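(* Let $M$ be a discretely ordered subring of a real closed field $R$, let $f\in M[X_1,\dots,X_n]$, and let $V\subseteq R^n$ be the real algebraic set defined by $f(X_1,\dots,X_n)=0$. Then $f(X_1,\dots,X_n)=0$ has a solution in some discretely ordered ring $N\supseteq M$ extending $M$ (as an ordered ring) if and only if $\widetilde V\subseteq\mathrm{Spec}_r(R[X_1,\dots,X_n])$ contains an $M$-arithmetical point.
   Context: Rings are commutative with identity. An ordered ring $(M,<)$ is discretely ordered if there is no $a\in M$ with $0<a<1$; "discretely ordered subring of $R$" means discretely ordered by the ordering induced from $R$. "$N$ extends $M$" means $M$ is a subring of $N$ and the ordering of $N$ restricts to that of $M$. Write $M^{\ge0}$ for the set of non-negative elements of $M$. $\mathrm{Spec}_r(A)$ is the real spectrum of a ring $A$, i.e. the set of prime cones $\alpha\subseteq A$, with $\mathrm{supp}(\alpha)=\alpha\cap-\alpha$. The cone $\alpha$ induces an ordering on the fraction field $k(\mathrm{supp}(\alpha))$ of $A/\mathrm{supp}(\alpha)$, and $k(\alpha)$ denotes its real closure; $f(\alpha)$ is the image of $f\in A$ in $A/\mathrm{supp}(\alpha)\subseteq k(\alpha)$. For a semialgebraic set $\mathcal S\subseteq R^n$ (defined by a formula also denoted $\mathcal S$), $\widetilde{\mathcal S}=\{\alpha\in\mathrm{Spec}_r(R[X_1,\dots,X_n]):k(\alpha)\models\mathcal S(X_1(\alpha),\dots,X_n(\alpha))\}$; in particular $\alpha\in\widetilde V$ iff $f(X_1(\alpha),\dots,X_n(\alpha))=0$ in $k(\alpha)$. For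 a ring $A\supseteq M$, $\alpha\in\mathrm{Spec}_r(A)$ is an $M$-discrete prime cone of $A$ if (i) $M^{\ge0}\subseteq\alpha$; (ii) $M^{\ge0}\cap\mathrm{supp}(\alpha)=\{0\}$; (iii) for every $f\in A$, if $f\in\alpha$ and $f\notin\mathrm{supp}(\alpha)$ then $f-1\in\alpha$. A point $\alpha\in\mathrm{Spec}_r(R[X_1,\dots,X_n])$ is an $M$-arithmetical point if $\alpha_M:=\alpha\cap M[X_1,\dots,X_n]$ is an $M$-discrete prime cone of $M[X_1,\dots,X_n]$. *)

theory Defs
  imports "HOL-Library.Poly_Mapping" "HOL-Algebra.Algebra"
begin

section \<open>Ordered rings and real closed fields\<close>

text \<open>Only total orders are considered. No strictness is imposed on products of positive elements,
  so zero divisors are not excluded a priori.\<close>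

record 'a oring = "'a ring" +
  leq :: "'a \<Rightarrow> 'a \<Rightarrow> bool" (infixl \<open>\<preceq>\<index>\<close> 50)

locale ordered_cring = cring R for R :: "('a, 'b) oring_scheme" (structure) +
  assumes leq_refl: "a \<in> carrier R \<Longrightarrow> a \<preceq> a"
    and leq_antisym: "\<lbrakk>a \<in> carrier R; b \<in> carrier R; a \<preceq> b; b \<preceq> a\<rbrakk> \<Longrightarrow> a = b"
    and leq_trans: "\<lbrakk>a \<in> carrier R; b \<in> carrier R; c \<in> carrier R; a \<preceq> b; b \<preceq> c\<rbrakk> \<Longrightarrow> a \<preceq> c"
    and leq_total: "\<lbrakk>a \<in> carrier R; b \<in> carrier R\<rbrakk> \<Longrightarrow> a \<preceq> b \<or> b \<preceq> a"
    and leq_add: "\<lbrakk>a \<in> carrier R; b \<in> carrier R; c \<in> carrier R; a \<preceq> b\<rbrakk> \<Longrightarrow> a \<oplus> c \<preceq> b \<oplus> c"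
    and leq_mult: "\<lbrakk>a \<in> carrier R; b \<in> carrier R; \<zero> \<preceq> a; \<zero> \<preceq> b\<rbrakk> \<Longrightarrow> \<zero> \<preceq> a \<otimes> b"

locale discretely_ordered_ring = ordered_cring +
  assumes discrete: "\<not> (\<exists>a \<in> carrier R. \<zero> \<preceq> a \<and> a \<noteq> \<zero> \<and> a \<preceq> \<one> \<and> a \<noteq> \<one>)"

locale real_closed_ordered_field = ordered_cring + field R +
  assumes nonneg_square: "\<lbrakk>a \<in> carrier R; \<zero> \<preceq> a\<rbrakk> \<Longrightarrow> \<exists>b \<in> carrier R. a = b \<otimes> b"
    and odd_degree_root:
      "\<lbrakk>p \<in> carrier (univ_poly R (carrier R)); odd (Polynomials.degree p)\<rbrakk>
        \<Longrightarrow> \<exists>a \<in> carrier R. eval p a = \<zero>"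

definition ordered_ring_embedding ::
    "('a, 'c) oring_scheme \<Rightarrow> ('b, 'd) oring_scheme \<Rightarrow> ('a \<Rightarrow> 'b) \<Rightarrow> bool" where
  "ordered_ring_embedding R S h \<longleftrightarrow>
     h \<in> ring_hom R S \<and> inj_on h (carrier R) \<and>
     (\<forall>a \<in> carrier R. \<forall>b \<in> carrier R. h a \<preceq>\<^bsub>S\<^esub> h b \<longleftrightarrow> a \<preceq>\<^bsub>R\<^esub> b)"

definition ring_of :: "'a::comm_ring_1 set \<Rightarrow> 'a ring" where
  "ring_of A = \<lparr>carrier = A, monoid.mult = (*), monoid.one = 1, ring.zero = 0, ring.add = (+)\<rparr>"

definition oring_of :: "'a::linordered_idom set \<Rightarrow> 'a oring" where
  "oring_of A = \<lparr>carrier = A, monoid.mult = (*), monoid.one = 1, ring.zero = 0, ring.add = (+), leq = (\<le>)\<rparr>"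

text \<open>The subfield of \<open>K\<close> formed by the fractions of elements of \<open>S\<close>, i.e. the fraction field of
  \<open>S\<close> whenever \<open>S\<close> is a subring of \<open>K\<close>.\<close>

definition fraction_subfield :: "('a, 'b) ring_scheme \<Rightarrow> 'a set \<Rightarrow> 'a set" where
  "fraction_subfield K S =
     {a \<otimes>\<^bsub>K\<^esub> inv\<^bsub>K\<^esub> b | a b. a \<in> S \<and> b \<in> S \<and> b \<noteq> \<zero>\<^bsub>K\<^esub>}"

text \<open>\<open>(K, \<iota>)\<close> is a real closure of the ordered fraction field of the ordered domain \<open>D\<close>. The order
  on that fraction field is the only one extending the order of \<open>D\<close>, so it suffices that \<open>\<iota>\<close>
  respects the latter.\<close>

definition real_closure_of_fractions ::
    "('a, 'c) oring_scheme \<Rightarrow> 'b oring \<times> ('a \<Rightarrow> 'b) \<Rightarrow> bool" where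
  "real_closure_of_fractions D = (\<lambda>(K, \<iota>).
     real_closed_ordered_field K \<and>
     ordered_ring_embedding D K \<iota> \<and>
     (\<forall>x \<in> carrier K. ring.algebraic K (fraction_subfield K (\<iota> ` carrier D)) x))"


section \<open>Polynomials in finitely many variables\<close>

text \<open>The variables are \<open>Var 0, \<dots>, Var (n - 1)\<close>.\<close>

type_synonym 'r mpoly = "(nat \<Rightarrow>\<^sub>0 nat) \<Rightarrow>\<^sub>0 'r"

definition Const :: "'r::comm_ring_1 \<Rightarrow> 'r mpoly" where
  "Const c = Poly_Mapping.single 0 c"

definition Var :: "nat \<Rightarrow> 'r::comm_ring_1 mpoly" where
  "Var i = Poly_Mapping.single (Poly_Mapping.single i 1) 1"

text \<open>\<open>mpolys M n\<close> is \<open>M[X\<^sub>0, \<dots>, X\<^bsub>n-1\<^esub>]\<close>.\<close>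

definition mpolys :: "'r::comm_ring_1 set \<Rightarrow> nat \<Rightarrow> 'r mpoly set" where
  "mpolys M n = {p. \<forall>m \<in> Poly_Mapping.keys p.
      Poly_Mapping.lookup p m \<in> M \<and> Poly_Mapping.keys m \<subseteq> {..<n}}"

text \<open>The value at \<open>x\<close> of the polynomial obtained from \<open>p\<close> by mapping its coefficients to \<open>S\<close>
  by \<open>h\<close>.\<close>

definition mpoly_eval ::
    "('s, 'b) ring_scheme \<Rightarrow> nat \<Rightarrow> ('r::comm_ring_1 \<Rightarrow> 's) \<Rightarrow> 'r mpoly \<Rightarrow> (nat \<Rightarrow> 's) \<Rightarrow> 's" where
  "mpoly_eval S n h p x =
     (\<Oplus>\<^bsub>S\<^esub> m \<in> Poly_Mapping.keys p.
        h (Poly_Mapping.lookup p m) \<otimes>\<^bsub>S\<^esub>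
        (\<Otimes>\<^bsub>S\<^esub> i \<in> {..<n}. x i [^]\<^bsub>S\<^esub> Poly_Mapping.lookup m i))"


section \<open>The real spectrum\<close>

definition prime_cone :: "'a::comm_ring_1 set \<Rightarrow> 'a set \<Rightarrow> bool" where
  "prime_cone A \<alpha> \<longleftrightarrow>
     \<alpha> \<subseteq> A \<and>
     (\<forall>a \<in> \<alpha>. \<forall>b \<in> \<alpha>. a + b \<in> \<alpha> \<and> a * b \<in> \<alpha>) \<and>
     (\<forall>a \<in> A. a * a \<in> \<alpha>) \<and>
     - 1 \<notin> \<alpha> \<and>
     (\<forall>a \<in> A. \<forall>b \<in> A. a * b \<in> \<alpha> \<longrightarrow> a \<in> \<alpha> \<or> - b \<in> \<alpha>)"

definition Spec_r :: "'a::comm_ring_1 set \<Rightarrow> 'a set set" where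
  "Spec_r A = {\<alpha>. prime_cone A \<alpha>}"

definition supp :: "'a::comm_ring_1 set \<Rightarrow> 'a set" where
  "supp \<alpha> = \<alpha> \<inter> uminus ` \<alpha>"

text \<open>\<open>A / supp(\<alpha>)\<close> with the order induced by \<open>\<alpha>\<close>, and the canonical map onto it.\<close>

definition residue_ring :: "'a::comm_ring_1 set \<Rightarrow> 'a set \<Rightarrow> 'a set oring" where
  "residue_ring A \<alpha> =
     ring.extend (ring_of A Quot supp \<alpha>)
       (oring.fields (\<lambda>B C. \<exists>x \<in> B. \<exists>y \<in> C. y - x \<in> \<alpha>))"

definition residue_class :: "'a::comm_ring_1 set \<Rightarrow> 'a set \<Rightarrow> 'a \<Rightarrow> 'a set" where
  "residue_class A \<alpha> g = supp \<alpha> +>\<^bsub>ring_of A\<^esub> g"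

text \<open>The field \<open>k(\<alpha>)\<close> for \<open>\<alpha>\<close> in the real spectrum of \<open>A = R[X\<^sub>0, \<dots>, X\<^bsub>n-1\<^esub>]\<close>, together with the
  embedding of \<open>A / supp(\<alpha>)\<close>. As \<open>R\<close> is infinite and embeds in \<open>A / supp(\<alpha>)\<close>, the real closure has
  the cardinality of \<open>R\<close>, so a copy of it lives on the type \<open>'r mpoly set\<close>. Hence, by the theorem of
  Artin and Schreier, the first alternative is the one that applies for every prime cone \<open>\<alpha>\<close>; the
  second one merely makes the definition independent of that theorem.\<close>

definition residue_real_closure ::
    "nat \<Rightarrow> 'r::linordered_field mpoly set
      \<Rightarrow> 'r mpoly set oring \<times> ('r mpoly set \<Rightarrow> 'r mpoly set)" where
  "residue_real_closure n \<alpha> =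
     (if \<exists>k :: 'r mpoly set oring \<times> ('r mpoly set \<Rightarrow> 'r mpoly set).
           real_closure_of_fractions (residue_ring (mpolys UNIV n) \<alpha>) k
      then SOME k. real_closure_of_fractions (residue_ring (mpolys UNIV n) \<alpha>) k
      else (residue_ring (mpolys UNIV n) \<alpha>, id))"

abbreviation k_field :: "nat \<Rightarrow> 'r::linordered_field mpoly set \<Rightarrow> 'r mpoly set oring" where
  "k_field n \<alpha> \<equiv> fst (residue_real_closure n \<alpha>)"

text \<open>\<open>k_value n \<alpha> g\<close> is \<open>g(\<alpha>)\<close>, an element of \<open>k(\<alpha>)\<close>.\<close>

definition k_value ::
    "nat \<Rightarrow> 'r::linordered_field mpoly set \<Rightarrow> 'r mpoly \<Rightarrow> 'r mpoly set" where
  "k_value n \<alpha> g = snd (residue_real_closure n \<alpha>) (residue_class (mpolys UNIV n) \<alpha> g)"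

text \<open>The set \<open>V~\<close> for the real algebraic set \<open>V\<close> given by \<open>f = 0\<close>: the points \<open>\<alpha>\<close> such that
  \<open>f(X\<^sub>0(\<alpha>), \<dots>, X\<^bsub>n-1\<^esub>(\<alpha>)) = 0\<close> holds in \<open>k(\<alpha>)\<close>, where \<open>c \<in> R\<close> acts as \<open>c(\<alpha>)\<close>.\<close>

definition tilde_zero_set ::
    "nat \<Rightarrow> 'r::linordered_field mpoly \<Rightarrow> 'r mpoly set set" where
  "tilde_zero_set n f =
     {\<alpha> \<in> Spec_r (mpolys UNIV n).
        mpoly_eval (k_field n \<alpha>) n (\<lambda>c. k_value n \<alpha> (Const c)) f (\<lambda>i. k_value n \<alpha> (Var i))
          = \<zero>\<^bsub>k_field n \<alpha>\<^esub>}"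


section \<open>Arithmetical points\<close>

definition discrete_prime_cone ::
    "'r::linordered_idom set \<Rightarrow> 'r mpoly set \<Rightarrow> 'r mpoly set \<Rightarrow> bool" where
  "discrete_prime_cone M A \<alpha> \<longleftrightarrow>
     \<alpha> \<in> Spec_r A \<and>
     Const ` {m \<in> M. 0 \<le> m} \<subseteq> \<alpha> \<and>
     Const ` {m \<in> M. 0 \<le> m} \<inter> supp \<alpha> = {0} \<and>
     (\<forall>g \<in> A. g \<in> \<alpha> \<and> g \<notin> supp \<alpha> \<longrightarrow> g - 1 \<in> \<alpha>)"

definition arithmetical_point ::
    "'r::linordered_field set \<Rightarrow> nat \<Rightarrow> 'r mpoly set \<Rightarrow> bool" where
  "arithmetical_point M n \<alpha> \<longleftrightarrow>
     \<alpha> \<in> Spec_r (mpolys UNIV n) \<and>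
     discrete_prime_cone M (mpolys M n) (\<alpha> \<inter> mpolys M n)"


section \<open>Solvability in discretely ordered extensions\<close>

text \<open>The ring \<open>N\<close> ranges over structures on one fixed type, and \<open>M\<close> is a subring of \<open>N\<close> up to the
  embedding \<open>j\<close>. In the type \<open>'r mpoly set + 'c\<close> used in the theorem the parameter \<open>'c\<close> is arbitrary, so
  that every extension of \<open>M\<close> occurs, up to isomorphism, for a suitable \<open>'c\<close>; the summand
  \<open>'r mpoly set\<close> ensures that the type is never too small, e.g. for the ring generated by \<open>M\<close> and
  finitely many elements of an extension.\<close>

definition solvable_in_extension ::
    "'r::linordered_idom set \<Rightarrow> nat \<Rightarrow> 'r mpoly \<Rightarrow> 'u oring \<Rightarrow> bool" where
  "solvable_in_extension M n f N \<longleftrightarrow>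
     (\<exists>j. ordered_ring_embedding (oring_of M) N j \<and>
        (\<exists>x \<in> {..<n} \<rightarrow> carrier N. mpoly_eval N n j f x = \<zero>\<^bsub>N\<^esub>))"

end

theory Submission
  imports Defs "HOL-Algebra.Algebraic_Closure_Type" "HOL-Computational_Algebra.Fraction_Field"
    "HOL-Computational_Algebra.Polynomial_FPS"
begin

text \<open>Let \<open>N\<close> be a discretely ordered ring extending \<open>M\<close> with a solution \<open>x\<close> of \<open>f = 0\<close>, and let \<open>\<beta>\<close> be the
set of all \<open>g \<in> M[X]\<close> with \<open>g(x) \<ge> 0\<close> in \<open>N\<close>. A positive element of \<open>N\<close> is at least \<open>1\<close>; this makes
\<open>N\<close> a domain, so \<open>\<beta>\<close> is a prime cone, and it is \<open>M\<close>-discrete with \<open>f\<close> in its support. In the other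
direction, an \<open>M\<close>-discrete prime cone \<open>\<beta>\<close> of \<open>M[X]\<close> with \<open>f\<close> in its support turns \<open>M[X]/supp(\<beta>)\<close> into
a discretely ordered ring that contains \<open>M\<close> and in which the residue classes of the variables solve
\<open>f = 0\<close>. Since \<open>g \<mapsto> g(\<alpha>)\<close> is the residue map followed by an embedding, a point \<open>\<alpha>\<close> lies in the set
defined by \<open>f\<close> iff \<open>f \<in> supp(\<alpha>)\<close> (\<open>tilde_zero_set_iff\<close>). The theorem therefore amounts to this: a prime
cone \<open>\<beta>\<close> of \<open>M[X]\<close> that induces the given order on \<open>M\<close> is the trace on \<open>M[X]\<close> of a prime cone of
\<open>R[X]\<close> (\<open>cone_extends\<close>).

If every finite set of polynomials in \<open>M[X]\<close> takes, at some point of \<open>R\<^sup>n\<close>, the signs that \<open>\<beta>\<close>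
prescribes, then some ultrafilter on \<open>R\<^sup>n\<close> contains all these sign conditions, and the polynomials that
are non-negative on one of its sets form the required cone. The points exist by transfer
(\<open>sign_transfer\<close>): the prescribed signs are those at a point over a real closed field, the real closure
of the fractions of \<open>M[X]/supp(\<beta>)\<close>, and a finite system of sign conditions over \<open>M\<close> that is solvable
over one real closed field extending \<open>M\<close> is solvable over every other. Variables are eliminated one at a time, by
the method of Cohen and Hoermander (\<open>sign_determination\<close>): the pattern of signs of finitely many
polynomials along a line depends only on the signs of finitely many expressions in their coefficients.

This elimination uses real closedness through the intermediate value property for polynomials. The
field \<open>R\<close> has it by Laplace's proof of the fundamental theorem of algebra (\<open>real_closed_imp_ivp\<close>). The
other field is a maximal ordered subfield of an algebraic closure, and has it because an ordering extends
to the field generated by a root of a polynomial of least degree that violates it (\<open>real_closure_ivp\<close>).\<close>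

section \<open>The intermediate value property for polynomials\<close>

text \<open>This is the form in which real closedness enters the elimination of variables. It is a predicate on a
  type, so that it can be assumed of the given field \<open>R\<close> as well as proved for a constructed one.\<close>
definition has_ivp :: "'a::linordered_field itself \<Rightarrow> bool" where
  "has_ivp _ \<longleftrightarrow> (\<forall>(p::'a poly) a b. a < b \<and> poly p a < 0 \<and> 0 < poly p b
      \<longrightarrow> (\<exists>x. a < x \<and> x < b \<and> poly p x = 0))"

lemma ivp_sign_change:
  fixes p :: "'a::linordered_field poly"
  assumes ivp: "has_ivp TYPE('a)" and ab: "a < b" and neg: "poly p a * poly p b < 0"
  shows "\<exists>x. a < x \<and> x < b \<and> poly p x = 0"
proof (cases "poly p a < 0")
  case True
  then have "poly p b > 0" using neg by (simp add: mult_less_0_iff)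
  with True ab ivp show ?thesis unfolding has_ivp_def by blast
next
  case False
  then have *: "poly p a > 0" "poly p b < 0" using neg by (auto simp add: mult_less_0_iff)
  then have "poly (- p) a < 0" "0 < poly (- p) b" by auto
  with ab ivp have "\<exists>x. a < x \<and> x < b \<and> poly (- p) x = 0" unfolding has_ivp_def by blast
  then show ?thesis by simp
qed

text \<open>Let \<open>a\<close> and \<open>b\<close> be adjacent roots and \<open>p = (X - a)\<^sup>m (X - b)\<^sup>k q\<close> with \<open>q(a), q(b) \<noteq> 0\<close>. Then \<open>q\<close> has
  the same sign at \<open>a\<close> and \<open>b\<close>, and \<open>p'\<close> is \<open>(X - a)\<^bsup>m-1\<^esup> (X - b)\<^bsup>k-1\<^esup>\<close> times a polynomial \<open>r\<close> with
  \<open>r(a) = m (a - b) q(a)\<close> and \<open>r(b) = k (b - a) q(b)\<close>, which changes sign. The usual argument by an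
  extremum would require compactness of the interval.\<close>
lemma ivp_rolle_adjacent:
  fixes p :: "'a::linordered_field poly"
  assumes ivp: "has_ivp TYPE('a)" and ab: "a < b" and roots: "poly p a = 0" "poly p b = 0"
    and p0: "p \<noteq> 0" and adj: "\<And>x. a < x \<Longrightarrow> x < b \<Longrightarrow> poly p x \<noteq> 0"
  shows "\<exists>x. a < x \<and> x < b \<and> poly (pderiv p) x = 0"
proof -
  obtain q1 where q1: "p = [:-a, 1:] ^ order a p * q1" "\<not> [:-a, 1:] dvd q1"
    using order_decomp[OF p0] by blast
  have q1': "q1 \<noteq> 0" "poly q1 a \<noteq> 0" using q1 p0 by (auto simp: poly_eq_0_iff_dvd)
  have "poly q1 b = 0"
    using roots(2) ab by (subst (asm) q1(1)) auto
  then have ob: "order b q1 \<noteq> 0" using q1' by (simp add: order_root)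
  obtain q where q: "q1 = [:-b, 1:] ^ order b q1 * q" "\<not> [:-b, 1:] dvd q"
    using order_decomp[OF q1'(1)] by blast
  have qb: "poly q b \<noteq> 0" using q(2) by (auto simp: poly_eq_0_iff_dvd)
  have qa: "poly q a \<noteq> 0" using q1'(2) by (subst (asm) q(1)) auto
  obtain m where m: "order a p = Suc m" using roots(1) p0 by (metis not0_implies_Suc order_root)
  obtain k where k: "order b q1 = Suc k" using ob not0_implies_Suc by blast
  define A where "A = [:-a, 1:]"
  define B where "B = [:-b, 1:]"
  have p_eq: "p = A ^ Suc m * (B ^ Suc k * q)" using q1(1) q(1) m k by (simp add: A_def B_def)
  have "poly q x \<noteq> 0" if "a < x" "x < b" for x
    using adj[OF that] by (subst (asm) p_eq) auto
  with ivp_sign_change[OF ivp ab, of q] have "\<not> poly q a * poly q b < 0" by blast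
  then have qq: "poly q a * poly q b > 0" using qa qb by (simp add: less_le not_less)
  define r where "r = smult (of_nat (Suc m)) (B * q) + smult (of_nat (Suc k)) (A * q) + A * B * pderiv q"
  have dA: "pderiv A = 1" and dB: "pderiv B = 1" by (simp_all add: A_def B_def pderiv_pCons)
  have "pderiv p = A ^ m * (B ^ k * r)"
    unfolding p_eq r_def pderiv_mult pderiv_power_Suc dA dB
    by (simp add: algebra_simps smult_add_left smult_add_right)
  moreover have "\<exists>x. a < x \<and> x < b \<and> poly r x = 0"
  proof (rule ivp_sign_change[OF ivp ab])
    have "poly r a * poly r b = - (of_nat (Suc m) * of_nat (Suc k) * (b - a) * (b - a)) * (poly q a * poly q b)"
      unfolding r_def A_def B_def by (simp add: algebra_simps)
    moreover have "of_nat (Suc m) * of_nat (Suc k) * (b - a) * (b - a) > 0" using ab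
      by (intro mult_pos_pos) (auto simp del: of_nat_Suc)
    ultimately show "poly r a * poly r b < 0" using qq by (simp add: mult_neg_pos)
  qed
  ultimately show ?thesis by auto
qed

lemma ivp_rolle:
  fixes p :: "'a::linordered_field poly"
  assumes ivp: "has_ivp TYPE('a)" and ab: "a < b" and roots: "poly p a = 0" "poly p b = 0"
  shows "\<exists>x. a < x \<and> x < b \<and> poly (pderiv p) x = 0"
proof (cases "p = 0")
  case True
  then show ?thesis using dense[OF ab] by auto
next
  case False
  define Z where "Z = {x. poly p x = (0::'a) \<and> a < x \<and> x \<le> b}"
  have fin: "finite Z" unfolding Z_def using poly_roots_finite[OF False] by (rule rev_finite_subset) auto
  have bZ: "b \<in> Z" using ab roots by (auto simp: Z_def)
  define c where "c = Min Z"
  have c: "c \<in> Z" and cmin: "\<And>x. x \<in> Z \<Longrightarrow> c \<le> x" using fin bZ Min_in unfolding c_def by auto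
  have "\<exists>x. a < x \<and> x < c \<and> poly (pderiv p) x = 0"
  proof (rule ivp_rolle_adjacent[OF ivp])
    show "a < c" "poly p c = 0" using c by (auto simp: Z_def)
    show "poly p x \<noteq> 0" if "a < x" "x < c" for x
      using cmin[of x] c that by (auto simp: Z_def)
  qed (use roots False in auto)
  then show ?thesis using c unfolding Z_def by force
qed

lemma ivp_mean_value:
  fixes p :: "'a::linordered_field poly"
  assumes ivp: "has_ivp TYPE('a)" and ab: "a < b"
  shows "\<exists>x. a < x \<and> x < b \<and> poly p b - poly p a = (b - a) * poly (pderiv p) x"
proof -
  define c where "c = (poly p b - poly p a) / (b - a)"
  have c: "c * (b - a) = poly p b - poly p a" using ab by (simp add: c_def)
  define h where "h = p - [: poly p a - c * a, c :]"
  have "\<exists>x. a < x \<and> x < b \<and> poly (pderiv h) x = 0"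
    by (rule ivp_rolle[OF ivp ab]) (use c in \<open>simp_all add: h_def algebra_simps\<close>)
  moreover have "poly (pderiv h) x = poly (pderiv p) x - c" for x
    by (simp add: h_def pderiv_diff pderiv_pCons)
  ultimately show ?thesis using c by (metis mult.commute right_minus_eq)
qed

lemma ivp_strict_mono:
  fixes p :: "'a::linordered_field poly"
  assumes ivp: "has_ivp TYPE('a)" and ab: "a < b"
    and d: "\<And>x. a < x \<Longrightarrow> x < b \<Longrightarrow> poly (pderiv p) x > 0"
  shows "poly p a < poly p b"
  using ivp_mean_value[OF ivp ab, of p] d ab by (metis diff_gt_0_iff_gt mult_pos_pos)

text \<open>Integer-valued, so that signs in two different fields can be compared.\<close>
definition sg :: "'a::linordered_idom \<Rightarrow> int" where
  "sg x = (if x < 0 then -1 else if x = 0 then 0 else 1)"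

lemma sg_simps [simp]: "sg 0 = 0" "sg 1 = 1" "sg (- x) = - sg x" "sg x = 0 \<longleftrightarrow> x = 0"
   "sg x = 1 \<longleftrightarrow> 0 < x" "sg x = - 1 \<longleftrightarrow> x < 0" "sg x < 0 \<longleftrightarrow> x < 0" "0 < sg x \<longleftrightarrow> 0 < x"
   "0 \<le> sg x \<longleftrightarrow> 0 \<le> x" "sg x \<le> 0 \<longleftrightarrow> x \<le> 0"
  by (auto simp: sg_def)

lemma sg_mult: "sg (x * y) = sg x * sg y"
  by (auto simp: sg_def mult_less_0_iff)

lemma sg_mono: "x \<le> y \<Longrightarrow> sg x \<le> sg y"
  by (auto simp: sg_def)

lemma sg_values: "sg x = -1 \<or> sg x = 0 \<or> sg x = 1" by (auto simp: sg_def)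

lemma sg_eq_pos: "sg x = sg y \<Longrightarrow> 0 < x \<longleftrightarrow> 0 < y" and sg_eq_neg: "sg x = sg y \<Longrightarrow> x < 0 \<longleftrightarrow> y < 0"
  and sg_eq_zero: "sg x = sg y \<Longrightarrow> x = 0 \<longleftrightarrow> y = 0"
  by (auto simp: sg_def split: if_splits)

lemma ivp_sg_const:
  fixes p :: "'a::linordered_field poly"
  assumes ivp: "has_ivp TYPE('a)" and ab: "a \<le> b"
    and d: "\<And>x. a \<le> x \<Longrightarrow> x \<le> b \<Longrightarrow> poly p x \<noteq> 0"
  shows "sg (poly p a) = sg (poly p b)"
proof (cases "a = b")
  case False
  with ab have ab: "a < b" by simp
  with ivp_sign_change[OF ivp this, of p] d have "\<not> poly p a * poly p b < 0" by (metis less_imp_le)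
  moreover have "poly p a \<noteq> 0" "poly p b \<noteq> 0" using d ab by auto
  ultimately show ?thesis by (auto simp: sg_def mult_less_0_iff)
qed auto

text \<open>The positive lower bound \<open>e\<close> is there for the induction: after multiplication by \<open>x\<close> the bound
  outgrows any constant term, which mere positivity would not give.\<close>
lemma poly_eventually_bounded_below:
  fixes p :: "'a::linordered_field poly"
  assumes "lead_coeff p > 0"
  shows "\<exists>W e. e > 0 \<and> (\<forall>x\<ge>W. poly p x \<ge> e)"
  using assms
proof (induction p)
  case 0 then show ?case by simp
next
  case (pCons a p)
  show ?case
  proof (cases "p = 0")
    case True then show ?thesis using pCons by auto
  next
    case False
    then obtain W e where We: "e > 0" "\<And>x. x \<ge> W \<Longrightarrow> poly p x \<ge> e" using pCons by auto
    have "poly (pCons a p) x \<ge> e" if x: "x \<ge> max (max W 0) ((e - a) / e)" for x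
    proof -
      have "x * e \<ge> e - a" using x We(1) by (simp add: pos_divide_le_eq)
      moreover have "x * e \<le> x * poly p x" using x We(2)[of x] by (intro mult_left_mono) auto
      ultimately show ?thesis by simp
    qed
    then show ?thesis using We(1) by blast
  qed
qed

lemma poly_pos_above:
  fixes p :: "'a::linordered_field poly"
  assumes "lead_coeff p > 0"
  shows "\<exists>x>c. poly p x > 0"
proof -
  obtain W e where We: "e > 0" "\<And>x. x \<ge> W \<Longrightarrow> poly p x \<ge> e"
    using poly_eventually_bounded_below[OF assms] by blast
  have "max W (c + 1) > c" by (meson less_add_one less_max_iff_disj)
  moreover have "poly p (max W (c + 1)) > 0" using We(1) We(2)[of "max W (c+1)"] by auto
  ultimately show ?thesis by blast
qed

lemma lead_coeff_pos_if_unbounded_pos: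
  fixes p :: "'a::linordered_field poly"
  assumes "\<And>x. x > c \<Longrightarrow> poly p x > 0"
  shows "lead_coeff p > 0"
proof (rule ccontr)
  assume "\<not> lead_coeff p > 0"
  moreover have "p \<noteq> 0" using assms[of "c+1"] by auto
  ultimately have "lead_coeff (- p) > 0"
    by (metis lead_coeff_minus leading_coeff_0_iff neg_0_less_iff_less not_less_iff_gr_or_eq)
  from poly_pos_above[OF this, of c] assms show False by force
qed

section \<open>Matching two ordered fields along the signs of polynomials\<close>

text \<open>A matching of two lines that are cut into the same sequence of convex cells: \<open>E x t\<close> means that \<open>x\<close> and
  \<open>t\<close> lie in corresponding cells. The cells are left implicit; by the last clause, two pairs either are in
  the same order on both lines or belong to one cell.\<close>
definition cellmatch :: "('a::linorder \<Rightarrow> 'b::linorder \<Rightarrow> bool) \<Rightarrow> bool" where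
  "cellmatch E \<longleftrightarrow> (\<forall>x. \<exists>t. E x t) \<and> (\<forall>t. \<exists>x. E x t) \<and>
     (\<forall>x t x' t'. E x t \<and> E x' t' \<and> x < x' \<longrightarrow> t < t' \<or> (E x t' \<and> E x' t))"

lemma cellmatch_converse:
  assumes "cellmatch E"
  shows "cellmatch (\<lambda>t x. E x t)"
proof -
  have "x < x' \<or> (E x' t \<and> E x t')" if "E x t" "E x' t'" "t < t'" for x t x' t'
    using assms that unfolding cellmatch_def by (metis neqE order_less_asym)
  then show ?thesis using assms unfolding cellmatch_def by blast
qed

text \<open>\<open>Z\<close> stands for an order isomorphism between finite sets of points of the two lines, in the
  applications the roots of corresponding polynomials.\<close>
definition same_position :: "('a::linordered_idom \<times> 'b::linordered_idom) set \<Rightarrow> 'a \<Rightarrow> 'b \<Rightarrow> bool" where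
  "same_position Z x t \<longleftrightarrow> (\<forall>(z, w)\<in>Z. sg (x - z) = sg (t - w))"

lemma same_position_less: "same_position Z x t \<Longrightarrow> (z, w) \<in> Z \<Longrightarrow> x < z \<longleftrightarrow> t < w"
  and same_position_greater: "same_position Z x t \<Longrightarrow> (z, w) \<in> Z \<Longrightarrow> z < x \<longleftrightarrow> w < t"
  and same_position_eq: "same_position Z x t \<Longrightarrow> (z, w) \<in> Z \<Longrightarrow> x = z \<longleftrightarrow> t = w"
  unfolding same_position_def sg_def by (force split: if_splits)+

lemma same_positionI:
  assumes "\<And>z w. (z, w) \<in> Z \<Longrightarrow> (x < z \<longleftrightarrow> t < w) \<and> (z < x \<longleftrightarrow> w < t)"
  shows "same_position Z x t"
proof -
  have "sg (x - z) = sg (t - w)" if "(z, w) \<in> Z" for z w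
    using assms[OF that] by (auto simp: sg_def)
  then show ?thesis unfolding same_position_def by blast
qed

text \<open>The points of \<open>Z\<close> include all roots of \<open>f'\<close> and \<open>g'\<close>, so \<open>f\<close> and \<open>g\<close> increase on the cells of \<open>x\<close> and
  \<open>t0\<close>. If \<open>f\<close> has a larger sign at \<open>x\<close> than \<open>g\<close> has at \<open>t0\<close>, then \<open>f\<close> is positive at the right end of
  its cell (or near infinity); so is \<open>g\<close>, since the signs agree on \<open>Z\<close> and at infinity, and \<open>g\<close> reaches the
  sign of \<open>f(x)\<close> on the way there by the intermediate value property.\<close>
lemma move_up:
  fixes f :: "'a::linordered_field poly" and g :: "'b::linordered_field poly"
  assumes ivpa: "has_ivp TYPE('a)" and ivpb: "has_ivp TYPE('b)"
    and fin: "finite Z"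
    and ord: "\<And>z w. (z, w) \<in> Z \<Longrightarrow> same_position Z z w"
    and rf: "\<And>z. poly (pderiv f) z = 0 \<Longrightarrow> \<exists>w. (z, w) \<in> Z"
    and rg: "\<And>w. poly (pderiv g) w = 0 \<Longrightarrow> \<exists>z. (z, w) \<in> Z"
    and sgz: "\<And>z w. (z, w) \<in> Z \<Longrightarrow> sg (poly f z) = sg (poly g w)"
    and lc: "sg (lead_coeff f) = sg (lead_coeff g)"
    and pos: "same_position Z x t0" and xZ: "\<And>w. (x, w) \<notin> Z"
    and fx: "poly (pderiv f) x > 0" and gt: "poly (pderiv g) t0 > 0"
    and less: "sg (poly g t0) < sg (poly f x)"
  shows "\<exists>t. sg (poly g t) = sg (poly f x) \<and> same_position Z x t"
proof -
  have fx0: "poly f x \<ge> 0" and gt0: "poly g t0 \<le> 0"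
    using less sg_values[of "poly f x"] sg_values[of "poly g t0"]
    by (auto simp: sg_def split: if_splits)
  have fpos: "poly (pderiv f) y > 0" if "x \<le> y" "\<And>z w. (z, w) \<in> Z \<Longrightarrow> x < z \<Longrightarrow> y < z" for y
  proof -
    have "poly (pderiv f) u \<noteq> 0" if "x \<le> u" "u \<le> y" for u
      using rf[of u] xZ \<open>\<And>z w. (z, w) \<in> Z \<Longrightarrow> x < z \<Longrightarrow> y < z\<close>[of u] that
      by (metis leD le_less)
    from ivp_sg_const[OF ivpa that(1) this] fx show ?thesis using sg_eq_pos by blast
  qed
  have gpos: "poly (pderiv g) s > 0" if "t0 \<le> s" "\<And>z w. (z, w) \<in> Z \<Longrightarrow> t0 < w \<Longrightarrow> s < w" for s
  proof -
    have "poly (pderiv g) u \<noteq> 0" if "t0 \<le> u" "u \<le> s" for u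
    proof
      assume "poly (pderiv g) u = 0"
      then obtain z where z: "(z, u) \<in> Z" using rg by blast
      then have "u \<noteq> t0" using pos same_position_eq xZ by blast
      then have "s < u" using z that \<open>\<And>z w. (z, w) \<in> Z \<Longrightarrow> t0 < w \<Longrightarrow> s < w\<close> by force
      with that show False by simp
    qed
    from ivp_sg_const[OF ivpb that(1) this] gt show ?thesis using sg_eq_pos by blast
  qed
  \<comment> \<open>\<open>W\<close> is the right end of the cell of \<open>t0\<close>, or a far away point if that cell is unbounded.\<close>
  have "\<exists>W>t0. poly g W > 0 \<and> (\<forall>(z, w)\<in>Z. t0 < w \<longrightarrow> W \<le> w)"
  proof (cases "\<exists>z w. (z, w) \<in> Z \<and> x < z")
    case True
    define S where "S = {z \<in> fst ` Z. x < z}"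
    have S: "finite S" "S \<noteq> {}" using fin True by (auto simp: S_def image_iff)
    define z where "z = Min S"
    have "z \<in> S" using Min_in[OF S] by (simp add: z_def)
    then obtain w where zw: "(z, w) \<in> Z" "x < z" by (auto simp: S_def)
    have zmin: "z \<le> z'" if "(z', w') \<in> Z" "x < z'" for z' w'
      using that S(1) unfolding z_def S_def by (intro Min_le) (auto simp: image_iff intro!: bexI[of _ "(z', w')"])
    have "poly f x < poly f z"
      by (rule ivp_strict_mono[OF ivpa zw(2)], rule fpos) (auto dest: zmin intro: less_le_trans)
    then have "poly g w > 0" using fx0 sgz[OF zw(1)] sg_eq_pos by fastforce
    moreover have "t0 < w" using pos zw same_position_less by blast
    moreover have "w \<le> w'" if "(z', w') \<in> Z" "t0 < w'" for z' w'
    proof -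
      have "x < z'" using pos that same_position_less by blast
      then have "z \<le> z'" using zmin that by blast
      then show ?thesis using ord[OF zw(1)] that(1) same_position_greater by (meson not_less)
    qed
    ultimately show ?thesis by blast
  next
    case False
    have "poly f y > 0" if "x < y" for y
    proof -
      have "poly f x < poly f y"
        by (rule ivp_strict_mono[OF ivpa that], rule fpos) (use False in auto)
      with fx0 show ?thesis by simp
    qed
    then have "lead_coeff f > 0" by (rule lead_coeff_pos_if_unbounded_pos)
    then have "lead_coeff g > 0" using lc sg_eq_pos by blast
    then obtain W where "W > t0" "poly g W > 0" using poly_pos_above by blast
    moreover have "\<not> t0 < w" if "(z, w) \<in> Z" for z w
      using False that pos same_position_less by blast
    ultimately show ?thesis by blast
  qed
  then obtain W where W: "W > t0" "poly g W > 0" "\<And>z w. (z, w) \<in> Z \<Longrightarrow> t0 < w \<Longrightarrow> W \<le> w" by blast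
  have gmono: "poly g s < poly g s'" if "t0 \<le> s" "s < s'" "s' \<le> W" for s s'
    by (rule ivp_strict_mono[OF ivpb that(2)], rule gpos) (use that in \<open>auto dest: W(3)\<close>)
  obtain r where r: "t0 \<le> r" "r < W" "poly g r = 0"
  proof (cases "poly g t0 = 0")
    case False
    then have "\<exists>r. t0 < r \<and> r < W \<and> poly g r = 0"
      using ivpb W(1,2) gt0 unfolding has_ivp_def by auto
    then show ?thesis using that by (meson less_imp_le)
  qed (use W that in blast)
  have "\<exists>t. t0 \<le> t \<and> t < W \<and> sg (poly g t) = sg (poly f x)"
  proof (cases "poly f x = 0")
    case True
    then show ?thesis using r by auto
  next
    case False
    then have "sg (poly f x) = 1" using fx0 by simp
    moreover obtain t where "r < t" "t < W" using dense r by blast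
    moreover have "poly g t > 0" using gmono[of r t] r calculation by simp
    ultimately show ?thesis using r by (metis less_imp_le order_trans sg_simps(5))
  qed
  then obtain t where t: "t0 \<le> t" "t < W" "sg (poly g t) = sg (poly f x)" by blast
  have "same_position Z x t"
  proof (rule same_positionI)
    fix z w assume zw: "(z, w) \<in> Z"
    have "x \<noteq> z" using zw xZ by blast
    then have "t0 \<noteq> w" using same_position_eq[OF pos zw] by simp
    have "t0 < w \<longleftrightarrow> t < w" using W(3)[OF zw] t by auto
    moreover have "w < t0 \<longleftrightarrow> w < t" 
    proof
      assume "w < t"
      show "w < t0"
      proof (rule ccontr)
        assume "\<not> w < t0"
        then show False using W(3)[OF zw] t \<open>t0 \<noteq> w\<close> \<open>w < t\<close> by auto
      qed
    qed (use t in auto)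
    ultimately show "(x < z \<longleftrightarrow> t < w) \<and> (z < x \<longleftrightarrow> w < t)"
      using same_position_less[OF pos zw] same_position_greater[OF pos zw] by simp
  qed
  with t show ?thesis by blast
qed

definition reflect :: "'a::comm_ring_1 poly \<Rightarrow> 'a poly" where
  "reflect p = p \<circ>\<^sub>p [:0, -1:]"

lemma poly_reflect [simp]: "poly (reflect p) x = poly p (- x)"
  by (simp add: reflect_def poly_pcompose)

lemma pderiv_reflect: "pderiv (reflect p) = - reflect (pderiv p)"
  by (simp add: reflect_def pderiv_pcompose pderiv_pCons)

lemma lead_coeff_reflect: 
  fixes p :: "'a::idom poly"
  shows "lead_coeff (reflect p) = (-1) ^ Polynomial.degree p * lead_coeff p"
  by (simp add: reflect_def lead_coeff_comp mult.commute)

lemma sg_power_minus_one: "sg ((-1) ^ n * x) = (-1) ^ n * sg x"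
  by (simp add: minus_one_power_iff)

text \<open>The four cases (\<open>f\<close> increasing or decreasing, sign to be raised or lowered) reduce to \<open>move_up\<close> by
  passing to \<open>- f, - g\<close> and by reflecting both lines at the origin.\<close>
lemma move:
  fixes f :: "'a::linordered_field poly" and g :: "'b::linordered_field poly"
  assumes ivpa: "has_ivp TYPE('a)" and ivpb: "has_ivp TYPE('b)"
    and fin: "finite Z"
    and ord: "\<And>z w. (z, w) \<in> Z \<Longrightarrow> same_position Z z w"
    and rf: "\<And>z. poly (pderiv f) z = 0 \<Longrightarrow> \<exists>w. (z, w) \<in> Z"
    and rg: "\<And>w. poly (pderiv g) w = 0 \<Longrightarrow> \<exists>z. (z, w) \<in> Z"
    and sgz: "\<And>z w. (z, w) \<in> Z \<Longrightarrow> sg (poly f z) = sg (poly g w)"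
    and lc: "sg (lead_coeff f) = sg (lead_coeff g)" and deg: "Polynomial.degree f = Polynomial.degree g"
    and pos: "same_position Z x t0" and xZ: "\<And>w. (x, w) \<notin> Z"
    and der: "sg (poly (pderiv f) x) = sg (poly (pderiv g) t0)"
  shows "\<exists>t. sg (poly g t) = sg (poly f x) \<and> same_position Z x t"
proof -
  have up: ?thesis if fg: "(f', g') = (f, g) \<or> (f', g') = (- f, - g)" and d: "poly (pderiv f') x > 0" for f' g'
  proof -
    have d': "poly (pderiv g') t0 > 0"
      using fg d sg_eq_pos[OF der] sg_eq_neg[OF der] by (auto simp: pderiv_minus)
    have lc': "sg (lead_coeff f') = sg (lead_coeff g')" and deg': "Polynomial.degree f' = Polynomial.degree g'"
      using fg lc deg by auto
    have sgz': "\<And>z w. (z, w) \<in> Z \<Longrightarrow> sg (poly f' z) = sg (poly g' w)"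
      using fg sgz by auto
    have rf': "\<And>z. poly (pderiv f') z = 0 \<Longrightarrow> \<exists>w. (z, w) \<in> Z"
      and rg': "\<And>w. poly (pderiv g') w = 0 \<Longrightarrow> \<exists>z. (z, w) \<in> Z"
      using fg rf rg by (auto simp: pderiv_minus)
    have "\<exists>t. sg (poly g' t) = sg (poly f' x) \<and> same_position Z x t"
    proof (cases "sg (poly g' t0)" "sg (poly f' x)" rule: linorder_cases)
      case less
      show ?thesis
        by (rule move_up[OF ivpa ivpb fin ord rf' rg' sgz' lc' pos xZ d d' less])
    next
      case equal
      then show ?thesis using pos by blast
    next
      case greater
      define Zr where "Zr = (\<lambda>(z, w). (- z, - w)) ` Z"
      have Zr: "(z, w) \<in> Zr \<longleftrightarrow> (- z, - w) \<in> Z" for z w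
        unfolding Zr_def by force
      have posr: "same_position Zr u v \<longleftrightarrow> same_position Z (- u) (- v)" for u v
      proof -
        have "sg (u + z) = sg (v + w) \<longleftrightarrow> sg (- u - z) = sg (- v - w)" for z w
          using sg_simps(3)[of "u + z"] sg_simps(3)[of "v + w"] by (simp add: algebra_simps)
        then show ?thesis unfolding same_position_def Zr_def by auto
      qed
      have "\<exists>t. sg (poly (- reflect g') t) = sg (poly (- reflect f') (- x)) \<and> same_position Zr (- x) t"
      proof (rule move_up[OF ivpa ivpb, where ?t0.0 = "- t0"])
        show "finite Zr" unfolding Zr_def using fin by simp
        show "same_position Zr z w" if "(z, w) \<in> Zr" for z w
          using that ord unfolding Zr posr by blast
        show "\<exists>w. (z, w) \<in> Zr" if "poly (pderiv (- reflect f')) z = 0" for z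
          using rf'[of "- z"] that unfolding Zr by (metis pderiv_minus pderiv_reflect minus_minus poly_reflect)
        show "\<exists>z. (z, w) \<in> Zr" if "poly (pderiv (- reflect g')) w = 0" for w
          using rg'[of "- w"] that unfolding Zr by (metis pderiv_minus pderiv_reflect minus_minus poly_reflect)
        show "sg (poly (- reflect f') z) = sg (poly (- reflect g') w)" if "(z, w) \<in> Zr" for z w
          using that sgz' unfolding Zr by simp
        show "sg (lead_coeff (- reflect f')) = sg (lead_coeff (- reflect g'))"
          using lc' deg' by (simp only: lead_coeff_minus lead_coeff_reflect sg_simps(3) sg_power_minus_one)
        show "same_position Zr (- x) (- t0)" using pos by (simp add: posr)
        show "(- x, w) \<notin> Zr" for w using xZ by (simp add: Zr)
        show "0 < poly (pderiv (- reflect f')) (- x)" "0 < poly (pderiv (- reflect g')) (- t0)"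
          using d d' by (simp_all add: pderiv_minus pderiv_reflect)
        show "sg (poly (- reflect g') (- t0)) < sg (poly (- reflect f') (- x))"
          using greater by simp
      qed
      then show ?thesis by (auto simp: posr)
    qed
    then show ?thesis using fg by auto
  qed
  have "\<not> (\<exists>w. (x, w) \<in> Z)" using xZ by blast
  then have "poly (pderiv f) x \<noteq> 0" using rf by blast
  then consider "poly (pderiv f) x > 0" | "poly (pderiv (- f)) x > 0" by (auto simp: pderiv_minus) (metis neqE)
  then show ?thesis using up by cases blast+
qed

definition sg_agree :: "('a::linordered_idom \<Rightarrow> 'b::linordered_idom \<Rightarrow> bool) \<Rightarrow> ('a poly \<times> 'b poly) \<Rightarrow> bool" where
  "sg_agree E = (\<lambda>(u, v). \<forall>x t. E x t \<longrightarrow> sg (poly u x) = sg (poly v t))"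

lemma infinite_roots_imp_zero:
  fixes u :: "'a::linordered_field poly"
  assumes "a < b" "\<And>x. a < x \<Longrightarrow> x < b \<Longrightarrow> poly u x = 0"
  shows "u = 0"
proof (rule ccontr)
  assume "u \<noteq> 0"
  then have "finite {x. poly u x = 0}" by (rule poly_roots_finite)
  then have "finite {a<..<b}" by (rule rev_finite_subset) (use assms in auto)
  then show False using infinite_Ioo[OF assms(1)] by blast
qed

text \<open>The inductive step of the elimination: a matching for a family \<open>P\<close> that contains the derivatives of \<open>f\<close>
  and \<open>g\<close> is refined to one that also respects the signs of \<open>f\<close> and \<open>g\<close>. A root of a non-zero member of
  \<open>P\<close> is alone in its cell, hence has exactly one partner; \<open>Z\<close> collects these pairs, and at them \<open>f\<close> and \<open>g\<close>
  have equal signs by assumption. The new matching \<open>E'\<close> relates points with the same position relative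
  to \<open>Z\<close> and the same sign of \<open>f\<close> and \<open>g\<close>. Partners exist by \<open>move\<close>. The order condition holds because
  between neighbouring points of \<open>Z\<close> both \<open>f\<close> and \<open>g\<close> are strictly monotone, in the same direction.\<close>
lemma cellmatch_extend:
  fixes f :: "'a::linordered_field poly" and g :: "'b::linordered_field poly"
  assumes ivpa: "has_ivp TYPE('a)" and ivpb: "has_ivp TYPE('b)"
    and E: "cellmatch E" and fin: "finite P" and agree: "\<And>uv. uv \<in> P \<Longrightarrow> sg_agree E uv"
    and deriv: "(pderiv f, pderiv g) \<in> P" and dnz: "pderiv f \<noteq> 0"
    and lc: "sg (lead_coeff f) = sg (lead_coeff g)" and deg: "Polynomial.degree f = Polynomial.degree g"
    and at_zero: "\<And>u v z w. (u, v) \<in> P \<Longrightarrow> u \<noteq> 0 \<Longrightarrow> E z w \<Longrightarrow> poly u z = 0 \<Longrightarrow> sg (poly f z) = sg (poly g w)"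
  shows "\<exists>E'. cellmatch E' \<and> (\<forall>uv\<in>insert (f, g) P. sg_agree E' uv)"
proof -
  have tot: "\<exists>t. E x t" and tot': "\<exists>x. E x t" for x t using E unfolding cellmatch_def by blast+
  have Eord: "t < t' \<or> (E x t' \<and> E x' t)" if "E x t" "E x' t'" "x < x'" for x t x' t'
    using E that unfolding cellmatch_def by blast
  have Eord': "x < x' \<or> (E x t' \<and> E x' t)" if "E x t" "E x' t'" "t < t'" for x t x' t'
    using cellmatch_converse[OF E] that unfolding cellmatch_def by blast
  have agr: "sg (poly u x) = sg (poly v t)" if "(u, v) \<in> P" "E x t" for u v x t
    using agree[OF that(1)] that(2) unfolding sg_agree_def by blast
  have root_iff: "poly u x = 0 \<longleftrightarrow> poly v t = 0" if "(u, v) \<in> P" "E x t" for u v x t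
    using agr[OF that] sg_eq_zero by blast
  have zero_iff: "u = 0 \<longleftrightarrow> v = 0" if "(u, v) \<in> P" for u v
  proof
    assume "u = 0"
    then have "poly v t = 0" for t using root_iff[OF that] tot'[of t] by auto
    then show "v = 0" by (rule infinite_roots_imp_zero[OF zero_less_one])
  next
    assume "v = 0"
    then have "poly u x = 0" for x using root_iff[OF that] tot[of x] by auto
    then show "u = 0" by (rule infinite_roots_imp_zero[OF zero_less_one])
  qed
  \<comment> \<open>a root is alone in its cell\<close>
  have inj2: "w = w'" if uv: "(u, v) \<in> P" "u \<noteq> 0" and z: "E z w" "E z w'" "poly u z = 0" for u v z w w'
  proof (rule ccontr)
    have *: False if "E z w" "E z w'" "w < w'" for w w'
    proof -
      have "E z s" if "w < s" "s < w'" for s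
      proof -
        obtain x where x: "E x s" using tot' by blast
        show ?thesis
          using Eord'[OF \<open>E z w\<close> x that(1)] Eord'[OF x \<open>E z w'\<close> that(2)] by (metis order_less_asym)
      qed
      then have "poly v s = 0" if "w < s" "s < w'" for s using that root_iff[OF uv(1)] z(3) by blast
      then have "v = 0" using infinite_roots_imp_zero[OF \<open>w < w'\<close>] by blast
      then show False using uv zero_iff by blast
    qed
    assume "w \<noteq> w'"
    then show False using * z by (metis neqE)
  qed
  have inj1: "z = z'" if uv: "(u, v) \<in> P" "u \<noteq> 0" and z: "E z w" "E z' w" "poly u z = 0" for u v z z' w
  proof (rule ccontr)
    have *: False if "E z w" "E z' w" "z < z'" "poly u z = 0" for z z'
    proof -
      have "E x w" if "z < x" "x < z'" for x
      proof -
        obtain s where s: "E x s" using tot by blast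
        show ?thesis
          using Eord[OF \<open>E z w\<close> s that(1)] Eord[OF s \<open>E z' w\<close> that(2)] by (metis order_less_asym)
      qed
      then have "poly u x = 0" if "z < x" "x < z'" for x using that root_iff[OF uv(1)] \<open>E z w\<close> \<open>poly u z = 0\<close> by blast
      then have "u = 0" using infinite_roots_imp_zero[OF \<open>z < z'\<close>] by blast
      then show False using uv by blast
    qed
    assume "z \<noteq> z'"
    moreover have "poly u z' = 0" using root_iff[OF uv(1)] z by blast
    ultimately show False using * z by (metis neqE)
  qed
  define Z where "Z = {(z, w). E z w \<and> (\<exists>(u, v)\<in>P. u \<noteq> 0 \<and> poly u z = 0)}"
  have Z1: "(z, w) \<in> Z" if "(u, v) \<in> P" "u \<noteq> 0" "E z w" "poly u z = 0" for u v z w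
    using that unfolding Z_def by blast
  have Z2: "(z, w) \<in> Z" if "(u, v) \<in> P" "u \<noteq> 0" "E z w" "poly v w = 0" for u v z w
    using that root_iff unfolding Z_def by blast
  have ZE: "\<exists>u v. (u, v) \<in> P \<and> u \<noteq> 0 \<and> E z w \<and> poly u z = 0" if "(z, w) \<in> Z" for z w
    using that unfolding Z_def by blast
  have ZE1: "E z w" if "(z, w) \<in> Z" for z w using that unfolding Z_def by blast
  have Zfun: "w = w'" if "(z, w) \<in> Z" "E z w'" for z w w'
    using ZE[OF that(1)] inj2 that(2) by blast
  have Zinj: "z = z'" if "(z, w) \<in> Z" "E z' w" for z z' w
    using ZE[OF that(1)] inj1 that(2) by blast
  have finZ: "finite Z"
  proof -
    have "finite (\<Union>(u, v)\<in>P. if u = 0 then {} else {z. poly u z = 0})"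
      using fin poly_roots_finite by auto
    then have "finite (fst ` Z)"
      by (rule rev_finite_subset) (auto simp: Z_def split: if_splits)
    moreover have "inj_on fst Z"
      unfolding inj_on_def using Zfun ZE1 by (metis prod.collapse)
    ultimately show ?thesis by (rule finite_imageD)
  qed
  have posE: "same_position Z x t" if xt: "E x t" for x t
  proof (rule same_positionI)
    fix z w assume zw: "(z, w) \<in> Z"
    have Ezw: "E z w" using ZE[OF zw] by blast
    have "x = z \<longleftrightarrow> t = w" using xt Zfun[OF zw] Zinj[OF zw] by blast
    moreover have "t < w" if "x < z" using Eord[OF xt Ezw that] Zinj[OF zw, of x] that by blast
    moreover have "w < t" if "z < x" using Eord[OF Ezw xt that] Zinj[OF zw, of x] that by blast
    ultimately show "(x < z \<longleftrightarrow> t < w) \<and> (z < x \<longleftrightarrow> w < t)" by (metis neqE order_less_asym)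
  qed
  define E' where "E' x t \<longleftrightarrow> same_position Z x t \<and> sg (poly f x) = sg (poly g t)" for x t
  have EE': "E' x t" if "E x t" "sg (poly f x) = sg (poly g t)" for x t
    using that posE by (simp add: E'_def)
  have atZ: "sg (poly f z) = sg (poly g w)" if "(z, w) \<in> Z" for z w
    using ZE[OF that] at_zero by blast
  have ord: "same_position Z z w" if "(z, w) \<in> Z" for z w using ZE[OF that] posE by blast
  have rf: "\<exists>w. (z, w) \<in> Z" if "poly (pderiv f) z = 0" for z
    using Z1[OF deriv dnz _ that] tot[of z] by blast
  have rg: "\<exists>z. (z, w) \<in> Z" if "poly (pderiv g) w = 0" for w
    using Z2[OF deriv dnz _ that] tot'[of w] by blast
  have tot1: "\<exists>t. E' x t" for x
  proof -
    obtain t0 where t0: "E x t0" using tot by blast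
    show ?thesis
    proof (cases "\<exists>w. (x, w) \<in> Z")
      case True
      then have "(x, t0) \<in> Z" using Zfun t0 by blast
      then show ?thesis using EE' t0 atZ by blast
    next
      case False
      have "\<exists>t. sg (poly g t) = sg (poly f x) \<and> same_position Z x t"
        by (rule move[OF ivpa ivpb finZ ord rf rg atZ lc deg posE[OF t0]]) (use False agr[OF deriv t0] in auto)
      then show ?thesis unfolding E'_def by metis
    qed
  qed
  have tot2: "\<exists>x. E' x t" for t
  proof -
    obtain x0 where x0: "E x0 t" using tot' by blast
    show ?thesis
    proof (cases "\<exists>z. (z, t) \<in> Z")
      case True
      then have "(x0, t) \<in> Z" using Zinj x0 by blast
      then show ?thesis using EE' x0 atZ by blast
    next
      case False
      have pc: "same_position (Z\<inverse>) t x \<longleftrightarrow> same_position Z x t" for x t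
      proof -
        have "(sg (t - w) = sg (x - z)) = (sg (x - z) = sg (t - w))" for z w by auto
        moreover have "(\<forall>(w, z)\<in>Z\<inverse>. Q w z) \<longleftrightarrow> (\<forall>(z, w)\<in>Z. Q w z)" for Q by blast
        ultimately show ?thesis unfolding same_position_def by presburger
      qed
      have "\<exists>x. sg (poly f x) = sg (poly g t) \<and> same_position (Z\<inverse>) t x"
      proof (rule move[OF ivpb ivpa, where ?t0.0 = x0])
        show "finite (Z\<inverse>)" using finZ by simp
      qed (use False agr[OF deriv x0] ord rf rg atZ lc deg posE[OF x0] in \<open>simp_all add: pc\<close>)
      then show ?thesis unfolding E'_def pc by blast
    qed
  qed
  have agr': "sg (poly u x) = sg (poly v t)" if uv: "(u, v) \<in> P" and xt: "E' x t" for u v x t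
  proof -
    obtain t1 where t1: "E x t1" using tot by blast
    have pos: "same_position Z x t" "same_position Z x t1" using xt posE[OF t1] by (auto simp: E'_def)
    have "sg (poly v t) = sg (poly v t1)"
    proof (cases "t = t1 \<or> v = 0")
      case False
      then have u0: "u \<noteq> 0" using zero_iff[OF uv] by blast
      have nr: "poly v s \<noteq> 0" if s: "min t t1 \<le> s" "s \<le> max t t1" for s
      proof
        assume "poly v s = 0"
        then obtain z where z: "(z, s) \<in> Z" using Z2[OF uv u0] tot' by blast
        have "s < t \<longleftrightarrow> s < t1" "t < s \<longleftrightarrow> t1 < s" "t = s \<longleftrightarrow> t1 = s"
          using same_position_less[OF _ z] same_position_greater[OF _ z] same_position_eq[OF _ z] pos by metis+
        with s False show False by (auto simp: min_def max_def split: if_splits)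
      qed
      show ?thesis
        using ivp_sg_const[OF ivpb, of "min t t1" "max t t1" v] nr by (cases "t \<le> t1") (auto simp: min_def max_def)
    qed auto
    then show ?thesis using agr[OF uv t1] by simp
  qed
  have ord': "t < t' \<or> (E' x t' \<and> E' x' t)" if xt: "E' x t" and xt': "E' x' t'" and less: "x < x'" for x t x' t'
  proof -
    have pos: "same_position Z x t" "same_position Z x' t'" using xt xt' by (auto simp: E'_def)
    have sgs: "sg (poly f x) = sg (poly g t)" "sg (poly f x') = sg (poly g t')" using xt xt' by (auto simp: E'_def)
    show ?thesis
    proof (cases "\<exists>z w. (z, w) \<in> Z \<and> x \<le> z \<and> z \<le> x'")
      case True
      then obtain z w where zw: "(z, w) \<in> Z" "x \<le> z" "z \<le> x'" by blast
      have "t \<le> w" "w \<le> t'" "t \<noteq> w \<or> t' \<noteq> w"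
        using same_position_less[OF _ zw(1)] same_position_greater[OF _ zw(1)] same_position_eq[OF _ zw(1)] pos zw less
        by (metis leD leI order_less_irrefl)+
      then show ?thesis by auto
    next
      case False
      have Zc: "x < z \<longleftrightarrow> x' < z" "z < x \<longleftrightarrow> z < x'" "z \<noteq> x" "z \<noteq> x'" if "(z, w) \<in> Z" for z w
      proof -
        have "z < x \<or> x' < z" using that False by (meson not_less)
        then show "x < z \<longleftrightarrow> x' < z" "z < x \<longleftrightarrow> z < x'" "z \<noteq> x" "z \<noteq> x'" using less by auto
      qed
      have Zt: "t < w \<longleftrightarrow> t' < w" "w < t \<longleftrightarrow> w < t'" "w \<noteq> t" if "(z, w) \<in> Z" for z w
        using Zc[OF that] same_position_less[OF _ that] same_position_greater[OF _ that] same_position_eq[OF _ that] pos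
        by metis+
      have samecell: "same_position Z x' t" "same_position Z x t'"
        by (rule same_positionI; use Zc same_position_less[OF pos(1)] same_position_greater[OF pos(1)]
            same_position_less[OF pos(2)] same_position_greater[OF pos(2)] in blast)+
      show ?thesis
      proof (cases "sg (poly f x) = sg (poly f x')")
        case True
        then show ?thesis using samecell sgs by (simp add: E'_def)
      next
        case sdiff: False
        have ndf: "poly (pderiv f) y \<noteq> 0" if "x \<le> y" "y \<le> x'" for y
          using rf[of y] Zc that False by blast
        \<comment> \<open>Replacing \<open>f\<close> and \<open>g\<close> by their negatives reduces to the case that both are increasing.\<close>
        have main: "t < t'" if fg: "(f', g') = (f, g) \<or> (f', g') = (- f, - g)" and d: "poly (pderiv f') x > 0" for f' g'
        proof (rule ccontr)
          assume "\<not> t < t'"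
          have sgs': "sg (poly f' x) = sg (poly g' t)" "sg (poly f' x') = sg (poly g' t')" 
            and sdiff': "sg (poly f' x) \<noteq> sg (poly f' x')" using fg sgs sdiff by auto
          have ndf': "poly (pderiv f') y \<noteq> 0" if "x \<le> y" "y \<le> x'" for y
            using fg ndf[OF that] by (auto simp: pderiv_minus)
          have "poly f' x < poly f' x'"
          proof (rule ivp_strict_mono[OF ivpa less])
            fix y assume y: "x < y" "y < x'"
            have "sg (poly (pderiv f') x) = sg (poly (pderiv f') y)"
              by (rule ivp_sg_const[OF ivpa]) (use ndf' y in auto)
            then show "poly (pderiv f') y > 0" using d sg_eq_pos by blast
          qed
          then have "sg (poly f' x) < sg (poly f' x')" using sg_mono[of "poly f' x" "poly f' x'"] sdiff' by linarith
          then have "sg (poly g' t) < sg (poly g' t')" using sgs' by simp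
          then have gt: "poly g' t < poly g' t'" using sg_mono by (metis not_less)
          then have tt: "t' < t" using \<open>\<not> t < t'\<close> by (metis neqE order_less_irrefl)
          have "sg (poly (pderiv f) x) = sg (poly (pderiv g) t)" using agr'[OF deriv xt] .
          then have "sg (poly (pderiv f') x) = sg (poly (pderiv g') t)" using fg by (auto simp: pderiv_minus)
          then have dt: "poly (pderiv g') t > 0" using d sg_eq_pos by blast
          have ndg: "poly (pderiv g') s \<noteq> 0" if "t' \<le> s" "s \<le> t" for s
            using fg rg[of s] Zt that by (auto simp: pderiv_minus) (metis not_less order_less_le)+
          have "poly g' t' < poly g' t"
          proof (rule ivp_strict_mono[OF ivpb tt])
            fix s assume s: "t' < s" "s < t"
            have "sg (poly (pderiv g') s) = sg (poly (pderiv g') t)"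
              by (rule ivp_sg_const[OF ivpb]) (use ndg s in auto)
            then show "poly (pderiv g') s > 0" using dt sg_eq_pos by blast
          qed
          then show False using gt by simp
        qed
        have "poly (pderiv f) x > 0 \<or> poly (pderiv (- f)) x > 0"
          using ndf[of x] less by (auto simp: pderiv_minus)
        then show ?thesis using main by blast
      qed
    qed
  qed
  have "cellmatch E'" unfolding cellmatch_def using tot1 tot2 ord' by blast
  moreover have "sg_agree E' uv" if "uv \<in> insert (f, g) P" for uv
    using that agr' by (auto simp: sg_agree_def E'_def)
  ultimately show ?thesis by blast
qed

section \<open>Sign determination in one variable\<close>

definition subring_set :: "'c::comm_ring_1 set \<Rightarrow> bool" where
  "subring_set A \<longleftrightarrow> 0 \<in> A \<and> 1 \<in> A \<and> (\<forall>x\<in>A. - x \<in> A) \<and> (\<forall>x\<in>A. \<forall>y\<in>A. x + y \<in> A \<and> x * y \<in> A)"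

text \<open>Homomorphisms on a subring of a type: the coefficient rings \<open>M[X\<^sub>0, \<dots>, X\<^bsub>k-1\<^esub>]\<close> of the elimination
  are proper subrings of the type of all polynomials.\<close>
definition hom_on :: "'c::comm_ring_1 set \<Rightarrow> ('c \<Rightarrow> 'd::comm_ring_1) \<Rightarrow> bool" where
  "hom_on A e \<longleftrightarrow> e 1 = 1 \<and> (\<forall>x\<in>A. \<forall>y\<in>A. e (x + y) = e x + e y \<and> e (x * y) = e x * e y)"

lemma subring_setD:
  assumes "subring_set A"
  shows "0 \<in> A" "1 \<in> A" "x \<in> A \<Longrightarrow> - x \<in> A" "x \<in> A \<Longrightarrow> y \<in> A \<Longrightarrow> x + y \<in> A"
    "x \<in> A \<Longrightarrow> y \<in> A \<Longrightarrow> x * y \<in> A" "x \<in> A \<Longrightarrow> y \<in> A \<Longrightarrow> x - y \<in> A"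
  using assms unfolding subring_set_def by (auto simp: diff_conv_add_uminus simp del: add_uminus_conv_diff)

lemma subring_set_of_nat: "subring_set A \<Longrightarrow> of_nat n \<in> A"
  by (induction n) (auto intro: subring_setD)

lemma subring_set_sum: "subring_set A \<Longrightarrow> (\<And>i. i \<in> I \<Longrightarrow> f i \<in> A) \<Longrightarrow> sum f I \<in> A"
  by (induction I rule: infinite_finite_induct) (auto intro: subring_setD)

lemma subring_set_prod: "subring_set A \<Longrightarrow> (\<And>i. i \<in> I \<Longrightarrow> f i \<in> A) \<Longrightarrow> prod f I \<in> A"
  by (induction I rule: infinite_finite_induct) (auto intro: subring_setD)

lemma subring_set_power: "subring_set A \<Longrightarrow> x \<in> A \<Longrightarrow> x ^ n \<in> A"
  by (induction n) (auto intro: subring_setD)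

lemma hom_onD:
  assumes "subring_set A" "hom_on A e"
  shows "e 1 = 1" "e 0 = 0" "x \<in> A \<Longrightarrow> y \<in> A \<Longrightarrow> e (x + y) = e x + e y"
    "x \<in> A \<Longrightarrow> y \<in> A \<Longrightarrow> e (x * y) = e x * e y" 
    "x \<in> A \<Longrightarrow> e (- x) = - e x" "x \<in> A \<Longrightarrow> y \<in> A \<Longrightarrow> e (x - y) = e x - e y"
proof -
  note A = subring_setD[OF assms(1)]
  show 1: "e 1 = 1" and add: "x \<in> A \<Longrightarrow> y \<in> A \<Longrightarrow> e (x + y) = e x + e y"
    and "x \<in> A \<Longrightarrow> y \<in> A \<Longrightarrow> e (x * y) = e x * e y" for x y
    using assms(2) by (auto simp: hom_on_def)
  have "e (0 + 0) = e 0 + e 0" by (rule add) (rule A)+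
  then show 0: "e 0 = 0" by simp
  show neg: "e (- x) = - e x" if "x \<in> A" for x
    using add[OF that A(3)[OF that]] 0 by (simp add: minus_unique)
  show "e (x - y) = e x - e y" if "x \<in> A" "y \<in> A" for x y
    using add[OF that(1) A(3)[OF that(2)]] neg[OF that(2)] by simp
qed

lemma hom_on_of_nat: "subring_set A \<Longrightarrow> hom_on A e \<Longrightarrow> e (of_nat n) = of_nat n"
  by (induction n) (auto simp: hom_onD subring_setD subring_set_of_nat)

lemma hom_on_sum: "subring_set A \<Longrightarrow> hom_on A e \<Longrightarrow> (\<And>i. i \<in> I \<Longrightarrow> f i \<in> A) \<Longrightarrow> e (sum f I) = (\<Sum>i\<in>I. e (f i))"
  by (induction I rule: infinite_finite_induct) (auto simp: hom_onD subring_set_sum)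

definition polys_over :: "'c::comm_ring_1 set \<Rightarrow> 'c poly set" where
  "polys_over A = {p. \<forall>i. coeff p i \<in> A}"

text \<open>One step of pseudo-division. At a root of \<open>g\<close> its value is \<open>lead_coeff g\<close> times that of \<open>p\<close>, so its sign
  determines the sign of \<open>p\<close> at the roots of \<open>g\<close>, and its degree is smaller than that of \<open>p\<close>.\<close>
definition reduct :: "'c::comm_ring_1 poly \<Rightarrow> 'c poly \<Rightarrow> 'c poly" where
  "reduct p g = smult (lead_coeff g) p -
     monom (lead_coeff p) (Polynomial.degree p - Polynomial.degree g) * g"

lemma degree_reduct_less:
  assumes "Polynomial.degree g \<le> Polynomial.degree p" "0 < Polynomial.degree p"
  shows "Polynomial.degree (reduct p g) < Polynomial.degree p"
proof -
  let ?k = "Polynomial.degree p - Polynomial.degree g"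
  have "Polynomial.degree (monom (lead_coeff p) ?k * g) \<le> ?k + Polynomial.degree g"
    by (meson add_mono_thms_linordered_semiring(3) degree_monom_le degree_mult_le order_trans)
  then have "Polynomial.degree (reduct p g) \<le> Polynomial.degree p"
    unfolding reduct_def using assms(1) by (intro degree_diff_le) (auto intro: order_trans[OF degree_smult_le])
  moreover have "coeff (reduct p g) (Polynomial.degree p) = 0"
    using assms(1) by (simp add: reduct_def coeff_monom_mult mult.commute[of "lead_coeff g"])
  ultimately show ?thesis using assms(2)
    by (metis degree_0 le_neq_implies_less leading_coeff_0_iff)
qed

lemma reduct_over:
  assumes "subring_set A" "p \<in> polys_over A" "g \<in> polys_over A"
  shows "reduct p g \<in> polys_over A"
  using assms by (auto simp: polys_over_def reduct_def coeff_monom_mult subring_setD)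

lemma map_poly_reduct:
  assumes A: "subring_set A" and e: "hom_on A e" and p: "p \<in> polys_over A" and g: "g \<in> polys_over A"
  shows "map_poly e (reduct p g) = smult (e (lead_coeff g)) (map_poly e p) -
     monom (e (lead_coeff p)) (Polynomial.degree p - Polynomial.degree g) * map_poly e g"
  using assms 
  by (intro poly_eqI) (auto simp: polys_over_def reduct_def coeff_monom_mult coeff_map_poly hom_onD subring_setD)

lemma pderiv_over:
  fixes p :: "'c::idom poly"
  assumes "subring_set A" "p \<in> polys_over A"
  shows "pderiv p \<in> polys_over A"
  using assms by (auto simp: polys_over_def coeff_pderiv intro!: subring_setD(5) subring_setD(4) subring_set_of_nat simp del: of_nat_Suc)

lemma map_poly_pderiv:
  fixes p :: "'c::idom poly" and e :: "'c \<Rightarrow> 'd::idom"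
  assumes A: "subring_set A" and e: "hom_on A e" and p: "p \<in> polys_over A"
  shows "map_poly e (pderiv p) = pderiv (map_poly e p)"
  using assms 
  by (intro poly_eqI) (auto simp: polys_over_def coeff_pderiv coeff_map_poly hom_onD hom_on_of_nat subring_set_of_nat simp del: of_nat_Suc)

lemma degree_pderiv_le: "Polynomial.degree (pderiv p) \<le> Polynomial.degree p - 1"
  by (rule degree_le) (auto simp: coeff_pderiv coeff_eq_0)

text \<open>In the coefficient ring the leading term of \<open>p'\<close> could vanish, in positive characteristic. It does not
  if the leading coefficient of \<open>p\<close> has a non-zero image in an ordered field.\<close>
lemma hom_on_lead_pderiv:
  fixes e :: "'c::idom \<Rightarrow> 'a::linordered_field"
  assumes A: "subring_set A" and e: "hom_on A e" and p: "p \<in> polys_over A"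
    and d: "0 < Polynomial.degree p" and nz: "e (lead_coeff p) \<noteq> 0"
  shows "e (lead_coeff (pderiv p)) = of_nat (Polynomial.degree p) * e (lead_coeff p)"
proof -
  obtain n where n: "Polynomial.degree p = Suc n" using d gr0_implies_Suc by blast
  let ?c = "of_nat (Suc n) * lead_coeff p"
  have c: "coeff (pderiv p) n = ?c" by (simp add: coeff_pderiv n)
  have ec: "e ?c = of_nat (Suc n) * e (lead_coeff p)"
    using p by (simp add: hom_onD[OF A e] hom_on_of_nat[OF A e] subring_set_of_nat[OF A] polys_over_def del: of_nat_Suc)
  then have "e ?c \<noteq> 0" using nz by (simp del: of_nat_Suc)
  then have "?c \<noteq> 0" using hom_onD(2)[OF A e] by metis
  then have "n \<le> Polynomial.degree (pderiv p)" using c by (metis le_degree)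
  moreover have "Polynomial.degree (pderiv p) \<le> n" using degree_pderiv_le[of p] n by simp
  ultimately show ?thesis using c ec n by simp
qed

text \<open>Takes the place of \<open>p\<close> under homomorphisms that annihilate its leading coefficient.\<close>
definition drop_lead :: "'c::comm_ring_1 poly \<Rightarrow> 'c poly" where
  "drop_lead p = p - monom (lead_coeff p) (Polynomial.degree p)"

lemma degree_drop_lead_less:
  assumes "0 < Polynomial.degree p"
  shows "Polynomial.degree (drop_lead p) < Polynomial.degree p"
proof -
  have "Polynomial.degree (drop_lead p) \<le> Polynomial.degree p"
    unfolding drop_lead_def by (intro degree_diff_le) (auto simp: degree_monom_le)
  moreover have "coeff (drop_lead p) (Polynomial.degree p) = 0"
    by (simp add: drop_lead_def)
  ultimately show ?thesis using assms
    by (metis degree_0 le_neq_implies_less leading_coeff_0_iff)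
qed

lemma drop_lead_over:
  assumes "subring_set A" "p \<in> polys_over A"
  shows "drop_lead p \<in> polys_over A"
  using assms by (auto simp: polys_over_def drop_lead_def subring_setD)

lemma map_poly_drop_lead:
  assumes A: "subring_set A" and e: "hom_on A e" and p: "p \<in> polys_over A" and z: "e (lead_coeff p) = 0"
  shows "map_poly e (drop_lead p) = map_poly e p"
  using assms 
  by (intro poly_eqI) (auto simp: polys_over_def drop_lead_def coeff_map_poly hom_onD subring_setD)

text \<open>The measure of the elimination: in the multiset order it decreases whenever a polynomial is replaced by
  any finite number of polynomials of smaller degree.\<close>
definition degree_mset :: "'c::zero poly set \<Rightarrow> nat multiset" where
  "degree_mset P = image_mset Polynomial.degree (mset_set P)"

lemma degree_mset_replace:
  assumes fin: "finite P" "finite N" and p: "p \<in> P" and less: "\<And>q. q \<in> N \<Longrightarrow> Polynomial.degree q < Polynomial.degree p"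
  shows "(degree_mset ((P - {p}) \<union> N), degree_mset P) \<in> mult less_than"
proof -
  let ?N = "N - (P - {p})"
  have "mset_set ((P - {p}) \<union> N) = mset_set (P - {p}) + mset_set ?N"
    using fin by (subst mset_set_Union[symmetric]) auto
  moreover have "mset_set P = mset_set (P - {p}) + {#p#}"
    using fin p by (simp add: mset_set.remove)
  moreover have "(image_mset Polynomial.degree (mset_set (P - {p})) + image_mset Polynomial.degree (mset_set ?N),
      image_mset Polynomial.degree (mset_set (P - {p})) + {#Polynomial.degree p#}) \<in> mult less_than"
    by (rule one_step_implies_mult) (use fin less in auto)
  ultimately show ?thesis unfolding degree_mset_def by simp
qed

text \<open>If the polynomials in \<open>P\<close> are specialised by \<open>e1\<close> and \<open>e2\<close> to two fields, then the agreement of finitely many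
  signs of coefficient expressions ensures that the two specialised families have a matching. If a leading coefficient
  is annihilated, it can be dropped. Otherwise let \<open>p\<close> have the largest degree. By induction there is a
  matching for the other polynomials, the derivative of \<open>p\<close>, and the reducts of \<open>p\<close> modulo all of these.
  The reducts determine the sign of \<open>p\<close> at the roots of the others, so \<open>cellmatch_extend\<close> applies. As the
  set \<open>Q\<close> must not depend on \<open>e1\<close> and \<open>e2\<close>, it collects what all these cases require.\<close>
lemma sign_determination:
  fixes P :: "'c::idom poly set"
  assumes ivpa: "has_ivp TYPE('a::linordered_field)" and ivpb: "has_ivp TYPE('b::linordered_field)"
    and A: "subring_set A" and "finite P" "P \<subseteq> polys_over A"
  shows "\<exists>Q. finite Q \<and> Q \<subseteq> A \<and> (\<forall>(e1::'c \<Rightarrow> 'a) (e2::'c \<Rightarrow> 'b). hom_on A e1 \<longrightarrow> hom_on A e2 \<longrightarrow>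
     (\<forall>q\<in>Q. sg (e1 q) = sg (e2 q)) \<longrightarrow>
     (\<exists>E. cellmatch E \<and> (\<forall>p\<in>P. sg_agree E (map_poly e1 p, map_poly e2 p))))" (is "\<exists>Q. ?good P Q")
proof -
  have "wf (inv_image (mult less_than) (degree_mset :: 'c poly set \<Rightarrow> _))" by (intro wf_inv_image wf_mult) simp
  then show ?thesis using assms(4,5)
  proof (induction P rule: wf_induct_rule)
    case (less P)
    note fin = less.prems(1) and over = less.prems(2)
    show ?case
    proof (cases "\<exists>p\<in>P. Polynomial.degree p > 0")
      case False
      have "?good P ((\<lambda>p. coeff p 0) ` P)"
      proof (intro conjI allI impI)
        fix e1 :: "'c \<Rightarrow> 'a" and e2 :: "'c \<Rightarrow> 'b"
        assume e1: "hom_on A e1" and e2: "hom_on A e2"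
          and sgs: "\<forall>q\<in>(\<lambda>p. coeff p 0) ` P. sg (e1 q) = sg (e2 q)"
        have "sg_agree (\<lambda>_ _. True) (map_poly e1 p, map_poly e2 p)" if "p \<in> P" for p
        proof -
          have "Polynomial.degree p = 0" using False that by auto
          then obtain c where c: "p = [:c:]" using degree_0_id by metis
          have "map_poly e1 p = [:e1 c:]" "map_poly e2 p = [:e2 c:]"
            using c by (auto simp: map_poly_pCons hom_onD[OF A e1] hom_onD[OF A e2])
          then show ?thesis using sgs that c by (force simp: sg_agree_def)
        qed
        moreover have "cellmatch (\<lambda>(_::'a) (_::'b). True)" by (simp add: cellmatch_def)
        ultimately show "\<exists>E. cellmatch E \<and> (\<forall>p\<in>P. sg_agree E (map_poly e1 p, map_poly e2 p))" by blast
      qed (use fin over in \<open>auto simp: polys_over_def\<close>)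
      then show ?thesis by blast
    next
      case True
      define P1 where "P1 = {p\<in>P. Polynomial.degree p > 0}"
      have P1: "finite P1" "P1 \<noteq> {}" using fin True by (auto simp: P1_def)
      have "\<exists>Q. ?good ((P - {p}) \<union> {drop_lead p}) Q" if "p \<in> P1" for p
      proof (rule less.IH)
        show "(P - {p} \<union> {drop_lead p}, P) \<in> inv_image (mult less_than) degree_mset"
          using that fin degree_drop_lead_less by (auto intro!: degree_mset_replace simp: P1_def simp del: Un_insert_right)
      qed (use fin over that in \<open>auto simp: P1_def intro: drop_lead_over[OF A]\<close>)
      then obtain Qd where Qd: "\<And>p. p \<in> P1 \<Longrightarrow> ?good ((P - {p}) \<union> {drop_lead p}) (Qd p)" by metis
      obtain p where p: "p \<in> P1" "\<And>q. q \<in> P1 \<Longrightarrow> Polynomial.degree q \<le> Polynomial.degree p"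
      proof -
        have "Max (Polynomial.degree ` P1) \<in> Polynomial.degree ` P1" using P1 by (intro Max_in) auto
        moreover have "Polynomial.degree q \<le> Max (Polynomial.degree ` P1)" if "q \<in> P1" for q
          using P1 that by (intro Max_ge) auto
        ultimately show ?thesis using that by (metis imageE)
      qed
      have pP: "p \<in> P" "Polynomial.degree p > 0" "p \<in> polys_over A" using p(1) over by (auto simp: P1_def)
      define G where "G = (P - {p}) \<union> {pderiv p}"
      define N where "N = insert (pderiv p) (reduct p ` {g\<in>G. Polynomial.degree g > 0})"
      have degG: "Polynomial.degree g \<le> Polynomial.degree p" if "g \<in> G" for g
        using that p(2)[of g] pP degree_pderiv_le[of p]
        by (cases "Polynomial.degree g = 0") (auto simp: G_def P1_def)
      have finG: "finite G" using fin by (simp add: G_def)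
      have overG: "G \<subseteq> polys_over A" using over pP pderiv_over[OF A] by (auto simp: G_def)
      have "\<exists>Q. ?good ((P - {p}) \<union> N) Q"
      proof (rule less.IH)
        show "(P - {p} \<union> N, P) \<in> inv_image (mult less_than) degree_mset"
          unfolding in_inv_image
        proof (rule degree_mset_replace)
          show "Polynomial.degree q < Polynomial.degree p" if "q \<in> N" for q
            using that degree_reduct_less[OF degG pP(2)] degree_pderiv_le[of p] pP by (auto simp: N_def)
        qed (use fin finG pP in \<open>auto simp: N_def\<close>)
      qed (use fin finG over overG pP A in \<open>auto simp: N_def intro!: reduct_over pderiv_over\<close>)
      then obtain Q0 where Q0: "?good ((P - {p}) \<union> N) Q0" by blast
      define Q where "Q = Q0 \<union> lead_coeff ` P1 \<union> (\<Union>p\<in>P1. Qd p)"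
      have "?good P Q"
      proof (intro conjI allI impI)
        show "finite Q" using P1 Q0 Qd by (auto simp: Q_def)
        show "Q \<subseteq> A" using Q0 Qd over by (fastforce simp: Q_def P1_def polys_over_def)
        fix e1 :: "'c \<Rightarrow> 'a" and e2 :: "'c \<Rightarrow> 'b"
        assume e1: "hom_on A e1" and e2: "hom_on A e2" and sgs: "\<forall>q\<in>Q. sg (e1 q) = sg (e2 q)"
        have lcs: "sg (e1 (lead_coeff q)) = sg (e2 (lead_coeff q))" if "q \<in> P1" for q
          using sgs that by (auto simp: Q_def)
        show "\<exists>E. cellmatch E \<and> (\<forall>p\<in>P. sg_agree E (map_poly e1 p, map_poly e2 p))"
        proof (cases "\<exists>q\<in>P1. e1 (lead_coeff q) = 0")
          case True
          then obtain q where q: "q \<in> P1" "e1 (lead_coeff q) = 0" by blast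
          then have q2: "e2 (lead_coeff q) = 0" using lcs sg_eq_zero by blast
          have qo: "q \<in> polys_over A" using q over by (auto simp: P1_def)
          obtain E where E: "cellmatch E" "\<And>p. p \<in> (P - {q}) \<union> {drop_lead q} \<Longrightarrow> sg_agree E (map_poly e1 p, map_poly e2 p)"
            using Qd[OF q(1)] e1 e2 sgs q(1) unfolding Q_def by (metis (no_types, lifting) UN_I UnCI)
          have "sg_agree E (map_poly e1 q, map_poly e2 q)"
            using E(2)[of "drop_lead q"] map_poly_drop_lead[OF A e1 qo q(2)] map_poly_drop_lead[OF A e2 qo q2] by simp
          then show ?thesis using E by (metis DiffI UnCI singletonD)
        next
          case False
          have nz1: "e1 (lead_coeff q) \<noteq> 0" and nz2: "e2 (lead_coeff q) \<noteq> 0" if "q \<in> P1" for q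
            using False that lcs[OF that] sg_eq_zero by blast+
          obtain E where E: "cellmatch E" "\<And>q. q \<in> (P - {p}) \<union> N \<Longrightarrow> sg_agree E (map_poly e1 q, map_poly e2 q)"
            using Q0 e1 e2 sgs unfolding Q_def by (metis (no_types, lifting) UnCI)
          define f where "f = map_poly e1 p"
          define g where "g = map_poly e2 p"
          have df: "Polynomial.degree f = Polynomial.degree p" and dg: "Polynomial.degree g = Polynomial.degree p"
            unfolding f_def g_def using nz1[OF p(1)] nz2[OF p(1)]
            by (simp_all add: map_poly_degree_eq)
          have lf: "lead_coeff f = e1 (lead_coeff p)" and lg: "lead_coeff g = e2 (lead_coeff p)"
            unfolding df dg unfolding f_def g_def
            by (simp_all add: coeff_map_poly hom_onD[OF A e1] hom_onD[OF A e2])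
          have pd1: "map_poly e1 (pderiv p) = pderiv f" and pd2: "map_poly e2 (pderiv p) = pderiv g"
            unfolding f_def g_def using map_poly_pderiv[OF A _ pP(3)] e1 e2 by auto
          have lcG: "e1 (lead_coeff h) \<noteq> 0 \<and> sg (e1 (lead_coeff h)) = sg (e2 (lead_coeff h))"
            if "h \<in> G" "Polynomial.degree h > 0" for h
          proof (cases "h \<in> P1")
            case True
            then show ?thesis using nz1 lcs by blast
          next
            case False
            then have h: "h = pderiv p" using that by (auto simp: G_def P1_def)
            show ?thesis
              unfolding h hom_on_lead_pderiv[OF A e1 pP(3,2) nz1[OF p(1)]]
                hom_on_lead_pderiv[OF A e2 pP(3,2) nz2[OF p(1)]] sg_mult
              using nz1[OF p(1)] pP(2) lcs[OF p(1)] by (simp add: sg_def)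
          qed
          define PP where "PP = (\<lambda>h. (map_poly e1 h, map_poly e2 h)) ` G"
          have GN: "G \<subseteq> (P - {p}) \<union> N" by (auto simp: G_def N_def)
          have "\<exists>E'. cellmatch E' \<and> (\<forall>uv\<in>insert (f, g) PP. sg_agree E' uv)"
          proof (rule cellmatch_extend[OF ivpa ivpb E(1)])
            show "finite PP" using finG by (simp add: PP_def)
            show "sg_agree E uv" if "uv \<in> PP" for uv
              using that E(2) GN by (auto simp: PP_def)
            show "(pderiv f, pderiv g) \<in> PP" unfolding PP_def pd1[symmetric] pd2[symmetric] by (auto simp: G_def)
            show "pderiv f \<noteq> 0" using df pP(2) by (simp add: pderiv_eq_0_iff)
            show "sg (lead_coeff f) = sg (lead_coeff g)" unfolding lf lg by (rule lcs[OF p(1)])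
            show "Polynomial.degree f = Polynomial.degree g" by (simp add: df dg)
            fix u v z w assume uv: "(u, v) \<in> PP" and u0: "u \<noteq> 0" and zw: "E z w" and uz: "poly u z = 0"
            obtain h where h: "h \<in> G" "u = map_poly e1 h" "v = map_poly e2 h" using uv by (auto simp: PP_def)
            have ho: "h \<in> polys_over A" using h overG by blast
            have dh: "Polynomial.degree h > 0"
            proof (rule ccontr)
              assume "\<not> Polynomial.degree h > 0"
              then obtain c where "h = [:c:]" using degree_0_id[of h] by (metis gr0I)
              then have "u = [:e1 c:]" using h by (simp add: map_poly_pCons hom_onD[OF A e1])
              then show False using u0 uz by auto
            qed
            have "sg_agree E (u, v)" using E(2) GN h by blast
            then have "sg (poly u z) = sg (poly v w)" using zw by (simp add: sg_agree_def)
            then have vw: "poly v w = 0" using uz by simp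
            have "sg_agree E (map_poly e1 (reduct p h), map_poly e2 (reduct p h))"
              by (rule E(2)) (use h dh in \<open>auto simp: N_def\<close>)
            then have r: "sg (poly (map_poly e1 (reduct p h)) z) = sg (poly (map_poly e2 (reduct p h)) w)"
              using zw by (auto simp: sg_agree_def)
            have r1: "poly (map_poly e1 (reduct p h)) z = e1 (lead_coeff h) * poly f z"
              unfolding map_poly_reduct[OF A e1 pP(3) ho] using uz h by (simp add: f_def)
            have r2: "poly (map_poly e2 (reduct p h)) w = e2 (lead_coeff h) * poly g w"
              unfolding map_poly_reduct[OF A e2 pP(3) ho] using vw h by (simp add: g_def)
            have lch: "sg (e1 (lead_coeff h)) = sg (e2 (lead_coeff h))"
              using lcG[OF h(1) dh] by blast
            have "sg (e2 (lead_coeff h)) \<noteq> 0" using lcG[OF h(1) dh] by (metis sg_simps(4))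
            then show "sg (poly f z) = sg (poly g w)"
              using r unfolding r1 r2 sg_mult lch by simp
          qed
          then obtain E' where E': "cellmatch E'" "\<And>uv. uv \<in> insert (f, g) PP \<Longrightarrow> sg_agree E' uv" by blast
          have "sg_agree E' (map_poly e1 q, map_poly e2 q)" if "q \<in> P" for q
            using that by (intro E'(2)) (auto simp: PP_def G_def f_def g_def)
          then show ?thesis using E'(1) by blast
        qed
      qed
      then show ?thesis by blast
    qed
  qed
qed

section \<open>Real closed fields have the intermediate value property\<close>

definition subfield_set :: "'c::field set \<Rightarrow> bool" where
  "subfield_set K \<longleftrightarrow> subring_set K \<and> (\<forall>x\<in>K. inverse x \<in> K)"

lemma subfield_setD:
  assumes "subfield_set K"
  shows "subring_set K" "x \<in> K \<Longrightarrow> y \<in> K \<Longrightarrow> x / y \<in> K"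
  using assms by (auto simp: subfield_set_def divide_inverse intro: subring_setD)

text \<open>The logarithmic derivative of \<open>\<Prod>(1 - \<gamma>\<^sub>i X)\<close> generates the power sums of the \<open>\<gamma>\<^sub>i\<close>: Newton's
  identities in the form of power series.\<close>
lemma deriv_prod_one_minus:
  fixes \<gamma> :: "'i \<Rightarrow> 'k::field_char_0"
  assumes "finite I"
  defines "F \<equiv> \<lambda>I. \<Prod>i\<in>I. 1 - fps_const (\<gamma> i) * fps_X"
  shows "fps_deriv (F I) = - F I * Abs_fps (\<lambda>n. \<Sum>i\<in>I. \<gamma> i ^ Suc n)"
  using assms(1)
proof (induction I rule: finite_induct)
  case empty
  then show ?case by (simp add: F_def fps_eq_iff)
next
  case (insert i I)
  let ?g = "Abs_fps (\<lambda>n. \<gamma> i ^ Suc n)" and ?S = "Abs_fps (\<lambda>n. \<Sum>i\<in>I. \<gamma> i ^ Suc n)"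
  let ?L = "1 - fps_const (\<gamma> i) * fps_X"
  have g: "?L * ?g = fps_const (\<gamma> i)"
  proof (rule fps_ext)
    fix n show "(?L * ?g) $ n = fps_const (\<gamma> i) $ n"
      by (cases n) (simp_all add: algebra_simps)
  qed
  have S: "Abs_fps (\<lambda>n. \<Sum>j\<in>insert i I. \<gamma> j ^ Suc n) = ?g + ?S"
    using insert by (simp add: fps_eq_iff)
  have "fps_deriv (F (insert i I)) = - fps_const (\<gamma> i) * F I + ?L * fps_deriv (F I)"
    using insert by (simp add: F_def algebra_simps del: fps_const_neg)
  also have "\<dots> = - (?L * ?g) * F I + ?L * (- F I * ?S)" unfolding g insert.IH ..
  also have "\<dots> = - (?L * F I) * (?g + ?S)" by (simp add: algebra_simps)
  also have "?L * F I = F (insert i I)" using insert by (simp add: F_def)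
  finally show ?case unfolding S .
qed

text \<open>Newton's identities express elementary symmetric functions and power sums through each other, with
  denominators that are positive integers. Laplace's proof needs that certain symmetric expressions in the
  roots of a polynomial lie in the base field; power sums make this a direct computation and take the place
  of the fundamental theorem on symmetric polynomials.\<close>
lemma coeffs_iff_power_sums:
  fixes \<gamma> :: "'i \<Rightarrow> 'k::field_char_0"
  assumes fin: "finite I" and K: "subfield_set K"
  shows "(\<forall>n. coeff (\<Prod>i\<in>I. [:- \<gamma> i, 1:]) n \<in> K) \<longleftrightarrow> (\<forall>n. (\<Sum>i\<in>I. \<gamma> i ^ Suc n) \<in> K)"
proof -
  note A = subfield_setD(1)[OF K]
  define P where "P = (\<Prod>i\<in>I. [:- \<gamma> i, 1:])"
  define F where "F = (\<Prod>i\<in>I. 1 - fps_const (\<gamma> i) * fps_X)"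
  define s where "s n = (\<Sum>i\<in>I. \<gamma> i ^ Suc n)" for n
  \<comment> \<open>Reversing the coefficients turns \<open>\<Prod>(X - \<gamma>\<^sub>i)\<close> into \<open>\<Prod>(1 - \<gamma>\<^sub>i X)\<close>.\<close>
  have "reflect_poly P = (\<Prod>i\<in>I. [:1, - \<gamma> i:])"
    unfolding P_def reflect_poly_prod by (rule prod.cong) (auto simp: reflect_poly_def)
  then have "fps_of_poly (reflect_poly P) = F"
    by (simp add: fps_of_poly_prod F_def fps_of_poly_pCons algebra_simps) (simp flip: fps_const_neg)
  then have F_nth: "F $ n = coeff (reflect_poly P) n" for n by (metis fps_of_poly_nth)
  have P_F: "(\<forall>n. coeff P n \<in> K) \<longleftrightarrow> (\<forall>n. F $ n \<in> K)"
  proof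
    assume "\<forall>n. coeff P n \<in> K"
    then show "\<forall>n. F $ n \<in> K" using subring_setD(1)[OF A] by (auto simp: F_nth coeff_reflect_poly)
  next
    assume F: "\<forall>n. F $ n \<in> K"
    show "\<forall>n. coeff P n \<in> K"
    proof
      fix n
      show "coeff P n \<in> K"
      proof (cases "n \<le> Polynomial.degree P")
        case True
        then show ?thesis using F[rule_format, of "Polynomial.degree P - n"] by (auto simp: F_nth coeff_reflect_poly split: if_splits)
      next
        case False
        then show ?thesis using subring_setD(1)[OF A] by (simp add: coeff_eq_0)
      qed
    qed
  qed
  have F0: "F $ 0 = 1"
  proof -
    have "lead_coeff P = 1" unfolding P_def lead_coeff_prod by simp
    then show ?thesis by (simp add: F_nth coeff_reflect_poly)
  qed
  have rec: "of_nat (Suc n) * F $ Suc n = - (\<Sum>k=0..n. F $ k * s (n - k))" for n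
  proof -
    have "fps_deriv F = - F * Abs_fps s"
      unfolding F_def s_def by (rule deriv_prod_one_minus[OF fin])
    then have "fps_deriv F $ n = (- F * Abs_fps s) $ n" by simp
    then show ?thesis by (simp add: fps_mult_nth sum_negf algebra_simps)
  qed
  have "(\<forall>n. F $ n \<in> K) \<longleftrightarrow> (\<forall>n. s n \<in> K)"
  proof
    assume F: "\<forall>n. F $ n \<in> K"
    show "\<forall>n. s n \<in> K"
    proof
      fix n show "s n \<in> K"
      proof (induction n rule: less_induct)
        case (less n)
        have "(\<Sum>k=0..n. F $ k * s (n - k)) = s n + (\<Sum>k=1..n. F $ k * s (n - k))"
          using F0 by (simp add: sum.atLeast_Suc_atMost)
        then have "s n = - (of_nat (Suc n) * F $ Suc n) - (\<Sum>k=1..n. F $ k * s (n - k))"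
          using rec[of n] by simp
        moreover have "(\<Sum>k=1..n. F $ k * s (n - k)) \<in> K"
          using F less by (intro subring_set_sum[OF A] subring_setD[OF A]) auto
        moreover have "of_nat (Suc n) * F $ Suc n \<in> K"
          using F by (intro subring_setD[OF A] subring_set_of_nat[OF A]) auto
        ultimately show ?case using subring_setD[OF A] by metis
      qed
    qed
  next
    assume s: "\<forall>n. s n \<in> K"
    show "\<forall>n. F $ n \<in> K"
    proof
      fix n show "F $ n \<in> K"
      proof (induction n rule: less_induct)
        case (less n)
        show ?case
        proof (cases n)
          case 0
          then show ?thesis using F0 subring_setD[OF A] by simp
        next
          case (Suc m)
          have "F $ Suc m = - (\<Sum>k=0..m. F $ k * s (m - k)) / of_nat (Suc m)"
            using rec[of m] by (metis nonzero_mult_div_cancel_left of_nat_neq_0)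
          moreover have "(\<Sum>k=0..m. F $ k * s (m - k)) \<in> K"
            using s less Suc by (intro subring_set_sum[OF A] subring_setD[OF A]) auto
          ultimately show ?thesis unfolding Suc
            using subfield_setD(2)[OF K] subring_setD[OF A] subring_set_of_nat[OF A] by metis
        qed
      qed
    qed
  qed
  then show ?thesis using P_F unfolding P_def s_def by simp
qed

lemma sum_strict_pairs:
  fixes h :: "nat \<Rightarrow> nat \<Rightarrow> 'k::comm_ring_1"
  assumes sym: "\<And>i j. h i j = h j i"
  shows "(\<Sum>i<d. \<Sum>j<d. h i j) = 2 * (\<Sum>(i, j)\<in>{(i, j). i < j \<and> j < d}. h i j) + (\<Sum>i<d. h i i)"
proof (induction d)
  case 0
  then show ?case by simp
next
  case (Suc d)
  have eq: "{(i, j). i < j \<and> j < Suc d} = {(i, j). i < j \<and> j < d} \<union> (\<lambda>i. (i, d)) ` {..<d}"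
    by auto
  have fin: "finite {(i, j). i < j \<and> j < d}"
    by (rule finite_subset[of _ "{..<d} \<times> {..<d}"]) auto
  have "(\<Sum>(i, j)\<in>{(i, j). i < j \<and> j < Suc d}. h i j) =
      (\<Sum>(i, j)\<in>{(i, j). i < j \<and> j < d}. h i j) + (\<Sum>i<d. h i d)"
    unfolding eq by (subst sum.union_disjoint) (use fin in \<open>auto simp: sum.reindex inj_on_def\<close>)
  moreover have "(\<Sum>j<d. h d j) = (\<Sum>i<d. h i d)" using sym by (intro sum.cong) auto
  ultimately show ?case using Suc by (simp add: sum.distrib algebra_simps)
qed

lemma card_strict_pairs: "2 * card {(i, j). i < j \<and> j < (d::nat)} = d * (d - 1)"
proof -
  have "(\<Sum>i<d. \<Sum>j<d. (1::int)) = 2 * (\<Sum>(i, j)\<in>{(i, j). i < j \<and> j < d}. 1) + (\<Sum>i<d. 1)"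
    by (rule sum_strict_pairs) auto
  then have "int d * int d = 2 * int (card {(i, j). i < j \<and> j < d}) + int d"
    by (simp add: case_prod_beta)
  then have "int (2 * card {(i, j). i < j \<and> j < d}) = int (d * (d - 1))"
    by (cases d) (auto simp: algebra_simps)
  then show ?thesis by linarith
qed

text \<open>The combinations \<open>(\<alpha>\<^sub>i + s) (\<alpha>\<^sub>j + s)\<close> have powers that factor into a function of \<open>i\<close> and one of \<open>j\<close>. So
  the sum over all pairs is the square of a sum over single roots, and the sum over \<open>i < j\<close> differs from
  half of that square by a diagonal sum of the same kind.\<close>
lemma symmetric_pairs_power_sums:
  fixes \<alpha> :: "nat \<Rightarrow> 'k::field_char_0"
  assumes K: "subfield_set K" and s: "s \<in> K" and p: "\<And>n. (\<Sum>i<d. \<alpha> i ^ Suc n) \<in> K"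
  shows "(\<Sum>(i, j)\<in>{(i, j). i < j \<and> j < d}. ((\<alpha> i + s) * (\<alpha> j + s)) ^ m) \<in> K"
proof -
  note A = subfield_setD(1)[OF K]
  have p': "(\<Sum>i<d. \<alpha> i ^ n) \<in> K" for n
    using p subring_set_of_nat[OF A, of d] by (cases n) auto
  have sh: "(\<Sum>i<d. (\<alpha> i + s) ^ n) \<in> K" for n
  proof -
    have "(\<Sum>i<d. (\<alpha> i + s) ^ n) = (\<Sum>i<d. \<Sum>k\<le>n. of_nat (n choose k) * \<alpha> i ^ k * s ^ (n - k))"
      by (simp add: binomial_ring)
    also have "\<dots> = (\<Sum>k\<le>n. of_nat (n choose k) * s ^ (n - k) * (\<Sum>i<d. \<alpha> i ^ k))"
      by (subst sum.swap) (simp add: sum_distrib_left algebra_simps)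
    also have "\<dots> \<in> K"
      by (rule subring_set_sum[OF A], intro subring_setD(5)[OF A] subring_set_of_nat[OF A] subring_set_power[OF A] p' s)
    finally show ?thesis .
  qed
  define h where "h i j = ((\<alpha> i + s) * (\<alpha> j + s)) ^ m" for i j
  have "(\<Sum>i<d. \<Sum>j<d. h i j) = 2 * (\<Sum>(i, j)\<in>{(i, j). i < j \<and> j < d}. h i j) + (\<Sum>i<d. h i i)"
    by (rule sum_strict_pairs) (simp add: h_def mult.commute)
  moreover have "(\<Sum>i<d. \<Sum>j<d. h i j) = (\<Sum>i<d. (\<alpha> i + s) ^ m) * (\<Sum>i<d. (\<alpha> i + s) ^ m)"
    by (simp add: h_def power_mult_distrib sum_product)
  moreover have "(\<Sum>i<d. h i i) = (\<Sum>i<d. (\<alpha> i + s) ^ (m + m))"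
    by (simp add: h_def power_mult_distrib power_add)
  ultimately have "(\<Sum>(i, j)\<in>{(i, j). i < j \<and> j < d}. h i j) =
      ((\<Sum>i<d. (\<alpha> i + s) ^ m) * (\<Sum>i<d. (\<alpha> i + s) ^ m) - (\<Sum>i<d. (\<alpha> i + s) ^ (m + m))) / of_nat 2"
    by simp
  also have "\<dots> \<in> K"
    using sh by (intro subfield_setD(2)[OF K] subring_setD[OF A] subring_set_of_nat[OF A])
  finally show ?thesis unfolding h_def .
qed

lemma range_to_ac_subfield: "subfield_set (range (to_ac :: 'a::field \<Rightarrow> _))"
proof -
  have "to_ac a + to_ac b \<in> range to_ac" "to_ac a * to_ac b \<in> range to_ac" "- to_ac a \<in> range to_ac"
    "inverse (to_ac a) \<in> range to_ac" "0 \<in> range to_ac" "1 \<in> range to_ac" for a b :: 'a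
    by (metis rangeI to_ac_add to_ac_mult to_ac_minus to_ac_inverse to_ac_0 to_ac_1)+
  then show ?thesis unfolding subfield_set_def subring_set_def by blast
qed

lemma hom_on_to_ac: "hom_on UNIV (to_ac :: 'a::field \<Rightarrow> _)"
  by (simp add: hom_on_def)

lemma subring_set_UNIV: "subring_set UNIV"
  by (simp add: subring_set_def)

lemma hom_poly_simps:
  fixes e :: "'c::comm_ring_1 \<Rightarrow> 'd::comm_ring_1"
  assumes e: "hom_on UNIV e"
  shows "map_poly e (p + q) = map_poly e p + map_poly e q" "map_poly e (p * q) = map_poly e p * map_poly e q"
    "map_poly e (smult c p) = smult (e c) (map_poly e p)" "map_poly e 1 = 1"
    "map_poly e (pCons c p) = pCons (e c) (map_poly e p)"
proof -
  note h = hom_onD[OF subring_set_UNIV e]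
  show "map_poly e (p + q) = map_poly e p + map_poly e q" 
    by (intro poly_eqI) (simp add: coeff_map_poly h)
  show "map_poly e (p * q) = map_poly e p * map_poly e q"
    by (intro poly_eqI) (simp add: coeff_map_poly h coeff_mult hom_on_sum[OF subring_set_UNIV e])
  show "map_poly e (smult c p) = smult (e c) (map_poly e p)"
    by (intro poly_eqI) (simp add: coeff_map_poly h)
  show "map_poly e 1 = 1" "map_poly e (pCons c p) = pCons (e c) (map_poly e p)"
    by (simp_all add: map_poly_pCons h map_poly_1)
qed

lemma poly_map_to_ac: "poly (map_poly to_ac p) (to_ac x) = to_ac (poly p x)"
  by (induction p) (simp_all add: map_poly_pCons)

lemma degree_map_to_ac [simp]: "Polynomial.degree (map_poly to_ac p) = Polynomial.degree (p :: 'a::field poly)"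
  by (cases "p = 0") (auto simp: map_poly_degree_eq)

text \<open>With \<open>r = \<surd>(a\<^sup>2 + b\<^sup>2)\<close> the root is \<open>\<surd>((r + a) / 2) \<plusminus> i \<surd>((r - a) / 2)\<close>, the sign being that of \<open>b\<close>.\<close>
lemma square_root_in_complexification:
  fixes im :: "'r::linordered_field alg_closure"
  assumes sq: "\<And>a::'r. 0 \<le> a \<Longrightarrow> \<exists>b. a = b * b" and im: "im * im = - 1"
  shows "\<exists>c d. (to_ac c + im * to_ac d) * (to_ac c + im * to_ac d) = to_ac a + im * to_ac (b::'r)"
proof -
  have sq': "\<exists>b\<ge>0. a = b * b" if "0 \<le> a" for a :: 'r
    using sq[OF that] by (metis abs_ge_zero abs_mult_self_eq)
  obtain r where r: "r \<ge> 0" "a * a + b * b = r * r" using sq'[of "a * a + b * b"] by (auto)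
  have "\<bar>a\<bar> \<le> r"
    using r by (metis abs_le_square_iff abs_of_nonneg le_add_same_cancel1 power2_eq_square zero_le_square)
  then have ra: "(r + a) / 2 \<ge> 0" "(r - a) / 2 \<ge> 0" by auto
  obtain c where c: "c \<ge> 0" "(r + a) / 2 = c * c" using sq'[OF ra(1)] by blast
  obtain d where d: "d \<ge> 0" "(r - a) / 2 = d * d" using sq'[OF ra(2)] by blast
  have a: "a = c * c - d * d" unfolding c(2)[symmetric] d(2)[symmetric] by (simp add: field_simps)
  have "(2 * (c * d)) * (2 * (c * d)) = 4 * ((r + a) / 2) * ((r - a) / 2)" unfolding c(2) d(2) by (simp add: algebra_simps)
  also have "\<dots> = b * b" using r(2) by (simp add: field_simps)
  finally have "b = 2 * (c * d) \<or> b = - (2 * (c * d))" by (metis square_eq_iff)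
  then have "(to_ac c + im * to_ac d) * (to_ac c + im * to_ac d) = to_ac a + im * to_ac b \<or>
      (to_ac c + im * to_ac (- d)) * (to_ac c + im * to_ac (- d)) = to_ac a + im * to_ac b"
  proof
    have e: "(to_ac c + im * to_ac d) * (to_ac c + im * to_ac d) =
       to_ac c * to_ac c + (im * im) * (to_ac d * to_ac d) + im * (2 * (to_ac c * to_ac d))" for d
      by (simp add: algebra_simps)
    { assume "b = 2 * (c * d)"
      then show ?thesis unfolding e im a by simp }
    { assume "b = - (2 * (c * d))"
      then show ?thesis unfolding e im a by simp }
  qed
  then show ?thesis by blast
qed

text \<open>Laplace's induction on the exponent \<open>k\<close> of \<open>2\<close> in the degree \<open>d\<close>. Let \<open>\<alpha>\<^sub>i\<close> be the roots of \<open>p\<close> in the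
  algebraic closure. For every natural number \<open>s\<close> the numbers \<open>(\<alpha>\<^sub>i + s) (\<alpha>\<^sub>j + s)\<close> with \<open>i < j\<close> are the
  roots of a polynomial over the base field of degree \<open>d (d - 1) / 2\<close>, to which the induction hypothesis
  applies. By the pigeonhole principle the same pair \<open>i, j\<close> gives an element of the complexification \<open>C\<close> for two
  different \<open>s\<close>. Hence \<open>\<alpha>\<^sub>i + \<alpha>\<^sub>j\<close> and \<open>\<alpha>\<^sub>i \<alpha>\<^sub>j\<close> lie in \<open>C\<close>, and so does \<open>\<alpha>\<^sub>i\<close>, as \<open>C\<close> has square roots.\<close>
lemma laplace_root:
  fixes p :: "'r::linordered_field poly"
  assumes sq: "\<And>a::'r. 0 \<le> a \<Longrightarrow> \<exists>b. a = b * b"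
    and odd: "\<And>p::'r poly. odd (Polynomial.degree p) \<Longrightarrow> \<exists>x. poly p x = 0"
    and im: "im * im = (- 1 :: 'r alg_closure)"
    and deg: "Polynomial.degree p = 2 ^ k * m" "Parity.odd m"
  shows "\<exists>a b. poly (map_poly to_ac p) (to_ac a + im * to_ac b) = 0"
  using deg
proof (induction k arbitrary: p m)
  case 0
  then obtain x where "poly p x = 0" using odd[of p] by auto
  then have "poly (map_poly to_ac p) (to_ac x + im * to_ac 0) = 0" by (simp add: poly_map_to_ac)
  then show ?case by blast
next
  case (Suc k)
  define K where "K = range (to_ac :: 'r \<Rightarrow> _)"
  have K: "subfield_set K" unfolding K_def by (rule range_to_ac_subfield)
  note A = subfield_setD(1)[OF K]
  define C where "C = {to_ac a + im * to_ac b | a b :: 'r. True}"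
  have Cplus: "x + y \<in> C" if xy: "x \<in> C" "y \<in> C" for x y
  proof -
    obtain a b c d where "x = to_ac a + im * to_ac b" "y = to_ac c + im * to_ac d" using xy unfolding C_def by blast
    then have "x + y = to_ac (a + c) + im * to_ac (b + d)" by (simp add: algebra_simps)
    then show ?thesis unfolding C_def by blast
  qed
  have CK: "to_ac c * x \<in> C" if xy: "x \<in> C" for x c
  proof -
    obtain a b where "x = to_ac a + im * to_ac b" using xy unfolding C_def by blast
    then have "to_ac c * x = to_ac (c * a) + im * to_ac (c * b)" by (simp add: algebra_simps)
    then show ?thesis unfolding C_def by blast
  qed
  have Cneg: "- x \<in> C" if "x \<in> C" for x using CK[OF that, of "-1"] by simp
  have Cminus: "x - y \<in> C" if "x \<in> C" "y \<in> C" for x y using Cplus[OF that(1) Cneg[OF that(2)]] by simp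
  have KC: "to_ac a \<in> C" for a
  proof -
    have "to_ac a = to_ac a + im * to_ac 0" by simp
    then show ?thesis unfolding C_def by blast
  qed
  have Ctimes: "x * y \<in> C" if xy: "x \<in> C" "y \<in> C" for x y
  proof -
    obtain a b c d where "x = to_ac a + im * to_ac b" "y = to_ac c + im * to_ac d" using xy unfolding C_def by blast
    then have "x * y = to_ac a * to_ac c + (im * im) * (to_ac b * to_ac d) + im * (to_ac a * to_ac d + to_ac b * to_ac c)"
      by (simp add: algebra_simps)
    also have "\<dots> = to_ac (a * c - b * d) + im * to_ac (a * d + b * c)" unfolding im by simp
    finally show ?thesis unfolding C_def by blast
  qed
  have Csqrt: "\<exists>w\<in>C. w * w = z" if "z \<in> C" for z
    using that square_root_in_complexification[OF sq im] unfolding C_def by blast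
  define d where "d = Polynomial.degree p"
  have d: "d = 2 ^ Suc k * m" using Suc.prems by (simp add: d_def)
  then have d0: "d > 0" using Suc.prems(2) by (auto intro: odd_pos)
  have p0: "map_poly to_ac p \<noteq> 0" using d0 by (metis d_def degree_0 degree_map_to_ac less_irrefl)
  obtain B where B: "size B = Polynomial.degree (map_poly to_ac p)"
      "map_poly to_ac p = smult (lead_coeff (map_poly to_ac p)) (\<Prod>x\<in>#B. [:-x, 1:])"
    using alg_closed_imp_factorization[OF p0] by blast
  obtain xs where xs: "mset xs = B" using ex_mset by blast
  have lxs: "length xs = d" using B(1) xs by (auto simp: d_def)
  define \<alpha> where "\<alpha> i = xs ! i" for i
  have prodB: "(\<Prod>x\<in>#B. [:-x, 1:]) = (\<Prod>i<d. [:- \<alpha> i, 1:])"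
    unfolding xs[symmetric] \<alpha>_def lxs[symmetric]
    by (simp add: prod_mset_prod_list prod.list_conv_set_nth atLeast0LessThan flip: mset_map)
  define lc where "lc = lead_coeff p"
  have lc0: "lc \<noteq> 0" using p0 by (auto simp: lc_def)
  have fact: "map_poly to_ac p = smult (to_ac lc) (\<Prod>i<d. [:- \<alpha> i, 1:])"
    using B(2) unfolding prodB by (simp add: lc_def coeff_map_poly)
  have "coeff (\<Prod>i<d. [:- \<alpha> i, 1:]) n \<in> K" for n
  proof -
    have "to_ac (coeff p n) = to_ac lc * coeff (\<Prod>i<d. [:- \<alpha> i, 1:]) n"
      using arg_cong[OF fact, of "\<lambda>q. coeff q n"] by (simp add: coeff_map_poly)
    then have "coeff (\<Prod>i<d. [:- \<alpha> i, 1:]) n = to_ac (coeff p n / lc)" using lc0 by (simp add: field_simps)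
    then show ?thesis unfolding K_def by (metis rangeI)
  qed
  then have ps: "(\<Sum>i<d. \<alpha> i ^ Suc n) \<in> K" for n
    using iffD1[OF coeffs_iff_power_sums[OF finite_lessThan K]] by blast
  define I where "I = {(i, j). i < j \<and> j < d}"
  have finI: "finite I" unfolding I_def by (rule finite_subset[of _ "{..<d} \<times> {..<d}"]) auto
  have cardI: "card I = 2 ^ k * (m * (d - 1))"
    using card_strict_pairs[of d] unfolding I_def[symmetric] by (simp add: d)
  have oddI: "Parity.odd (m * (d - 1))" using Suc.prems(2) d d0 by simp
  have ex: "\<exists>ij\<in>I. (\<alpha> (fst ij) + of_nat s) * (\<alpha> (snd ij) + of_nat s) \<in> C" for s :: nat
  proof -
    define \<gamma> where "\<gamma> = (\<lambda>(i, j). (\<alpha> i + of_nat s) * (\<alpha> j + of_nat s))"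
    define Q where "Q = (\<Prod>ij\<in>I. [:- \<gamma> ij, 1:])"
    have "(\<Sum>ij\<in>I. \<gamma> ij ^ Suc n) \<in> K" for n
      using symmetric_pairs_power_sums[OF K subring_set_of_nat[OF A, of s] ps, of "Suc n"]
      unfolding I_def \<gamma>_def by (simp add: case_prod_beta)
    then have QK: "coeff Q n \<in> K" for n
      using iffD2[OF coeffs_iff_power_sums[OF finI K]] unfolding Q_def by blast
    define q where "q = map_poly of_ac Q"
    have Qq: "map_poly to_ac q = Q"
      using QK unfolding q_def K_def by (intro poly_eqI) (simp add: coeff_map_poly to_ac_of_ac)
    have "Polynomial.degree Q = card I"
      unfolding Q_def by (subst degree_prod_sum_eq) auto
    then have "Polynomial.degree q = 2 ^ k * (m * (d - 1))" using cardI Qq degree_map_to_ac[of q] by simp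
    from Suc.IH[OF this oddI] obtain a b where "poly Q (to_ac a + im * to_ac b) = 0" unfolding Qq by blast
    then obtain ij where "ij \<in> I" "to_ac a + im * to_ac b = \<gamma> ij"
      unfolding Q_def by (auto simp: poly_prod finI)
    then have "\<gamma> ij \<in> C" unfolding C_def by (metis (mono_tags, lifting) mem_Collect_eq)
    then have "(\<alpha> (fst ij) + of_nat s) * (\<alpha> (snd ij) + of_nat s) \<in> C"
      by (simp add: \<gamma>_def case_prod_beta)
    with \<open>ij \<in> I\<close> show ?thesis by (rule bexI[rotated])
  qed
  then have "\<forall>s::nat. \<exists>ij. ij \<in> I \<and> (\<alpha> (fst ij) + of_nat s) * (\<alpha> (snd ij) + of_nat s) \<in> C"
    unfolding Bex_def by (rule allI)
  from choice[OF this] obtain pr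
    where pr: "\<And>s::nat. pr s \<in> I \<and> (\<alpha> (fst (pr s)) + of_nat s) * (\<alpha> (snd (pr s)) + of_nat s) \<in> C"
    by blast
  have "\<not> inj pr"
  proof
    assume "inj pr"
    then have "infinite (range pr)" by (simp add: range_inj_infinite)
    moreover have "range pr \<subseteq> I" using pr by auto
    ultimately show False using finI finite_subset by blast
  qed
  then obtain s t where st: "s \<noteq> t" "pr s = pr t" unfolding inj_def by blast
  define i where "i = fst (pr s)"
  define j where "j = snd (pr s)"
  have i: "i < d" using pr[of s] by (auto simp: i_def I_def)
  have g1: "(\<alpha> i + of_nat s) * (\<alpha> j + of_nat s) \<in> C" using pr[of s] by (simp add: i_def j_def)
  have g2: "(\<alpha> i + of_nat t) * (\<alpha> j + of_nat t) \<in> C" using pr[of t] by (simp add: i_def j_def st)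
  have nat_C: "of_nat n \<in> C" for n using KC[of "of_nat n"] by simp
  define e where "e = \<alpha> i + \<alpha> j"
  define q where "q = \<alpha> i * \<alpha> j"
  have g1': "q + of_nat s * e \<in> C"
    using Cminus[OF g1 Ctimes[OF nat_C nat_C], of s s] by (simp add: q_def e_def algebra_simps)
  have g2': "q + of_nat t * e \<in> C"
    using Cminus[OF g2 Ctimes[OF nat_C nat_C], of t t] by (simp add: q_def e_def algebra_simps)
  have "e = to_ac (inverse (of_nat s - of_nat t)) * ((q + of_nat s * e) - (q + of_nat t * e))"
    using st by (simp add: field_simps)
  then have eC: "e \<in> C" using CK Cminus[OF g1' g2'] by metis
  then have qC: "q \<in> C" using Cminus[OF g1' Ctimes[OF nat_C eC], of s] by simp
  obtain w where w: "w \<in> C" "w * w = e * e - to_ac 4 * q"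
    using Csqrt[OF Cminus[OF Ctimes[OF eC eC] CK[OF qC]]] by blast
  have "e * e - to_ac 4 * q = (\<alpha> i - \<alpha> j) * (\<alpha> i - \<alpha> j)" by (simp add: e_def q_def algebra_simps)
  then have "\<alpha> i - \<alpha> j = w \<or> \<alpha> i - \<alpha> j = - w" using w(2) square_eq_iff by metis
  then have "\<alpha> i - \<alpha> j \<in> C" using w Cneg by auto
  then have "to_ac (1/2) * (e + (\<alpha> i - \<alpha> j)) \<in> C" using CK Cplus eC by blast
  then have "\<alpha> i \<in> C" by (simp add: e_def)
  then obtain u v where uv: "\<alpha> i = to_ac u + im * to_ac v" unfolding C_def by blast
  have "poly (map_poly to_ac p) (\<alpha> i) = 0"
    unfolding fact using i by (auto simp: poly_prod)
  then show ?case unfolding uv by (intro exI)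
qed

text \<open>The remainder of \<open>p\<close> modulo the minimal polynomial of \<open>a + i b\<close> is linear and vanishes at this number;
  comparing real and imaginary parts shows that it is zero.\<close>
lemma complex_root_gives_factor:
  fixes p :: "'r::linordered_field poly"
  assumes root: "poly (map_poly to_ac p) (to_ac a + im * to_ac b) = 0"
    and im: "im * im = (- 1 :: 'r alg_closure)" and b: "b \<noteq> 0"
  shows "[:a * a + b * b, - 2 * a, 1:] dvd p"
proof -
  define q where "q = [:a * a + b * b, - 2 * a, 1:]"
  define z where "z = to_ac a + im * to_ac b"
  have q0: "q \<noteq> 0" "Polynomial.degree q = 2" by (simp_all add: q_def)
  have "poly (map_poly to_ac q) z = (im * im + 1) * (to_ac b * to_ac b)"
    by (simp add: q_def z_def map_poly_pCons algebra_simps)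
  then have qz: "poly (map_poly to_ac q) z = 0" by (simp add: im)
  have "poly (map_poly to_ac (q * (p div q) + p mod q)) z = 0" using root by (simp add: z_def)
  then have rz: "poly (map_poly to_ac (p mod q)) z = 0"
    unfolding hom_poly_simps[OF hom_on_to_ac] using qz by simp
  have "Polynomial.degree (p mod q) < 2" using degree_mod_less[OF q0(1), of p] q0(2) by auto
  then have "p mod q = [:coeff (p mod q) 0, coeff (p mod q) 1:]"
    by (intro poly_eqI) (auto simp: coeff_pCons coeff_eq_0 split: nat.split)
  then obtain u v where uv: "p mod q = [:u, v:]" by blast
  have lin: "to_ac (u + v * a) + im * to_ac (v * b) = 0"
    using rz by (simp add: uv z_def map_poly_pCons algebra_simps)
  then have "(im * to_ac (v * b)) * (im * to_ac (v * b)) = to_ac (u + v * a) * to_ac (u + v * a)"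
    by (metis add_eq_0_iff minus_mult_minus)
  then have "(im * im) * to_ac ((v * b) * (v * b)) = to_ac ((u + v * a) * (u + v * a))"
    by (simp add: algebra_simps)
  then have "to_ac (- ((v * b) * (v * b))) = to_ac ((u + v * a) * (u + v * a))" by (simp add: im)
  then have "- ((v * b) * (v * b)) = (u + v * a) * (u + v * a)" by (simp only: to_ac_eq_iff)
  then have "(v * b) * (v * b) + (u + v * a) * (u + v * a) = 0" by (metis add.right_inverse add.commute)
  then have "v * b = 0 \<and> u + v * a = 0" by (metis sum_squares_eq_zero_iff)
  then have "v = 0" "u = 0" using b by auto
  then have "p mod q = 0" using uv by simp
  then show ?thesis unfolding q_def by (simp add: mod_eq_0_iff_dvd)
qed

text \<open>A root \<open>u + i v\<close> of \<open>p\<close> splits off the factor \<open>X - u\<close>, if \<open>v = 0\<close>, or else the quadratic factor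
  \<open>(X - u)\<^sup>2 + v\<^sup>2\<close>, which is positive everywhere. Unless \<open>u\<close> itself is a root between \<open>a\<close> and \<open>b\<close>, the
  other factor of \<open>p\<close> changes sign between \<open>a\<close> and \<open>b\<close> too.\<close>
lemma real_closed_imp_ivp:
  assumes sq: "\<And>a::'r::linordered_field. 0 \<le> a \<Longrightarrow> \<exists>b. a = b * b"
    and odd: "\<And>p::'r poly. odd (Polynomial.degree p) \<Longrightarrow> \<exists>x. poly p x = 0"
  shows "has_ivp TYPE('r)"
proof -
  obtain im :: "'r alg_closure" where "poly [:1, 0, 1:] im = 0"
    using alg_closed_imp_poly_has_root[of "[:1, 0, 1:] :: 'r alg_closure poly"] by auto
  then have im: "im * im = - 1" by (simp add: add_eq_0_iff)
  have "\<exists>x. a < x \<and> x < b \<and> poly p x = 0" if "a < b" "poly p a * poly p b < 0" for p :: "'r poly" and a b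
    using that(2)
  proof (induction "Polynomial.degree p" arbitrary: p rule: less_induct)
    case less
    have p0: "p \<noteq> 0" using less.prems by auto
    have "Polynomial.degree p > 0"
    proof (rule ccontr)
      assume "\<not> Polynomial.degree p > 0"
      then obtain c where "p = [:c:]" using degree_0_id[of p] by (metis gr0I)
      then show False using less.prems by (simp add: mult_less_0_iff)
    qed
    then obtain k m where "Polynomial.degree p = 2 ^ k * m" "Parity.odd m"
      by (metis gr_implies_not0 multiplicity_decompose' odd_one)
    from laplace_root[OF sq odd im this] obtain u v
      where uv: "poly (map_poly to_ac p) (to_ac u + im * to_ac v) = 0" by blast
    show ?case
    proof (cases "v = 0")
      case True
      then have pu: "poly p u = 0" using uv by (simp add: poly_map_to_ac)
      show ?thesis
      proof (cases "a < u \<and> u < b")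
        case False
        obtain q where q: "p = [:- u, 1:] * q" using pu by (auto simp: poly_eq_0_iff_dvd)
        then have "q \<noteq> 0" using p0 by auto
        then have dq: "Polynomial.degree q < Polynomial.degree p" unfolding q by (subst degree_mult_eq) auto
        have "u \<noteq> a" "u \<noteq> b" using pu less.prems by auto
        then have "(a - u) * (b - u) > 0" using False that by (auto simp: zero_less_mult_iff)
        moreover have "poly p a * poly p b = ((a - u) * (b - u)) * (poly q a * poly q b)"
          by (simp add: q algebra_simps)
        ultimately have "poly q a * poly q b < 0"
          using less.prems by (metis mult_less_0_iff not_less_iff_gr_or_eq)
        from less.hyps[OF dq this] show ?thesis by (auto simp: q)
      qed (use pu in blast)
    next
      case False
      have "[:u * u + v * v, - 2 * u, 1:] dvd p" by (rule complex_root_gives_factor[OF uv im False])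
      then obtain q where q: "p = [:u * u + v * v, - 2 * u, 1:] * q" by (elim dvdE)
      then have "q \<noteq> 0" using p0 by auto
      then have dq: "Polynomial.degree q < Polynomial.degree p" unfolding q by (subst degree_mult_eq) auto
      have pos: "poly [:u * u + v * v, - 2 * u, 1:] x > 0" for x
      proof -
        have "poly [:u * u + v * v, - 2 * u, 1:] x = (x - u) * (x - u) + v * v" by (simp add: algebra_simps)
        also have "\<dots> > 0" using False by (intro add_nonneg_pos zero_le_square) (auto simp: zero_less_mult_iff neq_iff)
        finally show ?thesis .
      qed
      have "poly p a * poly p b = (poly [:u * u + v * v, - 2 * u, 1:] a * poly [:u * u + v * v, - 2 * u, 1:] b) * (poly q a * poly q b)"
        unfolding q poly_mult by (simp only: mult_ac)
      moreover have "poly [:u * u + v * v, - 2 * u, 1:] a * poly [:u * u + v * v, - 2 * u, 1:] b > 0"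
        using pos by (intro mult_pos_pos)
      ultimately have "poly q a * poly q b < 0" using less.prems by (metis mult_less_0_iff not_less_iff_gr_or_eq)
      from less.hyps[OF dq this] show ?thesis unfolding q by auto
    qed
  qed
  then show ?thesis unfolding has_ivp_def by (simp add: mult_neg_pos)
qed

lemma oring_of_simps [simp]:
  "carrier (oring_of A) = A" "x \<otimes>\<^bsub>oring_of A\<^esub> y = x * y" "x \<oplus>\<^bsub>oring_of A\<^esub> y = x + y"
  "\<one>\<^bsub>oring_of A\<^esub> = 1" "\<zero>\<^bsub>oring_of A\<^esub> = 0" "leq (oring_of A) x y \<longleftrightarrow> x \<le> y"
  by (simp_all add: oring_of_def)

text \<open>Polynomials as lists start with the leading coefficient, \<open>coeffs\<close> with the constant one.\<close>
lemma eval_rev_coeffs: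
  assumes R: "ring (oring_of (UNIV :: 'r::linordered_field set))"
  shows "ring.eval (oring_of UNIV) (rev (coeffs q)) a = poly q (a :: 'r)"
proof (induction q)
  case 0
  then show ?case by (simp add: ring.eval.simps[OF R])
next
  case (pCons c q)
  then have c: "coeffs (pCons c q) = c # coeffs q" using pCons.hyps by (auto simp: cCons_def)
  have "ring.eval (oring_of UNIV) (rev (coeffs q) @ [c]) a = ring.eval (oring_of UNIV) (rev (coeffs q)) a * a + c"
    using ring.eval_append_aux[OF R, of "rev (coeffs q)" c a] by simp
  then show ?case unfolding c rev.simps pCons.IH by (simp add: algebra_simps)
qed

lemma real_closed_ordered_field_ivp:
  assumes R: "real_closed_ordered_field (oring_of (UNIV :: 'r::linordered_field set))"
  shows "has_ivp TYPE('r)"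
proof (rule real_closed_imp_ivp)
  show "\<exists>b. a = b * b" if "0 \<le> a" for a :: 'r
    using real_closed_ordered_field.nonneg_square[OF R, of a] that unfolding oring_of_simps by blast
  have ring: "ring (oring_of (UNIV :: 'r set))"
    using R by (simp add: real_closed_ordered_field_def ordered_cring_def cring_def)
  fix p :: "'r poly" assume odd: "Parity.odd (Polynomial.degree p)"
  have p0: "p \<noteq> 0" using odd by auto
  define l where "l = rev (coeffs p)"
  have "l \<noteq> []" "hd l \<noteq> 0"
    using p0 by (simp_all add: l_def hd_rev last_coeffs_eq_coeff_degree)
  then have "l \<in> carrier (univ_poly (oring_of UNIV) (carrier (oring_of (UNIV :: 'r set))))"
    by (simp add: univ_poly_def polynomial_def)
  moreover have "Polynomials.degree l = Polynomial.degree p"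
    by (simp add: l_def length_coeffs p0)
  ultimately obtain a where "ring.eval (oring_of UNIV) l a = 0"
    using real_closed_ordered_field.odd_degree_root[OF R, of l] odd by auto
  then show "\<exists>x. poly p x = 0" using eval_rev_coeffs[OF ring, of p a] unfolding l_def by metis
qed

section \<open>A real closure of an ordered field\<close>

text \<open>If \<open>T\<close> contains \<open>0\<close> and \<open>1\<close>, this is a preordering of \<open>differences T\<close>, the ring generated by \<open>T\<close>
  (\<open>differences_ring\<close>); so the set \<open>T\<close> alone carries the information about both a ring and a preordering.\<close>
definition preordering :: "'k::comm_ring_1 set \<Rightarrow> bool" where
  "preordering T \<longleftrightarrow> (\<forall>a\<in>T. \<forall>b\<in>T. a + b \<in> T \<and> a * b \<in> T \<and> (a - b) * (a - b) \<in> T) \<and> - 1 \<notin> T"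

definition differences :: "'k::comm_ring_1 set \<Rightarrow> 'k set" where
  "differences T = {a - b | a b. a \<in> T \<and> b \<in> T}"

definition orderings_over :: "'a::linordered_field alg_closure set set" where
  "orderings_over = {T. preordering T \<and> to_ac ` {c. 0 \<le> c} \<subseteq> T}"

lemma differencesI: "a \<in> T \<Longrightarrow> b \<in> T \<Longrightarrow> a - b \<in> differences T"
  unfolding differences_def by blast

lemma preorderingD:
  assumes "preordering T"
  shows "a \<in> T \<Longrightarrow> b \<in> T \<Longrightarrow> a + b \<in> T" "a \<in> T \<Longrightarrow> b \<in> T \<Longrightarrow> a * b \<in> T"
    "x \<in> differences T \<Longrightarrow> x * x \<in> T" "- 1 \<notin> T"
  using assms unfolding preordering_def differences_def by blast+

lemma orderings_overD:
  assumes "T \<in> orderings_over"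
  shows "preordering T" "0 \<le> c \<Longrightarrow> to_ac c \<in> T" "0 \<in> T" "1 \<in> T"
proof -
  show "preordering T" and base: "0 \<le> c \<Longrightarrow> to_ac c \<in> T" for c
    using assms unfolding orderings_over_def by blast+
  show "0 \<in> T" "1 \<in> T" using base[of 0] base[of 1] by simp_all
qed

lemma orderings_over_base: "to_ac ` {c::'a::linordered_field. 0 \<le> c} \<in> orderings_over"
proof -
  have "preordering (to_ac ` {c::'a. 0 \<le> c})"
    unfolding preordering_def
  proof (intro conjI ballI)
    fix x y assume "x \<in> to_ac ` {c::'a. 0 \<le> c}" "y \<in> to_ac ` {c::'a. 0 \<le> c}"
    then obtain a b where ab: "x = to_ac a" "0 \<le> a" "y = to_ac b" "0 \<le> b" by blast
    have "x + y = to_ac (a + b)" "x * y = to_ac (a * b)" "(x - y) * (x - y) = to_ac ((a - b) * (a - b))"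
      by (simp_all add: ab)
    moreover have "to_ac c \<in> to_ac ` {c::'a. 0 \<le> c}" if "0 \<le> c" for c using that by (intro imageI CollectI)
    ultimately show "x + y \<in> to_ac ` {c::'a. 0 \<le> c}" "x * y \<in> to_ac ` {c::'a. 0 \<le> c}"
      "(x - y) * (x - y) \<in> to_ac ` {c::'a. 0 \<le> c}"
      using ab(2,4) by (simp_all only: add_nonneg_nonneg mult_nonneg_nonneg zero_le_square)
  next
    have "to_ac (c::'a) \<noteq> - 1" if "0 \<le> c" for c
    proof
      assume "to_ac c = - 1"
      then have "to_ac (c + 1) = 0" by simp
      then have "c + 1 = 0" by (simp only: to_ac_eq_0_iff)
      then show False using that by simp
    qed
    then show "- 1 \<notin> to_ac ` {c::'a. 0 \<le> c}" by (metis imageE mem_Collect_eq)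
  qed
  then show ?thesis by (simp add: orderings_over_def)
qed

lemma maximal_ordering_exists:
  "\<exists>T\<in>(orderings_over :: 'a::linordered_field alg_closure set set). \<forall>S\<in>orderings_over. T \<subseteq> S \<longrightarrow> S = T"
proof (rule subset_Zorn_nonempty)
  show "(orderings_over :: 'a alg_closure set set) \<noteq> {}" using orderings_over_base by blast
  fix \<C> :: "'a alg_closure set set" assume ne: "\<C> \<noteq> {}" and chain: "subset.chain orderings_over \<C>"
  have good: "T \<in> orderings_over" if "T \<in> \<C>" for T using chain that by (auto simp: subset.chain_def)
  have two: "\<exists>T\<in>\<C>. x \<in> T \<and> y \<in> T" if "x \<in> \<Union>\<C>" "y \<in> \<Union>\<C>" for x y
    using chain that unfolding subset.chain_def by blast
  have "x + y \<in> \<Union>\<C> \<and> x * y \<in> \<Union>\<C> \<and> (x - y) * (x - y) \<in> \<Union>\<C>" if xy: "x \<in> \<Union>\<C>" "y \<in> \<Union>\<C>" for x y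
  proof -
    obtain T where T: "T \<in> \<C>" "x \<in> T" "y \<in> T" using two[OF xy] by blast
    then have "preordering T" using good orderings_overD(1) by blast
    then show ?thesis using T unfolding preordering_def by blast
  qed
  moreover have "- 1 \<notin> \<Union>\<C>" using good orderings_overD(1) preorderingD(4) by blast
  moreover have "to_ac ` {c. 0 \<le> c} \<subseteq> \<Union>\<C>" using ne good orderings_overD(2) by blast
  ultimately show "\<Union>\<C> \<in> orderings_over" by (simp add: orderings_over_def preordering_def)
qed

definition real_closure_cone :: "'a::linordered_field alg_closure set" where
  "real_closure_cone = (SOME T. T \<in> orderings_over \<and> (\<forall>S\<in>orderings_over. T \<subseteq> S \<longrightarrow> S = T))"

lemma real_closure_cone: "(real_closure_cone :: 'a::linordered_field alg_closure set) \<in> orderings_over"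
  and real_closure_cone_maximal:
    "(S :: 'a alg_closure set) \<in> orderings_over \<Longrightarrow> real_closure_cone \<subseteq> S \<Longrightarrow> S = real_closure_cone"
proof -
  have "\<exists>T::'a::linordered_field alg_closure set. T \<in> orderings_over \<and> (\<forall>S\<in>orderings_over. T \<subseteq> S \<longrightarrow> S = T)"
    using maximal_ordering_exists by blast
  from someI_ex[OF this]
  have "(real_closure_cone::'a alg_closure set) \<in> orderings_over \<and> (\<forall>S\<in>orderings_over. (real_closure_cone::'a alg_closure set) \<subseteq> S \<longrightarrow> S = real_closure_cone)"
    unfolding real_closure_cone_def .
  then show "(real_closure_cone::'a alg_closure set) \<in> orderings_over"
    and "S \<in> orderings_over \<Longrightarrow> real_closure_cone \<subseteq> S \<Longrightarrow> S = real_closure_cone" for S :: "'a alg_closure set"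
    by blast+
qed

lemma differences_ring:
  assumes T: "T \<in> orderings_over"
  shows "subring_set (differences T)" "T \<subseteq> differences T"
proof -
  note TD = orderings_overD[OF T] and P = preorderingD[OF orderings_overD(1)[OF T]]
  show sub: "T \<subseteq> differences T" using TD(3) unfolding differences_def by force
  have "- x \<in> differences T" if "x \<in> differences T" for x
    using that unfolding differences_def by (auto intro: minus_diff_eq)
  moreover have "x + y \<in> differences T \<and> x * y \<in> differences T" if xy: "x \<in> differences T" "y \<in> differences T" for x y
  proof -
    obtain a b c d where abcd: "x = a - b" "y = c - d" "a \<in> T" "b \<in> T" "c \<in> T" "d \<in> T"
      using xy unfolding differences_def by blast
    have "x + y = (a + c) - (b + d)" "x * y = (a * c + b * d) - (a * d + b * c)"
      unfolding abcd(1,2) by (simp_all add: algebra_simps)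
    then show ?thesis by (simp only:) (intro conjI differencesI P(1) P(2) abcd)
  qed
  ultimately show "subring_set (differences T)"
    unfolding subring_set_def using sub TD(3,4) by blast
qed

text \<open>Let \<open>T\<close> be maximal. If \<open>x \<notin> T\<close>, the set \<open>T + x T\<close> contains \<open>- 1\<close>. If \<open>- x \<notin> T\<close> as well, then
  \<open>- 1 = a + x b = c - x d\<close> with \<open>a, b, c, d \<in> T\<close>, and the product \<open>(1 + a) (1 + c) = - x\<^sup>2 b d\<close> puts \<open>- 1\<close>
  into \<open>T\<close>.\<close>
lemma cone_total:
  assumes x: "x \<in> differences real_closure_cone"
  shows "x \<in> real_closure_cone \<or> - x \<in> (real_closure_cone :: 'a::linordered_field alg_closure set)"
proof -
  let ?T = "real_closure_cone :: 'a alg_closure set"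
  note TD = orderings_overD[OF real_closure_cone] and P = preorderingD[OF orderings_overD(1)[OF real_closure_cone]]
  note A = differences_ring[OF real_closure_cone]
  define adj where "adj y = {a + y * b | a b. a \<in> ?T \<and> b \<in> ?T}" for y
  have adj: "y \<in> ?T" if y: "y \<in> differences ?T" and m1: "- 1 \<notin> adj y" for y
  proof -
    have "preordering (adj y)" unfolding preordering_def
    proof (intro conjI ballI m1)
      fix u v assume "u \<in> adj y" "v \<in> adj y"
      then obtain a b c d where abcd: "u = a + y * b" "v = c + y * d" "a \<in> ?T" "b \<in> ?T" "c \<in> ?T" "d \<in> ?T"
        unfolding adj_def by blast
      have adjI: "p + y * q \<in> adj y" if "p \<in> ?T" "q \<in> ?T" for p q using that unfolding adj_def by blast
      have "u + v = (a + c) + y * (b + d)" unfolding abcd(1,2) by (simp add: algebra_simps)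
      then show "u + v \<in> adj y" by (simp only:) (intro adjI P(1) abcd)
      have "u * v = (a * c + (y * y) * (b * d)) + y * (a * d + b * c)" unfolding abcd(1,2) by (simp add: algebra_simps)
      moreover have "a * c + (y * y) * (b * d) \<in> ?T" by (intro P(1) P(2) P(3) y abcd)
      moreover have "a * d + b * c \<in> ?T" by (intro P(1) P(2) abcd)
      ultimately show "u * v \<in> adj y" by (simp only: adjI)
      have "u - v \<in> differences ?T"
        unfolding abcd(1,2) using abcd(3-6) y A(2) by (intro subring_setD[OF A(1)]) auto
      then have "(u - v) * (u - v) \<in> ?T" by (rule P(3))
      then have "(u - v) * (u - v) + y * 0 \<in> adj y" unfolding adj_def using TD(3) by blast
      then show "(u - v) * (u - v) \<in> adj y" by simp
    qed
    moreover have sub: "?T \<subseteq> adj y"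
    proof
      fix a assume "a \<in> ?T"
      then have "a + y * 0 \<in> adj y" unfolding adj_def using TD(3) by blast
      then show "a \<in> adj y" by simp
    qed
    ultimately have "adj y \<in> orderings_over" unfolding orderings_over_def using TD(2) by blast
    then have "adj y = ?T" using sub by (rule real_closure_cone_maximal)
    moreover have "0 + y * 1 \<in> adj y" unfolding adj_def using TD(3,4) by blast
    ultimately show ?thesis by simp
  qed
  have "\<not> (- 1 \<in> adj x \<and> - 1 \<in> adj (- x))"
  proof
    assume "- 1 \<in> adj x \<and> - 1 \<in> adj (- x)"
    then obtain a b c d where abcd: "- 1 = a + x * b" "- 1 = c + - x * d" "a \<in> ?T" "b \<in> ?T" "c \<in> ?T" "d \<in> ?T"
      unfolding adj_def by blast
    have "1 + a + x * b = 0" unfolding add.assoc abcd(1)[symmetric] by simp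
    then have e1: "1 + a = - (x * b)" by (simp only: eq_neg_iff_add_eq_0)
    have "1 + c + - x * d = 0" unfolding add.assoc abcd(2)[symmetric] by simp
    then have e2: "1 + c = x * d" by simp
    have "a + c + a * c + (x * x) * (b * d) = (1 + a) * (1 + c) - 1 + (x * x) * (b * d)"
      by (simp add: algebra_simps)
    also have "\<dots> = - 1" unfolding e1 e2 by (simp add: algebra_simps)
    finally have "- 1 = a + c + a * c + (x * x) * (b * d)" by (rule sym)
    moreover have "a + c + a * c + (x * x) * (b * d) \<in> ?T"
      by (intro P(1) P(2) P(3) x abcd)
    ultimately show False using P(4) by metis
  qed
  then show ?thesis using adj x subring_setD(3)[OF A(1) x] by blast
qed

text \<open>A ring between a field and an algebraic extension of it is a field: a polynomial relation for \<open>x \<noteq> 0\<close> with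
  non-zero constant term \<open>a\<close> reads \<open>a + x y = 0\<close> with \<open>y\<close> in the ring.\<close>
lemma algebraic_ring_inverse:
  fixes x :: "'a::field alg_closure"
  assumes A: "subring_set A" and base: "range to_ac \<subseteq> A" and x: "x \<in> A"
  shows "inverse x \<in> A"
proof (cases "x = 0")
  case False
  obtain p :: "'a poly" where p: "p \<noteq> 0" "poly (map_poly to_ac p) x = 0" by (rule alg_closure_algebraic)
  have "\<exists>q::'a poly. coeff q 0 \<noteq> 0 \<and> poly (map_poly to_ac q) x = 0"
    using p
  proof (induction p)
    case (pCons a p)
    show ?case
    proof (cases "a = 0")
      case True
      then show ?thesis using pCons False by (auto simp: map_poly_pCons)
    next
      case False
      then show ?thesis using pCons.prems by (intro exI[of _ "pCons a p"]) simp
    qed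
  qed simp
  then obtain a q where q: "a \<noteq> 0" "poly (map_poly to_ac (pCons a q)) x = 0"
    by (metis coeff_pCons_0 pCons_cases)
  define y where "y = poly (map_poly to_ac q) x"
  have "y \<in> A" unfolding y_def poly_altdef using base x
    by (intro subring_set_sum[OF A] subring_setD(5)[OF A] subring_set_power[OF A]) (auto simp: coeff_map_poly)
  have "to_ac a + x * y = 0" using q by (simp add: map_poly_pCons y_def)
  then have "x * (- (y * to_ac (inverse a))) = 1" using q(1)
    by (simp add: add_eq_0_iff field_simps)
  then have "inverse x = - (y * to_ac (inverse a))" by (metis inverse_unique)
  also have "\<dots> \<in> A" using \<open>y \<in> A\<close> base by (intro subring_setD[OF A]) (auto simp del: to_ac_inverse)
  finally show ?thesis .
qed (use subring_setD[OF A] in simp)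

lemma to_ac_in_differences:
  assumes "T \<in> orderings_over"
  shows "to_ac c \<in> differences T"
proof (cases "0 \<le> c")
  case True
  then show ?thesis using orderings_overD(2)[OF assms] differences_ring(2)[OF assms] by blast
next
  case False
  then have "to_ac (- c) \<in> differences T" using orderings_overD(2)[OF assms, of "- c"] differences_ring(2)[OF assms] by auto
  then have "- to_ac (- c) \<in> differences T" by (rule subring_setD[OF differences_ring(1)[OF assms]])
  then show ?thesis by simp
qed

lemma differences_inverse: "T \<in> orderings_over \<Longrightarrow> x \<in> differences T \<Longrightarrow> inverse x \<in> differences T"
  by (rule algebraic_ring_inverse) (auto intro: differences_ring to_ac_in_differences)

text \<open>If \<open>x \<noteq> 0\<close> and \<open>x, - x \<in> T\<close>, then \<open>- 1 = x (- x) (1/x)\<^sup>2 \<in> T\<close>.\<close>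
lemma cone_antisym:
  assumes T: "T \<in> orderings_over" and x: "x \<in> T" "- x \<in> T"
  shows "x = 0"
proof (rule ccontr)
  assume "x \<noteq> 0"
  note P = preorderingD[OF orderings_overD(1)[OF T]]
  have "inverse x * inverse x \<in> T"
    using x(1) differences_ring(2)[OF T] differences_inverse[OF T] P(3) by blast
  then have "(x * (- x)) * (inverse x * inverse x) \<in> T" using x P(2) by blast
  then have "- 1 \<in> T" using \<open>x \<noteq> 0\<close> by (simp add: field_simps)
  then show False using P(4) by blast
qed

text \<open>As an algebraic extension of a field this ring is a field, and by maximality the cone orders it totally.\<close>
typedef (overloaded) 'a real_closure = "differences (real_closure_cone :: 'a::linordered_field alg_closure set)"
  by (rule exI[of _ "to_ac 0"]) (rule to_ac_in_differences[OF real_closure_cone])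

setup_lifting type_definition_real_closure

instantiation real_closure :: (linordered_field) linordered_field
begin

lift_definition zero_real_closure :: "'a real_closure" is 0
  by (rule subring_setD[OF differences_ring(1)[OF real_closure_cone]])
lift_definition one_real_closure :: "'a real_closure" is 1
  by (rule subring_setD[OF differences_ring(1)[OF real_closure_cone]])
lift_definition plus_real_closure :: "'a real_closure \<Rightarrow> 'a real_closure \<Rightarrow> 'a real_closure" is "(+)"
  by (rule subring_setD[OF differences_ring(1)[OF real_closure_cone]])
lift_definition minus_real_closure :: "'a real_closure \<Rightarrow> 'a real_closure \<Rightarrow> 'a real_closure" is "(-)"
  by (rule subring_setD[OF differences_ring(1)[OF real_closure_cone]])
lift_definition times_real_closure :: "'a real_closure \<Rightarrow> 'a real_closure \<Rightarrow> 'a real_closure" is "(*)"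
  by (rule subring_setD[OF differences_ring(1)[OF real_closure_cone]])
lift_definition uminus_real_closure :: "'a real_closure \<Rightarrow> 'a real_closure" is uminus
  by (rule subring_setD[OF differences_ring(1)[OF real_closure_cone]])
lift_definition inverse_real_closure :: "'a real_closure \<Rightarrow> 'a real_closure" is inverse
  by (rule differences_inverse[OF real_closure_cone])
lift_definition less_eq_real_closure :: "'a real_closure \<Rightarrow> 'a real_closure \<Rightarrow> bool"
  is "\<lambda>x y. y - x \<in> real_closure_cone" .

definition divide_real_closure :: "'a real_closure \<Rightarrow> 'a real_closure \<Rightarrow> 'a real_closure" where
  "divide_real_closure x y = x * inverse y"
definition less_real_closure :: "'a real_closure \<Rightarrow> 'a real_closure \<Rightarrow> bool" where
  "less_real_closure x y \<longleftrightarrow> x \<le> y \<and> x \<noteq> y"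
definition abs_real_closure :: "'a real_closure \<Rightarrow> 'a real_closure" where
  "abs_real_closure x = (if x < 0 then - x else x)"
definition sgn_real_closure :: "'a real_closure \<Rightarrow> 'a real_closure" where
  "sgn_real_closure x = (if x = 0 then 0 else if 0 < x then 1 else - 1)"

instance
proof
  fix x y z :: "'a real_closure"
  show "x + y + z = x + (y + z)" by transfer (simp add: algebra_simps)
  show "x + y - x = y" by transfer simp
  show "x - y - z = x - (y + z)" by transfer (simp add: algebra_simps)
  show "0 * x = 0" "x * 0 = 0" by (transfer; simp)+
  show "x + y = y + x" by transfer (simp add: algebra_simps)
  show "0 + x = x" by transfer simp
  show "- x + x = 0" by transfer simp
  show "x - y = x + - y" by transfer simp
  show "x * y * z = x * (y * z)" by transfer (simp add: algebra_simps)
  show "x * y = y * x" by transfer (simp add: algebra_simps)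
  show "1 * x = x" by transfer simp
  show "(x + y) * z = x * z + y * z" by transfer (simp add: algebra_simps)
  show "(0::'a real_closure) \<noteq> 1" by transfer simp
  show "inverse x * x = 1" if "x \<noteq> 0" using that by transfer simp
  show "x div y = x * inverse y" by (rule divide_real_closure_def)
  show "inverse (0::'a real_closure) = 0" by transfer simp
  have refl: "x \<le> x" for x :: "'a real_closure" by transfer (simp add: orderings_overD(3)[OF real_closure_cone])
  show "x \<le> x" by (rule refl)
  show antisym: "x = y" if "x \<le> y" "y \<le> x" for x y :: "'a real_closure"
    using that
  proof transfer
    fix a b :: "'a alg_closure"
    assume "b - a \<in> real_closure_cone" "a - b \<in> real_closure_cone"
    then have "b - a = 0" using cone_antisym[OF real_closure_cone, of "b - a"] by simp
    then show "a = b" by simp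
  qed
  show "x \<le> z" if "x \<le> y" "y \<le> z"
    using that
  proof transfer
    fix a b c :: "'a alg_closure"
    assume "b - a \<in> real_closure_cone" "c - b \<in> real_closure_cone"
    then have "(b - a) + (c - b) \<in> real_closure_cone"
      using preorderingD(1)[OF orderings_overD(1)[OF real_closure_cone]] by blast
    then show "c - a \<in> real_closure_cone" by (simp add: algebra_simps)
  qed
  show "x < y \<longleftrightarrow> x \<le> y \<and> \<not> y \<le> x"
    unfolding less_real_closure_def using antisym refl by blast
  show "x \<le> y \<or> y \<le> x"
  proof transfer
    fix a b :: "'a alg_closure"
    assume "a \<in> differences real_closure_cone" "b \<in> differences real_closure_cone"
    then have "b - a \<in> differences real_closure_cone"
      by (intro subring_setD[OF differences_ring(1)[OF real_closure_cone]])
    from cone_total[OF this] show "b - a \<in> real_closure_cone \<or> a - b \<in> real_closure_cone" by simp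
  qed
  show "z + x \<le> z + y" if "x \<le> y" using that by transfer simp
  show "z * x < z * y" if "x < y" "0 < z"
  proof -
    have "z * x \<le> z * y" using that unfolding less_real_closure_def
    proof (transfer, elim conjE)
      fix a b c :: "'a alg_closure"
      assume "b - a \<in> real_closure_cone" "c - 0 \<in> real_closure_cone"
      then have "c * (b - a) \<in> real_closure_cone"
        using preorderingD(2)[OF orderings_overD(1)[OF real_closure_cone]] by simp
      then show "c * b - c * a \<in> real_closure_cone" by (simp add: algebra_simps)
    qed
    moreover have "z * x \<noteq> z * y" using that unfolding less_real_closure_def
      by transfer auto
    ultimately show ?thesis by (simp add: less_real_closure_def)
  qed
  show "\<bar>x\<bar> = (if x < 0 then - x else x)" by (rule abs_real_closure_def)
  show "sgn x = (if x = 0 then 0 else if 0 < x then 1 else - 1)" by (rule sgn_real_closure_def)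
qed

end

lemma hom_on_Rep_real_closure: "hom_on UNIV Rep_real_closure"
  by (simp add: hom_on_def one_real_closure.rep_eq plus_real_closure.rep_eq times_real_closure.rep_eq)

text \<open>The candidate for an extension of the preordering \<open>T\<close> to a larger ring \<open>Y\<close>.\<close>
inductive_set weighted_squares :: "'k::comm_ring_1 set \<Rightarrow> 'k set \<Rightarrow> 'k set" for T Y where
  zero: "0 \<in> weighted_squares T Y"
| add: "s \<in> weighted_squares T Y \<Longrightarrow> t \<in> T \<Longrightarrow> y \<in> Y \<Longrightarrow> s + t * (y * y) \<in> weighted_squares T Y"

lemma weighted_squares_add:
  assumes "u \<in> weighted_squares T Y" "v \<in> weighted_squares T Y"
  shows "u + v \<in> weighted_squares T Y"
  using assms(2,1) by induction (auto simp: add.assoc[symmetric] intro: weighted_squares.intros)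

lemma weighted_squares_mult:
  assumes T: "\<And>a b. a \<in> T \<Longrightarrow> b \<in> T \<Longrightarrow> a * b \<in> T" and Y: "subring_set Y"
    and uv: "u \<in> weighted_squares T Y" "v \<in> weighted_squares T Y"
  shows "u * v \<in> weighted_squares T Y"
  using uv(2,1)
proof (induction)
  case (add s t y)
  have "u * (t * (y * y)) \<in> weighted_squares T Y" using add.prems
  proof (induction)
    case (add s' t' y')
    have "(s' + t' * (y' * y')) * (t * (y * y)) = s' * (t * (y * y)) + (t' * t) * ((y' * y) * (y' * y))"
      by (simp add: algebra_simps)
    then show ?case
      using weighted_squares.add[OF add.IH T[OF \<open>t' \<in> T\<close> \<open>t \<in> T\<close>] subring_setD(5)[OF Y \<open>y' \<in> Y\<close> \<open>y \<in> Y\<close>]] by simp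
  qed (simp add: weighted_squares.zero)
  from weighted_squares_add[OF add.IH[OF add.prems] this] show ?case by (simp add: distrib_left)
qed (simp add: weighted_squares.zero)

lemma weighted_squares_subset:
  assumes T: "T \<subseteq> Y" and Y: "subring_set Y"
  shows "weighted_squares T Y \<subseteq> Y"
proof
  fix u assume "u \<in> weighted_squares T Y"
  then show "u \<in> Y" by induction (use T in \<open>auto intro!: subring_setD[OF Y]\<close>)
qed

lemma weighted_squares_ordering:
  assumes T: "T \<in> orderings_over" and TY: "T \<subseteq> Y" and Y: "subring_set Y" and m1: "- 1 \<notin> weighted_squares T Y"
  shows "weighted_squares T Y \<in> orderings_over" "T \<subseteq> weighted_squares T Y"
    "\<And>y. y \<in> Y \<Longrightarrow> y * y \<in> weighted_squares T Y"
proof -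
  note TD = orderings_overD[OF T] and P = preorderingD[OF orderings_overD(1)[OF T]]
  show sub: "T \<subseteq> weighted_squares T Y"
  proof
    fix t assume "t \<in> T"
    from weighted_squares.add[OF weighted_squares.zero this subring_setD(2)[OF Y]]
    show "t \<in> weighted_squares T Y" by simp
  qed
  show sq: "y * y \<in> weighted_squares T Y" if "y \<in> Y" for y
    using weighted_squares.add[OF weighted_squares.zero TD(4) that] by simp
  have "preordering (weighted_squares T Y)"
    unfolding preordering_def
  proof (intro conjI ballI m1)
    fix u v assume uv: "u \<in> weighted_squares T Y" "v \<in> weighted_squares T Y"
    show "u + v \<in> weighted_squares T Y" using uv by (rule weighted_squares_add)
    show "u * v \<in> weighted_squares T Y" using P(2) Y uv by (rule weighted_squares_mult)
    show "(u - v) * (u - v) \<in> weighted_squares T Y"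
      using uv weighted_squares_subset[OF TY Y] by (intro sq subring_setD(6)[OF Y]) auto
  qed
  then show "weighted_squares T Y \<in> orderings_over"
    unfolding orderings_over_def using sub TD(2) by blast
qed

text \<open>The argument of Artin and Schreier. Suppose that \<open>p\<close> changes sign between \<open>a\<close> and \<open>b\<close> without a root in
  between, while all such polynomials of smaller degree have one. Then \<open>p\<close> is a minimal polynomial of its
  root \<open>\<theta>\<close> in the algebraic closure. The sums of weighted squares in the field generated by \<open>\<theta>\<close> do not
  contain \<open>- 1\<close>. Otherwise \<open>- 1 = f(\<theta>)\<close> where \<open>f\<close> is non-negative everywhere and has degree at most
  \<open>2 d - 2\<close>, with \<open>d\<close> the degree of \<open>p\<close>. Then \<open>1 + f = p k\<close>, so \<open>k\<close> has degree less than \<open>d\<close> and changes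
  sign with \<open>p\<close>; but \<open>1 + f\<close> cannot vanish at a root of \<open>k\<close>. By maximality the
  extension is trivial, so \<open>p\<close> is linear, and its root does lie between \<open>a\<close> and \<open>b\<close>.\<close>
lemma real_closure_ivp: "has_ivp TYPE('a::linordered_field real_closure)"
proof -
  have main: "\<exists>x. a < x \<and> x < b \<and> poly p x = 0" if ab: "a < b" and sc: "poly p a * poly p b < 0"
    for p :: "'a real_closure poly" and a b
    using sc
  proof (induction "Polynomial.degree p" arbitrary: p rule: less_induct)
    case (less p)
    show ?case
    proof (rule ccontr)
      assume noroot: "\<not> ?case"
      define e where "e = (Rep_real_closure :: 'a real_closure \<Rightarrow> _)"
      have e: "hom_on UNIV e" unfolding e_def by (rule hom_on_Rep_real_closure)
      note hp = hom_poly_simps[OF e] and h = hom_onD[OF subring_set_UNIV e]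
      have einj: "e x = e y \<longleftrightarrow> x = y" for x y by (simp add: e_def Rep_real_closure_inject)
      have e0: "e x = 0 \<longleftrightarrow> x = 0" for x using einj[of x 0] h(2) by simp
      have p0: "p \<noteq> 0" using less.prems by auto
      define d where "d = Polynomial.degree p"
      have d: "d > 0"
      proof (rule ccontr)
        assume "\<not> d > 0"
        then obtain c where "p = [:c:]" using degree_0_id[of p] unfolding d_def by (metis gr0I)
        then show False using less.prems by (simp add: mult_less_0_iff)
      qed
      have "Polynomial.degree (map_poly e p) = d" unfolding d_def
        using p0 e0 by (simp add: map_poly_degree_eq)
      then obtain \<theta> where \<theta>: "poly (map_poly e p) \<theta> = 0" using alg_closed_imp_poly_has_root d by metis
      define ev where "ev g = poly (map_poly e g) \<theta>" for g
      have ev: "ev (g + k) = ev g + ev k" "ev (g * k) = ev g * ev k" "ev (smult c g) = e c * ev g"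
          "ev 1 = 1" "ev [:c:] = e c" for g k c
        by (simp_all add: ev_def hp)
      have evp: "ev p = 0" using \<theta> by (simp add: ev_def)
      have ev_mod: "ev (g mod k) = ev g" if "ev k = 0" for g k
        using ev(1)[of "k * (g div k)" "g mod k"] ev(2)[of k "g div k"] that by simp
      \<comment> \<open>A generator \<open>h0\<close> of the ideal of \<open>\<theta>\<close> divides \<open>p\<close>; a proper factorisation would give \<open>p\<close> a root in the interval.\<close>
      have evdvd: "p dvd g" if "ev g = 0" for g
      proof -
        obtain h0 where h0: "h0 \<noteq> 0" "ev h0 = 0"
          and h0min: "\<And>g. g \<noteq> 0 \<Longrightarrow> ev g = 0 \<Longrightarrow> Polynomial.degree h0 \<le> Polynomial.degree g"
          using ex_has_least_nat[of "\<lambda>g. g \<noteq> 0 \<and> ev g = 0" p Polynomial.degree] p0 evp by blast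
        have h0dvd: "h0 dvd g" if "ev g = 0" for g
        proof -
          have "g mod h0 = 0"
            using degree_mod_less[OF h0(1), of g] h0min[of "g mod h0"] ev_mod[OF h0(2), of g] that by force
          then show ?thesis by (simp add: mod_eq_0_iff_dvd)
        qed
        obtain k where k: "p = h0 * k" using h0dvd[OF evp] by (elim dvdE)
        have k0: "k \<noteq> 0" using k p0 by auto
        have dh0: "Polynomial.degree h0 > 0"
        proof (rule ccontr)
          assume "\<not> Polynomial.degree h0 > 0"
          then obtain c where "h0 = [:c:]" using degree_0_id[of h0] by (metis gr0I)
          then show False using h0 ev(5) e0 by auto
        qed
        have deg: "Polynomial.degree p = Polynomial.degree h0 + Polynomial.degree k"
          unfolding k by (rule degree_mult_eq[OF h0(1) k0])
        have "Polynomial.degree k = 0"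
        proof (rule ccontr)
          assume "Polynomial.degree k \<noteq> 0"
          then have lt: "Polynomial.degree h0 < Polynomial.degree p" "Polynomial.degree k < Polynomial.degree p"
            using deg dh0 by auto
          have "poly p a * poly p b = (poly h0 a * poly h0 b) * (poly k a * poly k b)"
            by (simp add: k algebra_simps)
          then have "poly h0 a * poly h0 b < 0 \<or> poly k a * poly k b < 0"
            using less.prems by (metis mult_less_0_iff)
          then have "(\<exists>x. a < x \<and> x < b \<and> poly h0 x = 0) \<or> (\<exists>x. a < x \<and> x < b \<and> poly k x = 0)"
            using less.hyps lt by blast
          then show False using noroot unfolding k by auto
        qed
        then obtain c where "k = [:c:]" using degree_0_id[of k] by metis
        then have "p = smult c h0" "c \<noteq> 0" using k k0 by (auto simp: mult.commute)
        then have "p dvd h0" by (metis dvd_smult_cancel dvd_refl smult_dvd)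
        then show ?thesis using h0dvd[OF that] by (rule dvd_trans)
      qed
      define T where "T = (real_closure_cone :: 'a alg_closure set)"
      have Tgood: "T \<in> orderings_over" unfolding T_def by (rule real_closure_cone)
      have T_nonneg: "\<exists>c\<ge>0. t = e c" if "t \<in> T" for t
      proof -
        have "t \<in> differences real_closure_cone" using that differences_ring(2)[OF Tgood] unfolding T_def by blast
        then have "t = e (Abs_real_closure t)" by (simp add: e_def Abs_real_closure_inverse)
        moreover from this have "0 \<le> Abs_real_closure t"
          using that by (simp add: less_eq_real_closure.rep_eq zero_real_closure.rep_eq T_def e_def)
        ultimately show ?thesis by blast
      qed
      define Y where "Y = range ev"
      have Y: "subring_set Y"
      proof -
        have "0 \<in> Y" "1 \<in> Y" unfolding Y_def using ev(4) ev(5)[of 0] h(2) by (metis rangeI)+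
        moreover have "- x \<in> Y" if xY: "x \<in> Y" for x
        proof -
          obtain g where "x = ev g" using xY unfolding Y_def by blast
          then have "- x = ev (smult (- 1) g)" using ev(3)[of "- 1" g] h(1) h(5)[of 1] by simp
          then show ?thesis unfolding Y_def by blast
        qed
        moreover have "x + y \<in> Y \<and> x * y \<in> Y" if "x \<in> Y" "y \<in> Y" for x y
          using that unfolding Y_def by (metis (no_types, lifting) ev(1,2) rangeE rangeI)
        ultimately show ?thesis unfolding subring_set_def by blast
      qed
      have TY: "T \<subseteq> Y" unfolding Y_def using T_nonneg ev(5) by (metis rangeI subsetI)
      have psd: "\<exists>f. u = ev f \<and> (\<forall>x. poly f x \<ge> 0) \<and> Polynomial.degree f \<le> 2 * d - 2"
        if "u \<in> weighted_squares T Y" for u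
        using that
      proof induction
        case zero
        then show ?case using ev(5)[of 0] h(2) by (intro exI[of _ 0]) simp
      next
        case (add s t y)
        then obtain f where f: "s = ev f" "\<forall>x. poly f x \<ge> 0" "Polynomial.degree f \<le> 2 * d - 2" by blast
        obtain c where c: "c \<ge> 0" "t = e c" using T_nonneg add by blast
        obtain g where "y = ev g" using add unfolding Y_def by blast
        then have g: "y = ev (g mod p)" using ev_mod[OF evp] by simp
        let ?g = "g mod p"
        have "Polynomial.degree ?g < d" using degree_mod_less[OF p0, of g] d unfolding d_def by auto
        then have "Polynomial.degree (smult c (?g * ?g)) \<le> 2 * d - 2"
          using degree_mult_le[of ?g ?g] degree_smult_le[of c "?g * ?g"] by linarith
        then have "Polynomial.degree (f + smult c (?g * ?g)) \<le> 2 * d - 2" using f(3) by (intro degree_add_le)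
        moreover have "poly (f + smult c (?g * ?g)) x \<ge> 0" for x using f(2) c(1) by simp
        moreover have "s + t * (y * y) = ev (f + smult c (?g * ?g))" by (simp add: ev f(1) c(2) g)
        ultimately show ?case by blast
      qed
      have m1: "- 1 \<notin> weighted_squares T Y"
      proof
        assume "- 1 \<in> weighted_squares T Y"
        then obtain f where f: "- 1 = ev f" "\<And>x. poly f x \<ge> 0" "Polynomial.degree f \<le> 2 * d - 2"
          using psd by blast
        have "ev (1 + f) = 0" unfolding ev f(1)[symmetric] by simp
        then obtain k where k: "1 + f = p * k" using evdvd by (meson dvdE)
        have pos: "poly (1 + f) x > 0" for x using f(2)[of x] by (simp add: add_pos_nonneg)
        have k0: "k \<noteq> 0" using k pos[of 0] by auto
        have "Polynomial.degree (1 + f) \<le> 2 * d - 2" using f(3) by (intro degree_add_le) auto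
        moreover have "Polynomial.degree (1 + f) = d + Polynomial.degree k"
          unfolding k d_def by (rule degree_mult_eq[OF p0 k0])
        ultimately have dk: "Polynomial.degree k < Polynomial.degree p" using d unfolding d_def by linarith
        have "poly (1 + f) a * poly (1 + f) b > 0" using pos by (intro mult_pos_pos)
        moreover have "poly (1 + f) a * poly (1 + f) b = (poly p a * poly p b) * (poly k a * poly k b)"
          unfolding k by (simp add: algebra_simps)
        ultimately have "poly k a * poly k b < 0" using less.prems by (metis zero_less_mult_iff order_less_asym)
        then obtain r where "poly k r = 0" using less.hyps[OF dk] by blast
        then have "poly (1 + f) r = 0" unfolding k by simp
        then show False using pos[of r] by simp
      qed
      note W = weighted_squares_ordering[OF Tgood TY Y m1]
      have WT: "weighted_squares T Y = T"
        unfolding T_def by (rule real_closure_cone_maximal) (use W in \<open>auto simp: T_def\<close>)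
      \<comment> \<open>\<open>\<theta> = ((\<theta> + 1) / 2)\<^sup>2 - ((\<theta> - 1) / 2)\<^sup>2\<close> is a difference of squares.\<close>
      define y where "y = ev [:1/2, 1/2:]"
      define z where "z = ev [:-1/2, 1/2:]"
      have evsq: "ev g * ev g \<in> T" for g 
      proof -
        have "ev g \<in> Y" unfolding Y_def by simp
        from W(3)[OF this] show ?thesis unfolding WT .
      qed
      have "y * y \<in> T" "z * z \<in> T" unfolding y_def z_def by (rule evsq)+
      then have "y * y - z * z \<in> differences T" by (rule differencesI)
      moreover have "y * y - z * z = \<theta>"
      proof -
        have "y * y - z * z = ev ([:1/2, 1/2:] * [:1/2, 1/2:] + smult (- 1) ([:-1/2, 1/2:] * [:-1/2, 1/2:]))"
          unfolding ev y_def z_def using h(1) h(5)[of 1] by simp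
        also have "[:1/2, 1/2:] * [:1/2, 1/2:] + smult (- 1) ([:-1/2, 1/2:] * [:-1/2, 1/2:]) = [:0, 1 :: 'a real_closure:]"
          by simp
        also have "ev [:0, 1:] = \<theta>" by (simp add: ev_def hp h)
        finally show ?thesis .
      qed
      ultimately have "\<theta> \<in> differences real_closure_cone" by (simp add: T_def)
      then obtain r where r: "\<theta> = e r" unfolding e_def by (metis Abs_real_closure_inverse)
      have "ev [:- r, 1:] = 0" by (simp add: ev_def hp h r)
      then obtain k where k: "[:- r, 1:] = p * k" using evdvd by (meson dvdE)
      have k0: "k \<noteq> 0" using k by auto
      have "Polynomial.degree [:- r, 1:] = d + Polynomial.degree k"
        unfolding k d_def by (rule degree_mult_eq[OF p0 k0])
      then have "Polynomial.degree k = 0" using d by simp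
      then obtain c where c: "k = [:c:]" using degree_0_id[of k] by metis
      have c0: "c \<noteq> 0" using c k0 by auto
      have lin: "x - r = poly p x * c" for x
        using arg_cong[OF k, of "\<lambda>q. poly q x"] by (simp add: c)
      have "(a - r) * (b - r) = (poly p a * poly p b) * (c * c)" unfolding lin by (simp add: algebra_simps)
      also have "\<dots> < 0" using c0 by (intro mult_neg_pos[OF less.prems]) (auto simp: zero_less_mult_iff neq_iff)
      finally have "a < r \<and> r < b" using ab by (auto simp: mult_less_0_iff)
      moreover have "poly p r = 0" using lin[of r] c0 by simp
      ultimately show False using noroot by blast
    qed
  qed
  then show ?thesis unfolding has_ivp_def by (simp add: mult_neg_pos)
qed

lift_definition to_real_closure :: "'a::linordered_field \<Rightarrow> 'a real_closure" is to_ac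
  by (rule to_ac_in_differences[OF real_closure_cone])

lemma hom_on_to_real_closure: "hom_on UNIV to_real_closure"
  unfolding hom_on_def by (intro conjI ballI; transfer; simp)

lemma to_real_closure_nonneg: "0 \<le> c \<Longrightarrow> 0 \<le> to_real_closure c"
  by transfer (simp add: orderings_overD(2)[OF real_closure_cone])

lemma sg_to_real_closure: "sg (to_real_closure c) = sg c"
proof -
  have z: "to_real_closure c = 0 \<longleftrightarrow> c = 0" by transfer simp
  have m: "to_real_closure (- c) = - to_real_closure c" by transfer simp
  have "0 \<le> to_real_closure c" if "0 \<le> c" using that by (rule to_real_closure_nonneg)
  moreover have "to_real_closure c \<le> 0" if "c \<le> 0" using to_real_closure_nonneg[of "- c"] that m by simp
  ultimately show ?thesis using z by (cases c "0::'a" rule: linorder_cases) (auto simp: sg_def less_le)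
qed

section \<open>Evaluation of polynomials in several variables\<close>

lemma mpolys_single: "c \<in> M \<Longrightarrow> Poly_Mapping.keys m \<subseteq> {..<n} \<Longrightarrow> Poly_Mapping.single m c \<in> mpolys M n"
  by (auto simp: mpolys_def)

lemma mpolys_add:
  assumes M: "subring_set M" and p: "p \<in> mpolys M n" and q: "q \<in> mpolys M n"
  shows "p + q \<in> mpolys M n"
proof -
  have "Poly_Mapping.lookup p m \<in> M" "Poly_Mapping.lookup q m \<in> M" for m
    using p q subring_setD(1)[OF M] unfolding mpolys_def
    by (metis (mono_tags, lifting) mem_Collect_eq not_in_keys_iff_lookup_eq_zero)+
  then have "Poly_Mapping.lookup (p + q) m \<in> M" for m
    by (simp add: lookup_add subring_setD(4)[OF M])
  moreover have "Poly_Mapping.keys m \<subseteq> {..<n}" if "m \<in> Poly_Mapping.keys (p + q)" for m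
    using that keys_add[of p q] p q unfolding mpolys_def by blast
  ultimately show ?thesis unfolding mpolys_def by blast
qed

lemma mpolys_monomial_induct [consumes 1, case_names zero add]:
  assumes p: "p \<in> mpolys M n" and zero: "P 0"
    and add: "\<And>m c p. c \<in> M \<Longrightarrow> Poly_Mapping.keys m \<subseteq> {..<n} \<Longrightarrow> p \<in> mpolys M n \<Longrightarrow> P p \<Longrightarrow> P (Poly_Mapping.single m c + p)"
  shows "P p"
  using p
proof (induction "card (Poly_Mapping.keys p)" arbitrary: p)
  case 0
  then have "p = 0" by simp
  then show ?case using zero by simp
next
  case (Suc k)
  then obtain m where m: "m \<in> Poly_Mapping.keys p" by (metis card.empty ex_in_conv nat.distinct(1))
  define q where "q = Poly_Mapping.update m 0 p"
  have kq: "Poly_Mapping.keys q = Poly_Mapping.keys p - {m}" by (simp add: q_def keys_update)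
  have q: "q \<in> mpolys M n" using Suc.prems kq unfolding mpolys_def by (auto simp: q_def lookup_update)
  have "P q" using Suc.hyps(1)[OF _ q] Suc.hyps(2) m kq by simp
  moreover have "p = Poly_Mapping.single m (Poly_Mapping.lookup p m) + q"
    by (rule poly_mapping_eqI) (simp add: lookup_add q_def lookup_update lookup_single when_def)
  moreover have "Poly_Mapping.lookup p m \<in> M" "Poly_Mapping.keys m \<subseteq> {..<n}"
    using Suc.prems m by (auto simp: mpolys_def)
  ultimately show ?case using add q by metis
qed

lemma keys_plus_nat: "Poly_Mapping.keys (a + b) \<subseteq> S \<longleftrightarrow> Poly_Mapping.keys a \<subseteq> S \<and> Poly_Mapping.keys (b :: nat \<Rightarrow>\<^sub>0 nat) \<subseteq> S"
proof -
  have "Poly_Mapping.keys (a + b) = Poly_Mapping.keys a \<union> Poly_Mapping.keys b"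
    by (auto simp: in_keys_iff lookup_add)
  then show ?thesis by simp
qed

lemma zero_in_mpolys: "0 \<in> mpolys M n"
  by (simp add: mpolys_def)

lemma mpolys_subring:
  assumes M: "subring_set M"
  shows "subring_set (mpolys M n)"
proof -
  note MD = subring_setD[OF M]
  have mon: "Poly_Mapping.single m c * q \<in> mpolys M n"
    if "c \<in> M" "Poly_Mapping.keys m \<subseteq> {..<n}" "q \<in> mpolys M n" for m c q
    using that(3)
  proof (induction q rule: mpolys_monomial_induct)
    case (add m' c' q)
    have "Poly_Mapping.single m c * Poly_Mapping.single m' c' \<in> mpolys M n"
      using that add by (simp add: mult_single) (intro mpolys_single MD; auto simp: keys_plus_nat)
    then show ?case using add.IH by (simp only: distrib_left) (intro mpolys_add[OF M])
  qed (simp add: zero_in_mpolys)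
  have mult: "p * q \<in> mpolys M n" if "p \<in> mpolys M n" "q \<in> mpolys M n" for p q
    using that(1)
  proof (induction p rule: mpolys_monomial_induct)
    case (add m c p)
    then show ?case using mon[OF add(1,2) that(2)] by (simp only: distrib_right) (intro mpolys_add[OF M])
  qed (simp add: zero_in_mpolys)
  have one: "1 \<in> mpolys M n" unfolding single_one[symmetric] using MD(2) by (intro mpolys_single) auto
  moreover have "- p \<in> mpolys M n" if "p \<in> mpolys M n" for p
    using that MD(3) by (auto simp: mpolys_def)
  ultimately show ?thesis
    unfolding subring_set_def using zero_in_mpolys mult mpolys_add[OF M] by blast
qed

lemma Const_in_mpolys: "c \<in> M \<Longrightarrow> Const c \<in> mpolys M n"
  unfolding Const_def by (rule mpolys_single) auto

lemma Var_in_mpolys: "subring_set M \<Longrightarrow> i < n \<Longrightarrow> Var i \<in> mpolys M n"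
  unfolding Var_def by (rule mpolys_single) (auto simp: subring_setD)

lemma hom_on_Const: "hom_on UNIV Const"
  by (simp add: hom_on_def Const_def single_add mult_single)

lemma monomial_eq: 
  assumes "Poly_Mapping.keys m \<subseteq> {..<n}"
  shows "Poly_Mapping.single m c = Const c * (\<Prod>i<n. Var i ^ Poly_Mapping.lookup m i)"
proof -
  have pow: "Var i ^ k = (Poly_Mapping.single (Poly_Mapping.single i k) 1 :: 'a mpoly)" for i k
    by (induction k) (simp_all add: Var_def mult_single flip: single_add)
  have "(\<Prod>i\<in>I. Var i ^ k i) = (Poly_Mapping.single (\<Sum>i\<in>I. Poly_Mapping.single i (k i)) 1 :: 'a mpoly)" if "finite I" for I k
    using that by (induction I rule: finite_induct) (simp_all add: pow mult_single)
  moreover have "(\<Sum>i<n. Poly_Mapping.single i (Poly_Mapping.lookup m i)) = m"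
  proof (rule poly_mapping_eqI)
    fix k
    have "Poly_Mapping.lookup m k = 0" if "\<not> k < n" using that assms by (meson in_keys_iff lessThan_iff subsetD)
    then show "Poly_Mapping.lookup (\<Sum>i<n. Poly_Mapping.single i (Poly_Mapping.lookup m i)) k = Poly_Mapping.lookup m k"
      by (simp add: lookup_sum lookup_single when_def)
  qed
  ultimately show ?thesis by (simp add: Const_def mult_single)
qed

lemma mpolys_induct [consumes 2, case_names Const Var add mult]:
  assumes M: "subring_set M" and p: "p \<in> mpolys M n"
    and const: "\<And>c. c \<in> M \<Longrightarrow> P (Const c)" and var: "\<And>i. i < n \<Longrightarrow> P (Var i)"
    and add: "\<And>p q. p \<in> mpolys M n \<Longrightarrow> q \<in> mpolys M n \<Longrightarrow> P p \<Longrightarrow> P q \<Longrightarrow> P (p + q)"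
    and mult: "\<And>p q. p \<in> mpolys M n \<Longrightarrow> q \<in> mpolys M n \<Longrightarrow> P p \<Longrightarrow> P q \<Longrightarrow> P (p * q)"
  shows "P p"
proof -
  note A = mpolys_subring[OF M, of n] and MD = subring_setD[OF M]
  have one: "P 1" using const[OF MD(2)] by (simp add: Const_def)
  have zero: "P 0" using const[OF MD(1)] by (simp add: Const_def)
  have pow: "P (Var i ^ k)" if "i < n" for i k
    by (induction k) (use one that in \<open>auto intro!: mult var Var_in_mpolys[OF M] subring_set_power[OF A]\<close>)
  have prod: "P (\<Prod>i\<in>I. Var i ^ k i)" if "finite I" "I \<subseteq> {..<n}" for I k
    using that by (induction I rule: finite_induct)
      (use one in \<open>auto intro!: mult pow Var_in_mpolys[OF M] subring_set_power[OF A] subring_set_prod[OF A]\<close>)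
  show ?thesis
    using p
  proof (induction p rule: mpolys_monomial_induct)
    case (add m c p)
    have "P (Poly_Mapping.single m c)"
      unfolding monomial_eq[OF add(2)] using add(1)
      by (intro mult const prod Const_in_mpolys subring_set_prod[OF A] subring_set_power[OF A] Var_in_mpolys[OF M]) auto
    then show ?case using add by (intro assms(5) mpolys_single)
  qed (rule zero)
qed

lemma ring_of_simps [simp]:
  "carrier (ring_of A) = A" "x \<otimes>\<^bsub>ring_of A\<^esub> y = x * y" "x \<oplus>\<^bsub>ring_of A\<^esub> y = x + y"
  "\<one>\<^bsub>ring_of A\<^esub> = 1" "\<zero>\<^bsub>ring_of A\<^esub> = 0"
  by (simp_all add: ring_of_def)

lemma cring_ring_of:
  assumes A: "subring_set A"
  shows "cring (ring_of A)"
proof (rule cringI)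
  note AD = subring_setD[OF A]
  show "abelian_group (ring_of A)"
  proof (rule abelian_groupI)
    show "\<exists>y\<in>carrier (ring_of A). y \<oplus>\<^bsub>ring_of A\<^esub> x = \<zero>\<^bsub>ring_of A\<^esub>" if "x \<in> carrier (ring_of A)" for x
      using that AD(3)[of x] by (auto intro!: bexI[of _ "- x"])
  qed (auto simp: AD algebra_simps)
  show "Group.comm_monoid (ring_of A)"
    by (rule comm_monoidI) (auto simp: AD algebra_simps)
qed (simp add: algebra_simps)

lemma hom_on_iff_ring_hom:
  "e \<in> ring_hom (ring_of A) (ring_of UNIV) \<longleftrightarrow> hom_on A e"
  by (auto simp: ring_hom_def hom_on_def)

definition mon_eval :: "('s, 'b) ring_scheme \<Rightarrow> nat \<Rightarrow> (nat \<Rightarrow> 's) \<Rightarrow> (nat \<Rightarrow>\<^sub>0 nat) \<Rightarrow> 's" where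
  "mon_eval S n x m = (\<Otimes>\<^bsub>S\<^esub> i \<in> {..<n}. x i [^]\<^bsub>S\<^esub> Poly_Mapping.lookup m i)"

context cring
begin

lemma mon_eval_closed: "x \<in> {..<n} \<rightarrow> carrier R \<Longrightarrow> mon_eval R n x m \<in> carrier R"
  unfolding mon_eval_def by (intro finprod_closed) auto

lemma mon_eval_add:
  assumes "x \<in> {..<n} \<rightarrow> carrier R"
  shows "mon_eval R n x (m + m') = mon_eval R n x m \<otimes> mon_eval R n x m'"
proof -
  have "mon_eval R n x (m + m') = (\<Otimes> i \<in> {..<n}. (x i [^] Poly_Mapping.lookup m i) \<otimes> (x i [^] Poly_Mapping.lookup m' i))"
    unfolding mon_eval_def using assms
    by (intro finprod_cong) (auto simp: lookup_add nat_pow_mult Pi_iff simp_implies_def)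
  also have "\<dots> = mon_eval R n x m \<otimes> mon_eval R n x m'"
    unfolding mon_eval_def using assms by (intro finprod_multf) auto
  finally show ?thesis .
qed

lemma ring_hom_facts:
  assumes M: "subring_set M" and h: "h \<in> ring_hom (ring_of M) R"
  shows   "c \<in> M \<Longrightarrow> h c \<in> carrier R" "c \<in> M \<Longrightarrow> d \<in> M \<Longrightarrow> h (c + d) = h c \<oplus> h d"
  "c \<in> M \<Longrightarrow> d \<in> M \<Longrightarrow> h (c * d) = h c \<otimes> h d" "h 1 = \<one>" "h 0 = \<zero>"
proof -
  show closed: "c \<in> M \<Longrightarrow> h c \<in> carrier R" and add: "c \<in> M \<Longrightarrow> d \<in> M \<Longrightarrow> h (c + d) = h c \<oplus> h d"
    and "c \<in> M \<Longrightarrow> d \<in> M \<Longrightarrow> h (c * d) = h c \<otimes> h d" "h 1 = \<one>" for c d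
    using h by (auto simp: ring_hom_def)
  have "h 0 \<oplus> h 0 = h 0" using add[of 0 0] subring_setD(1)[OF M] by simp
  then show "h 0 = \<zero>" using closed subring_setD(1)[OF M] by (metis add.r_cancel_one')
qed

context
  fixes M :: "'r::comm_ring_1 set" and h and n :: nat and x
  assumes M: "subring_set M" and h: "h \<in> ring_hom (ring_of M) R" and x: "x \<in> {..<n} \<rightarrow> carrier R"
begin

lemmas hom_facts = ring_hom_facts[OF M h]

lemma lookup_in: "p \<in> mpolys M n \<Longrightarrow> Poly_Mapping.lookup p m \<in> M"
  using subring_setD(1)[OF M] unfolding mpolys_def
  by (metis (mono_tags, lifting) mem_Collect_eq not_in_keys_iff_lookup_eq_zero)

text \<open>With the range of summation enlarged to a common finite set of monomials, additivity of the evaluation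
  becomes additivity of finite sums.\<close>
lemma mpoly_eval_superset:
  assumes p: "p \<in> mpolys M n" and F: "finite F" "Poly_Mapping.keys p \<subseteq> F"
  shows "mpoly_eval R n h p x = (\<Oplus> m \<in> F. h (Poly_Mapping.lookup p m) \<otimes> mon_eval R n x m)"
  unfolding mpoly_eval_def mon_eval_def[symmetric]
proof (rule add.finprod_mono_neutral_cong_left[OF F])
  show "h (Poly_Mapping.lookup p i) \<otimes> mon_eval R n x i = \<zero>" if "i \<in> F - Poly_Mapping.keys p" for i
    using that by (simp add: in_keys_iff hom_facts mon_eval_closed[OF x])
  show "(\<lambda>m. h (Poly_Mapping.lookup p m) \<otimes> mon_eval R n x m) \<in> F \<rightarrow> carrier R"
    using lookup_in[OF p] by (auto simp: hom_facts mon_eval_closed[OF x])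
qed auto

lemma mpoly_eval_closed:
  assumes p: "p \<in> mpolys M n"
  shows "mpoly_eval R n h p x \<in> carrier R"
  unfolding mpoly_eval_superset[OF p finite_keys subset_refl]
  by (intro finsum_closed) (auto simp: lookup_in[OF p] hom_facts mon_eval_closed[OF x])

lemma mpoly_eval_single:
  assumes c: "c \<in> M" and m: "Poly_Mapping.keys m \<subseteq> {..<n}"
  shows "mpoly_eval R n h (Poly_Mapping.single m c) x = h c \<otimes> mon_eval R n x m"
proof -
  have "mpoly_eval R n h (Poly_Mapping.single m c) x =
      (\<Oplus> m' \<in> {m}. h (Poly_Mapping.lookup (Poly_Mapping.single m c) m') \<otimes> mon_eval R n x m')"
    by (rule mpoly_eval_superset[OF mpolys_single[OF c m]]) auto
  then show ?thesis by (simp add: finsum_insert hom_facts c mon_eval_closed[OF x])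
qed

lemma mpoly_eval_add:
  assumes p: "p \<in> mpolys M n" and q: "q \<in> mpolys M n"
  shows "mpoly_eval R n h (p + q) x = mpoly_eval R n h p x \<oplus> mpoly_eval R n h q x"
proof -
  let ?F = "Poly_Mapping.keys p \<union> Poly_Mapping.keys q"
  have "mpoly_eval R n h (p + q) x = (\<Oplus> m \<in> ?F. h (Poly_Mapping.lookup (p + q) m) \<otimes> mon_eval R n x m)"
    using keys_add[of p q] by (intro mpoly_eval_superset mpolys_add M p q) auto
  also have "\<dots> = (\<Oplus> m \<in> ?F. h (Poly_Mapping.lookup p m) \<otimes> mon_eval R n x m \<oplus> h (Poly_Mapping.lookup q m) \<otimes> mon_eval R n x m)"
    by (intro finsum_cong) (auto simp: lookup_add hom_facts lookup_in[OF p] lookup_in[OF q] mon_eval_closed[OF x] l_distr simp_implies_def)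
  also have "\<dots> = (\<Oplus> m \<in> ?F. h (Poly_Mapping.lookup p m) \<otimes> mon_eval R n x m) \<oplus> (\<Oplus> m \<in> ?F. h (Poly_Mapping.lookup q m) \<otimes> mon_eval R n x m)"
    by (intro finsum_addf) (auto simp: hom_facts lookup_in[OF p] lookup_in[OF q] mon_eval_closed[OF x])
  also have "\<dots> = mpoly_eval R n h p x \<oplus> mpoly_eval R n h q x"
    by (subst (1 2) mpoly_eval_superset[of _ ?F, symmetric]) (use p q in auto)
  finally show ?thesis .
qed

lemma mpoly_eval_zero: "mpoly_eval R n h 0 x = \<zero>"
  by (simp add: mpoly_eval_def)

text \<open>Both sides are additive in \<open>p\<close> and in \<open>q\<close>, which leaves the case of two monomials.\<close>
lemma mpoly_eval_mult:
  assumes p: "p \<in> mpolys M n" and q: "q \<in> mpolys M n"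
  shows "mpoly_eval R n h (p * q) x = mpoly_eval R n h p x \<otimes> mpoly_eval R n h q x"
proof -
  note A = mpolys_subring[OF M, of n] and MD = subring_setD[OF M]
  note closed = hom_facts mon_eval_closed[OF x] mpoly_eval_closed
  have mon: "mpoly_eval R n h (Poly_Mapping.single m c * q) x = h c \<otimes> mon_eval R n x m \<otimes> mpoly_eval R n h q x"
    if cm: "c \<in> M" "Poly_Mapping.keys m \<subseteq> {..<n}" for m c
    using q
  proof (induction q rule: mpolys_monomial_induct)
    case zero
    then show ?case by (simp add: mpoly_eval_zero closed cm)
  next
    case (add m' c' q)
    have s: "Poly_Mapping.single m c \<in> mpolys M n" "Poly_Mapping.single m' c' \<in> mpolys M n"
      using cm add by (auto intro: mpolys_single)
    have "mpoly_eval R n h (Poly_Mapping.single m c * Poly_Mapping.single m' c') x = h (c * c') \<otimes> mon_eval R n x (m + m')"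
      unfolding mult_single using cm add by (intro mpoly_eval_single) (auto simp: MD keys_plus_nat)
    also have "\<dots> = h c \<otimes> mon_eval R n x m \<otimes> (h c' \<otimes> mon_eval R n x m')"
      using cm add by (simp add: hom_facts mon_eval_add[OF x] mon_eval_closed[OF x] m_ac)
    finally have e: "mpoly_eval R n h (Poly_Mapping.single m c * Poly_Mapping.single m' c') x = \<dots>" .
    show ?case
      unfolding distrib_left
      using cm add s
      by (simp add: mpoly_eval_add subring_setD(5)[OF A] e add.IH mpoly_eval_single r_distr closed)
  qed
  show ?thesis
    using p
  proof (induction p rule: mpolys_monomial_induct)
    case zero
    then show ?case using q by (simp add: mpoly_eval_zero closed)
  next
    case (add m c p)
    have s: "Poly_Mapping.single m c \<in> mpolys M n" using add by (auto intro: mpolys_single)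
    show ?case
      unfolding distrib_right
      using add s q
      by (simp add: mpoly_eval_add subring_setD(5)[OF A] mon add.IH mpoly_eval_single l_distr closed)
  qed
qed

lemma mpoly_eval_Const: "c \<in> M \<Longrightarrow> mpoly_eval R n h (Const c) x = h c"
proof -
  assume c: "c \<in> M"
  have "mon_eval R n x 0 = \<one>"
    unfolding mon_eval_def by (intro finprod_one_eqI) simp
  then show ?thesis unfolding Const_def using mpoly_eval_single[OF c, of 0] by (simp add: hom_facts c)
qed

lemma mpoly_eval_Var: "i < n \<Longrightarrow> mpoly_eval R n h (Var i) x = x i"
proof -
  assume i: "i < n"
  have xc: "x j \<in> carrier R" if "j < n" for j using x that by auto
  have "mon_eval R n x (Poly_Mapping.single i 1) = (\<Otimes> j \<in> {..<n}. if i = j then x j else \<one>)"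
    unfolding mon_eval_def using xc
    by (intro finprod_cong) (auto simp: lookup_single when_def simp_implies_def)
  also have "\<dots> = x i"
    using xc i by (intro finprod_singleton) auto
  finally show ?thesis unfolding Var_def
    using mpoly_eval_single[OF subring_setD(2)[OF M], of "Poly_Mapping.single i 1"] i xc by (simp add: hom_facts)
qed

lemma mpoly_eval_ring_hom: "(\<lambda>p. mpoly_eval R n h p x) \<in> ring_hom (ring_of (mpolys M n)) R"
proof (rule ring_hom_memI)
  show "mpoly_eval R n h \<one>\<^bsub>ring_of (mpolys M n)\<^esub> x = \<one>"
    using mpoly_eval_Const[OF subring_setD(2)[OF M]] by (simp add: Const_def hom_facts)
qed (auto simp: mpoly_eval_closed mpoly_eval_add mpoly_eval_mult)

end

text \<open>Every homomorphism on \<open>M[X\<^sub>0, \<dots>, X\<^bsub>n-1\<^esub>]\<close> is the evaluation at the images of the variables. This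
  identifies the values taken in \<open>k(\<alpha>)\<close>, in residue rings and in their real closures.\<close>
lemma ring_hom_mpoly_eval:
  assumes M: "subring_set M" and \<psi>: "\<psi> \<in> ring_hom (ring_of (mpolys M n)) R" and p: "p \<in> mpolys M n"
    and h: "\<And>c. c \<in> M \<Longrightarrow> h c = \<psi> (Const c)" and x: "\<And>i. i < n \<Longrightarrow> x i = \<psi> (Var i)"
  shows "mpoly_eval R n h p x = \<psi> p"
proof -
  have f: "\<psi> p \<in> carrier R" "\<psi> (p + q) = \<psi> p \<oplus> \<psi> q" "\<psi> (p * q) = \<psi> p \<otimes> \<psi> q" "\<psi> 1 = \<one>"
    if "p \<in> mpolys M n" "q \<in> mpolys M n" for p q
    using \<psi> that by (auto simp: ring_hom_def)
  note c = Const_in_mpolys[where M = M and n = n]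
  have fc: "\<psi> p \<in> carrier R" if "p \<in> mpolys M n" for p using f(1)[OF that that] .
  have hh: "h \<in> ring_hom (ring_of M) R"
  proof (rule ring_hom_memI)
    show "h \<one>\<^bsub>ring_of M\<^esub> = \<one>"
      using h[OF subring_setD(2)[OF M]] f(4)[OF zero_in_mpolys zero_in_mpolys] by (simp add: Const_def)
  qed (auto simp: h subring_setD[OF M] f fc c hom_onD[OF subring_set_UNIV hom_on_Const])
  have xx: "x \<in> {..<n} \<rightarrow> carrier R" using x fc Var_in_mpolys[OF M] by auto
  note e = mpoly_eval_Const[OF M] mpoly_eval_Var[OF M] mpoly_eval_add[OF M] mpoly_eval_mult[OF M]
  show ?thesis
    using M p by (induction p rule: mpolys_induct)
      (simp_all add: e hh xx h x f)
qed

end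

section \<open>Transfer of sign conditions in several variables\<close>

abbreviation mpoly_value :: "nat \<Rightarrow> ('r::comm_ring_1 \<Rightarrow> 'a::comm_ring_1) \<Rightarrow> (nat \<Rightarrow> 'a) \<Rightarrow> 'r mpoly \<Rightarrow> 'a" where
  "mpoly_value n h x p \<equiv> mpoly_eval (ring_of UNIV) n h p x"

lemma ring_of_UNIV_ops:
  fixes f :: "'i \<Rightarrow> 'a::comm_ring_1"
  shows "finsum (ring_of UNIV) f I = sum f I" "finprod (ring_of UNIV) f I = prod f I" "(y::'a) [^]\<^bsub>ring_of UNIV\<^esub> (k::nat) = y ^ k"
proof -
  interpret U: cring "ring_of (UNIV :: 'a set)" by (rule cring_ring_of[OF subring_set_UNIV])
  show "finsum (ring_of UNIV) f I = sum f I"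
    by (induction I rule: infinite_finite_induct) (simp_all add: U.finsum_insert U.finsum_infinite)
  show "finprod (ring_of UNIV) f I = prod f I"
    by (induction I rule: infinite_finite_induct) (simp_all add: U.finprod_insert U.finprod_infinite)
  show "y [^]\<^bsub>ring_of UNIV\<^esub> k = y ^ k"
    by (induction k) (simp_all add: mult.commute)
qed

lemma mpoly_value_altdef:
  "mpoly_value n h x p =
     (\<Sum>m\<in>Poly_Mapping.keys p. h (Poly_Mapping.lookup p m) * (\<Prod>i<n. x i ^ Poly_Mapping.lookup m i))"
  unfolding mpoly_eval_def ring_of_UNIV_ops by simp

lemma mpoly_value_hom_on:
  assumes M: "subring_set M" and h: "hom_on M h"
  shows "hom_on (mpolys M n) (mpoly_value n h x)"
proof -
  interpret U: cring "ring_of (UNIV :: 'b set)" by (rule cring_ring_of[OF subring_set_UNIV])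
  show ?thesis
    using U.mpoly_eval_ring_hom[OF M, of h x n] h unfolding hom_on_iff_ring_hom by auto
qed

text \<open>\<open>p \<in> M[X\<^sub>0, \<dots>, X\<^sub>n]\<close> as a polynomial in \<open>X\<^sub>n\<close> whose coefficients lie in \<open>M[X\<^sub>0, \<dots>, X\<^bsub>n-1\<^esub>]\<close>: the entry
  \<open>n\<close> of every monomial is moved from the monomial to the outer degree.\<close>
definition univariate :: "nat \<Rightarrow> 'r::comm_ring_1 mpoly \<Rightarrow> 'r mpoly poly" where
  "univariate n p = (\<Sum>m\<in>Poly_Mapping.keys p.
     monom (Poly_Mapping.single (Poly_Mapping.update n 0 m) (Poly_Mapping.lookup p m)) (Poly_Mapping.lookup m n))"

lemma univariate_term:
  assumes "p \<in> mpolys M (Suc n)" "m \<in> Poly_Mapping.keys p"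
  shows "Poly_Mapping.lookup p m \<in> M" "Poly_Mapping.keys (Poly_Mapping.update n 0 m) \<subseteq> {..<n}"
    "Poly_Mapping.single (Poly_Mapping.update n 0 m) (Poly_Mapping.lookup p m) \<in> mpolys M n"
proof -
  show 1: "Poly_Mapping.lookup p m \<in> M" using assms by (auto simp: mpolys_def)
  have "Poly_Mapping.keys m \<subseteq> {..<Suc n}" using assms by (auto simp: mpolys_def)
  then show 2: "Poly_Mapping.keys (Poly_Mapping.update n 0 m) \<subseteq> {..<n}"
    by (auto simp: keys_update less_Suc_eq)
  show "Poly_Mapping.single (Poly_Mapping.update n 0 m) (Poly_Mapping.lookup p m) \<in> mpolys M n"
    by (rule mpolys_single[OF 1 2])
qed

lemma univariate_over:
  assumes M: "subring_set M" and p: "p \<in> mpolys M (Suc n)"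
  shows "univariate n p \<in> polys_over (mpolys M n)"
  using univariate_term(3)[OF p] zero_in_mpolys
  unfolding polys_over_def univariate_def by (auto simp: coeff_sum intro!: subring_set_sum[OF mpolys_subring[OF M]])

lemma map_poly_hom_sum:
  assumes A: "subring_set A" and e: "hom_on A e" and f: "\<And>i. i \<in> I \<Longrightarrow> f i \<in> polys_over A"
  shows "map_poly e (sum f I) = (\<Sum>i\<in>I. map_poly e (f i))"
  using f by (intro poly_eqI)
    (simp add: coeff_map_poly coeff_sum hom_onD[OF A e] hom_on_sum[OF A e] polys_over_def)

lemma poly_univariate:
  assumes M: "subring_set M" and h: "hom_on M h" and p: "p \<in> mpolys M (Suc n)"
  shows "poly (map_poly (mpoly_value n h x) (univariate n p)) t = mpoly_value (Suc n) h (x(n := t)) p"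
proof -
  let ?e = "mpoly_value n h x"
  note A = mpolys_subring[OF M, of n] and e = mpoly_value_hom_on[OF M h, of n x]
  let ?s = "\<lambda>m. Poly_Mapping.single (Poly_Mapping.update n 0 m) (Poly_Mapping.lookup p m)"
  have "poly (map_poly ?e (univariate n p)) t = (\<Sum>m\<in>Poly_Mapping.keys p. ?e (?s m) * t ^ Poly_Mapping.lookup m n)"
  proof -
    have "map_poly ?e (univariate n p) = (\<Sum>m\<in>Poly_Mapping.keys p. map_poly ?e (monom (?s m) (Poly_Mapping.lookup m n)))"
      unfolding univariate_def using univariate_term(3)[OF p] zero_in_mpolys
      by (intro map_poly_hom_sum[OF A e]) (auto simp: polys_over_def)
    also have "\<dots> = (\<Sum>m\<in>Poly_Mapping.keys p. monom (?e (?s m)) (Poly_Mapping.lookup m n))"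
      by (intro sum.cong map_poly_monom hom_onD[OF A e]) auto
    finally show ?thesis by (simp add: poly_sum poly_monom)
  qed
  also have "\<dots> = mpoly_value (Suc n) h (x(n := t)) p"
    unfolding mpoly_value_altdef[of "Suc n"]
  proof (rule sum.cong)
    fix m assume m: "m \<in> Poly_Mapping.keys p"
    then have nz: "Poly_Mapping.lookup p m \<noteq> 0" by (simp add: in_keys_iff)
    have "?e (?s m) = h (Poly_Mapping.lookup p m) * (\<Prod>i<n. x i ^ Poly_Mapping.lookup (Poly_Mapping.update n 0 m) i)"
      unfolding mpoly_value_altdef using nz by simp
    also have "(\<Prod>i<n. x i ^ Poly_Mapping.lookup (Poly_Mapping.update n 0 m) i) = (\<Prod>i<n. (x(n := t)) i ^ Poly_Mapping.lookup m i)"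
      by (intro prod.cong) (auto simp: lookup_update)
    finally show "?e (?s m) * t ^ Poly_Mapping.lookup m n
       = h (Poly_Mapping.lookup p m) * (\<Prod>i<Suc n. (x(n := t)) i ^ Poly_Mapping.lookup m i)"
      by (simp add: mult.assoc)
  qed simp
  finally show ?thesis .
qed

text \<open>Signs at a point over one field can be realised at a point over the other. The last variable is
  eliminated by \<open>sign_determination\<close>, with coefficient ring \<open>M[X\<^sub>0, \<dots>, X\<^bsub>n-1\<^esub>]\<close> and the evaluations at the
  first \<open>n\<close> coordinates as specialisations; the induction hypothesis for the resulting set \<open>Q\<close> yields the
  first \<open>n\<close> coordinates of \<open>y\<close>, and a partner of \<open>x\<^sub>n\<close> under the matching yields the last one.\<close>
theorem sign_transfer:
  fixes h1 :: "'r::idom \<Rightarrow> 'a::linordered_field" and h2 :: "'r \<Rightarrow> 'b::linordered_field"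
  assumes ivpa: "has_ivp TYPE('a)" and ivpb: "has_ivp TYPE('b)" and M: "subring_set M"
    and h1: "hom_on M h1" and h2: "hom_on M h2" and sgM: "\<And>c. c \<in> M \<Longrightarrow> sg (h1 c) = sg (h2 c)"
    and "finite G" "G \<subseteq> mpolys M n"
  shows "\<exists>y. \<forall>g\<in>G. sg (mpoly_value n h1 x g) = sg (mpoly_value n h2 y g)"
  using assms(7,8)
proof (induction n arbitrary: G)
  case 0
  have "sg (mpoly_value 0 h1 x g) = sg (mpoly_value 0 h2 y g)" if "g \<in> G" for g y
  proof -
    have k: "Poly_Mapping.keys g \<subseteq> {0}" and l: "\<And>m. m \<in> Poly_Mapping.keys g \<Longrightarrow> Poly_Mapping.lookup g m \<in> M"
      using that 0(2) unfolding mpolys_def by force+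
    then consider "Poly_Mapping.keys g = {}" | "Poly_Mapping.keys g = {0}" by blast
    then show ?thesis
      by cases (use l sgM in \<open>simp_all add: mpoly_value_altdef\<close>)
  qed
  then show ?case by blast
next
  case (Suc n)
  note A = mpolys_subring[OF M, of n]
  have "finite (univariate n ` G)" "univariate n ` G \<subseteq> polys_over (mpolys M n)"
    using Suc.prems univariate_over[OF M] by auto
  from sign_determination[OF ivpa ivpb A this] obtain Q where Q: "finite Q" "Q \<subseteq> mpolys M n"
    and QE: "\<And>(e1::_ \<Rightarrow> 'a) (e2::_ \<Rightarrow> 'b). hom_on (mpolys M n) e1 \<Longrightarrow> hom_on (mpolys M n) e2 \<Longrightarrow>
      \<forall>q\<in>Q. sg (e1 q) = sg (e2 q) \<Longrightarrow>
      \<exists>E. cellmatch E \<and> (\<forall>p\<in>univariate n ` G. sg_agree E (map_poly e1 p, map_poly e2 p))"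
    by blast
  obtain y where y: "\<forall>q\<in>Q. sg (mpoly_value n h1 x q) = sg (mpoly_value n h2 y q)"
    using Suc.IH[OF Q] by blast
  obtain E where E: "cellmatch E"
    "\<And>g. g \<in> G \<Longrightarrow> sg_agree E (map_poly (mpoly_value n h1 x) (univariate n g), map_poly (mpoly_value n h2 y) (univariate n g))"
    using QE[OF mpoly_value_hom_on[OF M h1] mpoly_value_hom_on[OF M h2] y] by blast
  obtain t where t: "E (x n) t" using E(1) unfolding cellmatch_def by blast
  have "sg (mpoly_value (Suc n) h1 x g) = sg (mpoly_value (Suc n) h2 (y(n := t)) g)" if g: "g \<in> G" for g
  proof -
    have gM: "g \<in> mpolys M (Suc n)" using g Suc.prems by blast
    show ?thesis
      using E(2)[OF g] t poly_univariate[OF M h1 gM, of x "x n"] poly_univariate[OF M h2 gM, of y t]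
      unfolding sg_agree_def case_prod_conv fun_upd_triv by metis
  qed
  then show ?case by blast
qed

section \<open>Prime cones and the ordered residue ring as a type\<close>

lemma prime_coneD:
  assumes "prime_cone A \<alpha>"
  shows "p \<in> \<alpha> \<Longrightarrow> p \<in> A" "p \<in> \<alpha> \<Longrightarrow> q \<in> \<alpha> \<Longrightarrow> p + q \<in> \<alpha>" "p \<in> \<alpha> \<Longrightarrow> q \<in> \<alpha> \<Longrightarrow> p * q \<in> \<alpha>"
    "p \<in> A \<Longrightarrow> p * p \<in> \<alpha>" "- 1 \<notin> \<alpha>" "p \<in> A \<Longrightarrow> p \<in> \<alpha> \<or> - p \<in> \<alpha>"
    "p \<in> A \<Longrightarrow> q \<in> A \<Longrightarrow> p * q \<in> \<alpha> \<Longrightarrow> p \<in> \<alpha> \<or> - q \<in> \<alpha>"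
  using assms unfolding prime_cone_def by blast+

lemma supp_iff: "p \<in> supp \<alpha> \<longleftrightarrow> p \<in> \<alpha> \<and> - p \<in> \<alpha>"
  unfolding supp_def by (metis Int_iff image_iff minus_minus)

locale cone_on =
  fixes A :: "'a::comm_ring_1 set" and \<alpha>
  assumes ring: "subring_set A" and cone: "prime_cone A \<alpha>"
begin

lemmas AD = subring_setD[OF ring] and coneD = prime_coneD[OF cone]

lemma zero_in: "0 \<in> \<alpha>"
  using coneD(4)[OF AD(1)] by simp

lemma supp_in: "p \<in> supp \<alpha> \<Longrightarrow> p \<in> A"
  using coneD(1) by (auto simp: supp_iff)

lemma supp_zero: "0 \<in> supp \<alpha>" using zero_in by (simp add: supp_iff)

lemma supp_minus: "p \<in> supp \<alpha> \<Longrightarrow> - p \<in> supp \<alpha>" by (auto simp: supp_iff)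

lemma supp_add: "p \<in> supp \<alpha> \<Longrightarrow> q \<in> supp \<alpha> \<Longrightarrow> p + q \<in> supp \<alpha>"
  using coneD(2)[of p q] coneD(2)[of "- p" "- q"] by (simp add: supp_iff)

lemma supp_diff: "p \<in> supp \<alpha> \<Longrightarrow> q \<in> supp \<alpha> \<Longrightarrow> p - q \<in> supp \<alpha>"
  using supp_add[OF _ supp_minus, of p q] by simp

lemma supp_mult:
  assumes "a \<in> A" "p \<in> supp \<alpha>"
  shows "a * p \<in> supp \<alpha>"
proof (cases "a \<in> \<alpha>")
  case True
  then show ?thesis using assms(2) coneD(3)[of a p] coneD(3)[of a "- p"] by (simp add: supp_iff)
next
  case False
  then have "- a \<in> \<alpha>" using coneD(6) assms(1) by blast
  then show ?thesis using assms(2) coneD(3)[of "- a" p] coneD(3)[of "- a" "- p"] by (simp add: supp_iff)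
qed

lemma supp_prime:
  assumes pq: "p \<in> A" "q \<in> A" "p * q \<in> supp \<alpha>"
  shows "p \<in> supp \<alpha> \<or> q \<in> supp \<alpha>"
  using coneD(7)[OF pq(1,2)] coneD(7)[OF pq(1) AD(3)[OF pq(2)]] coneD(7)[OF AD(3)[OF pq(1)] pq(2)]
    coneD(7)[OF AD(3)[OF pq(1)] AD(3)[OF pq(2)]] pq(3)
  by (auto simp: supp_iff)

lemma one_notin_supp: "1 \<notin> supp \<alpha>"
  using coneD(5) by (simp add: supp_iff)

lemma cone_supp_shift:
  assumes "p \<in> \<alpha>" "q - p \<in> supp \<alpha>"
  shows "q \<in> \<alpha>"
  using coneD(2)[of p "q - p"] assms by (simp add: supp_iff)

lemma cone_cong:
  assumes "p - p' \<in> supp \<alpha>"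
  shows "p \<in> \<alpha> \<longleftrightarrow> p' \<in> \<alpha>"
  using cone_supp_shift[of p p'] cone_supp_shift[of p' p] assms supp_minus[OF assms] by auto

end

definition cone_sg :: "'a::comm_ring_1 set \<Rightarrow> 'a \<Rightarrow> int" where
  "cone_sg \<alpha> p = (if p \<in> supp \<alpha> then 0 else if p \<in> \<alpha> then 1 else - 1)"

lemma prime_cone_of_hom:
  fixes e :: "'a::comm_ring_1 \<Rightarrow> 'b::linordered_idom"
  assumes A: "subring_set A" and e: "hom_on A e"
  shows "prime_cone A {p \<in> A. 0 \<le> e p}"
proof -
  note AD = subring_setD[OF A] and h = hom_onD[OF A e]
  have "p \<in> {p \<in> A. 0 \<le> e p} \<or> - q \<in> {p \<in> A. 0 \<le> e p}"
    if "p \<in> A" "q \<in> A" "p * q \<in> {p \<in> A. 0 \<le> e p}" for p q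
  proof -
    have "0 \<le> e p * e q" "e (- q) = - e q" using that by (simp_all add: h)
    then show ?thesis using that AD(3)[OF that(2)] by (auto simp: zero_le_mult_iff)
  qed
  moreover have "- 1 \<notin> {p \<in> A. 0 \<le> e p}" using h(5)[OF AD(2)] h(1) by simp
  moreover have "p * p \<in> {p \<in> A. 0 \<le> e p}" if "p \<in> A" for p using that by (simp add: h AD)
  moreover have "p + q \<in> {p \<in> A. 0 \<le> e p} \<and> p * q \<in> {p \<in> A. 0 \<le> e p}"
    if "p \<in> {p \<in> A. 0 \<le> e p}" "q \<in> {p \<in> A. 0 \<le> e p}" for p q using that by (simp add: h AD)
  ultimately show ?thesis unfolding prime_cone_def by (intro conjI ballI impI) (blast | simp)+
qed

text \<open>The last clause says that \<open>\<beta>\<close> induces on \<open>M\<close> its given order.\<close>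
definition compatible_cone :: "'r::linordered_field set \<Rightarrow> nat \<Rightarrow> 'r mpoly set \<Rightarrow> bool" where
  "compatible_cone M n \<beta> \<longleftrightarrow> subring_set M \<and> prime_cone (mpolys M n) \<beta> \<and>
     (\<forall>c\<in>M. 0 < c \<longrightarrow> Const c \<in> \<beta> \<and> Const c \<notin> supp \<beta>)"

definition finitely_realized :: "'r::linordered_field set \<Rightarrow> nat \<Rightarrow> 'r mpoly set \<Rightarrow> bool" where
  "finitely_realized M n \<beta> \<longleftrightarrow> (\<forall>G. finite G \<longrightarrow> G \<subseteq> mpolys M n \<longrightarrow>
     (\<exists>y. \<forall>g\<in>G. sg (mpoly_value n id y g) = cone_sg \<beta> g))"

lemma compatible_cone_exists: "\<exists>M n \<beta>. compatible_cone (M :: 'r::linordered_field set) n \<beta>"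
proof -
  have id: "hom_on UNIV (id :: 'r \<Rightarrow> 'r)" by (simp add: hom_on_def)
  let ?e = "mpoly_value 0 id (\<lambda>_. 0) :: 'r mpoly \<Rightarrow> 'r"
  note A = mpolys_subring[OF subring_set_UNIV, of 0]
  note e = mpoly_value_hom_on[OF subring_set_UNIV id, of 0 "\<lambda>_. 0"]
  have c: "?e (Const c) = c" for c by (simp add: mpoly_value_altdef Const_def)
  have m: "Const (- c) = - Const c" for c :: 'r by (simp add: Const_def single_uminus)
  have Cin: "Const c \<in> mpolys UNIV 0" for c :: 'r by (rule Const_in_mpolys) simp
  let ?\<beta> = "{p \<in> mpolys UNIV 0. 0 \<le> ?e p}"
  have "Const c \<in> ?\<beta> \<and> Const c \<notin> supp ?\<beta>" if "0 < c" for c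
    using that Cin[of c] c[of c] c[of "- c"] by (simp add: supp_iff flip: m)
  then have "compatible_cone UNIV 0 ?\<beta>"
    unfolding compatible_cone_def using prime_cone_of_hom[OF A e] subring_set_UNIV by simp
  then show ?thesis by blast
qed

text \<open>The residue ring of a prime cone should be a type, so that its field of fractions and the real closure of
  that are types as well; but a type cannot depend on a variable cone. The choice operator resolves this: the cone
  \<open>critical\<close> is chosen to be not finitely realized if there is any such compatible cone at all. It depends on nothing
  but the type \<open>'r\<close>, and if it is finitely realized, then so are all compatible cones.\<close>
definition critical :: "'r::linordered_field set \<times> nat \<times> 'r mpoly set" where
  "critical = (SOME (M, n, \<beta>). compatible_cone M n \<beta> \<and>
     ((\<exists>M n \<beta>. compatible_cone (M :: 'r set) n \<beta> \<and> \<not> finitely_realized M n \<beta>) \<longrightarrow> \<not> finitely_realized M n \<beta>))"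

definition crit_ring :: "'r::linordered_field mpoly set" where
  "crit_ring = (case critical :: 'r set \<times> nat \<times> 'r mpoly set of (M, n, \<beta>) \<Rightarrow> mpolys M n)"

definition crit_cone :: "'r::linordered_field mpoly set" where
  "crit_cone = (case critical of (M, n, \<beta>) \<Rightarrow> \<beta>)"

lemma critical:
  "\<exists>(M :: 'r::linordered_field set) n. crit_ring = mpolys M n \<and> compatible_cone M n crit_cone \<and>
     (\<forall>(M' :: 'r set) n' \<beta>. compatible_cone M' n' \<beta> \<longrightarrow> finitely_realized M n crit_cone \<longrightarrow> finitely_realized M' n' \<beta>)"
proof -
  let ?ex = "\<exists>M n \<beta>. compatible_cone (M :: 'r set) n \<beta> \<and> \<not> finitely_realized M n \<beta>"
  let ?P = "\<lambda>(M, n, \<beta>). compatible_cone (M :: 'r set) n \<beta> \<and> (?ex \<longrightarrow> \<not> finitely_realized M n \<beta>)"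
  have "\<exists>t. ?P t"
  proof (cases ?ex)
    case True
    then obtain M n \<beta> where "compatible_cone (M :: 'r set) n \<beta>" "\<not> finitely_realized M n \<beta>" by blast
    then have "?P (M, n, \<beta>)" by simp
    then show ?thesis by (rule exI)
  next
    case False
    obtain M n \<beta> where "compatible_cone (M :: 'r set) n \<beta>" using compatible_cone_exists by blast
    with False have "?P (M, n, \<beta>)" by simp
    then show ?thesis by (rule exI)
  qed
  then have P: "?P critical" unfolding critical_def by (rule someI_ex)
  obtain M n \<beta> where c: "critical = (M :: 'r set, n, \<beta>)" by (metis prod_cases3)
  have "crit_ring = mpolys M n" "crit_cone = \<beta>" unfolding crit_ring_def crit_cone_def c prod.case by (rule refl)+
  moreover have "compatible_cone M n \<beta>" using P unfolding c prod.case by (rule conjunct1)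
  moreover have "?ex \<longrightarrow> \<not> finitely_realized M n \<beta>" using P unfolding c prod.case by (rule conjunct2)
  ultimately show ?thesis by (intro exI[of _ M] exI[of _ n]) auto
qed

interpretation crit: cone_on "crit_ring :: 'r::linordered_field mpoly set" crit_cone
proof
  obtain M :: "'r set" and n where c: "crit_ring = mpolys M n" "compatible_cone M n crit_cone"
    using critical[where 'r = 'r] by blast
  have "subring_set M" "prime_cone (mpolys M n) crit_cone" using c(2) by (simp_all add: compatible_cone_def)
  then show "subring_set (crit_ring :: 'r mpoly set)" "prime_cone (crit_ring :: 'r mpoly set) crit_cone"
    unfolding c(1) by (simp_all add: mpolys_subring)
qed

lemma product_difference: "p * q - p' * q' = q * (p - p') + p' * (q - (q' :: 'a::comm_ring_1))"
  by (simp add: algebra_simps)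

definition crit_rel :: "'r::linordered_field mpoly \<Rightarrow> 'r mpoly \<Rightarrow> bool" where
  "crit_rel p q \<longleftrightarrow> p \<in> crit_ring \<and> q \<in> crit_ring \<and> p - q \<in> supp crit_cone"

text \<open>The residue ring of the critical cone; the relation is partial because the cone lives on a subring
  of the type of all polynomials.\<close>
quotient_type (overloaded) 'r residue = "'r::linordered_field mpoly" / partial: crit_rel
  morphisms rep_residue residue_of
proof (rule part_equivpI)
  show "\<exists>p :: 'r mpoly. crit_rel p p" using crit.AD(1) crit.supp_zero by (auto simp: crit_rel_def)
  show "symp (crit_rel :: 'r mpoly \<Rightarrow> _)"
    unfolding symp_def crit_rel_def using crit.supp_minus by (metis minus_diff_eq)
  show "transp (crit_rel :: 'r mpoly \<Rightarrow> _)"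
  proof (rule transpI)
    fix p q r :: "'r mpoly" assume "crit_rel p q" "crit_rel q r"
    moreover from this have "(p - q) + (q - r) \<in> supp crit_cone"
      by (intro crit.supp_add) (simp_all add: crit_rel_def)
    ultimately show "crit_rel p r" by (simp add: crit_rel_def)
  qed
qed

instantiation residue :: (linordered_field) linordered_idom
begin

lift_definition zero_residue :: "'a residue" is 0
  by (simp add: crit_rel_def crit.AD crit.supp_zero)
lift_definition one_residue :: "'a residue" is 1
  by (simp add: crit_rel_def crit.AD crit.supp_zero)
lift_definition plus_residue :: "'a residue \<Rightarrow> 'a residue \<Rightarrow> 'a residue" is "(+)"
proof -
  fix p p' q q' :: "'a mpoly"
  assume "crit_rel p p'" "crit_rel q q'"
  then show "crit_rel (p + q) (p' + q')"
    using crit.supp_add[of "p - p'" "q - q'"] unfolding crit_rel_def by (simp add: crit.AD(4) add_diff_add)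
qed
lift_definition minus_residue :: "'a residue \<Rightarrow> 'a residue \<Rightarrow> 'a residue" is "(-)"
proof -
  fix p p' q q' :: "'a mpoly"
  assume "crit_rel p p'" "crit_rel q q'"
  moreover have "p - q - (p' - q') = (p - p') - (q - q')" by simp
  ultimately show "crit_rel (p - q) (p' - q')"
    using crit.supp_diff[of "p - p'" "q - q'"] unfolding crit_rel_def by (simp only: crit.AD(6))
qed
lift_definition uminus_residue :: "'a residue \<Rightarrow> 'a residue" is uminus
proof -
  fix p p' :: "'a mpoly"
  assume p: "crit_rel p p'"
  have "- p - - p' = - (p - p')" by simp
  then show "crit_rel (- p) (- p')"
    using p crit.supp_minus crit.AD(3) unfolding crit_rel_def by metis
qed
lift_definition times_residue :: "'a residue \<Rightarrow> 'a residue \<Rightarrow> 'a residue" is "(*)"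
proof -
  fix p p' q q' :: "'a mpoly"
  assume "crit_rel p p'" "crit_rel q q'"
  then show "crit_rel (p * q) (p' * q')"
    unfolding crit_rel_def product_difference[of p q p' q']
    by (elim conjE, intro conjI crit.AD crit.supp_add crit.supp_mult)
qed
lift_definition less_eq_residue :: "'a residue \<Rightarrow> 'a residue \<Rightarrow> bool" is "\<lambda>p q. q - p \<in> crit_cone"
proof -
  fix p p' q q' :: "'a mpoly"
  assume "crit_rel p p'" "crit_rel q q'"
  then have "(q - q') - (p - p') \<in> supp crit_cone" unfolding crit_rel_def by (blast intro: crit.supp_diff)
  moreover have "(q - p) - (q' - p') = (q - q') - (p - p')" by simp
  ultimately show "(q - p \<in> crit_cone) = (q' - p' \<in> crit_cone)"
    using crit.cone_cong[of "q - p" "q' - p'"] by (simp only:)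
qed

definition less_residue :: "'a residue \<Rightarrow> 'a residue \<Rightarrow> bool" where
  "less_residue x y \<longleftrightarrow> x \<le> y \<and> x \<noteq> y"
definition abs_residue :: "'a residue \<Rightarrow> 'a residue" where
  "abs_residue x = (if x < 0 then - x else x)"
definition sgn_residue :: "'a residue \<Rightarrow> 'a residue" where
  "sgn_residue x = (if x = 0 then 0 else if 0 < x then 1 else - 1)"

lemma crit_rel_eqI: "p \<in> crit_ring \<Longrightarrow> p = q \<Longrightarrow> crit_rel p q"
  using crit.supp_zero by (auto simp: crit_rel_def)

instance
proof
  fix x y z :: "'a residue"
  note AD = crit.AD
  have R: "p \<in> crit_ring \<and> q \<in> crit_ring \<and> p - q \<in> supp crit_cone" if "crit_rel p q" for p q :: "'a mpoly"
    using that by (simp add: crit_rel_def)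
  show "x + y + z = x + (y + z)" by transfer (auto intro!: crit_rel_eqI AD dest!: R simp: algebra_simps)
  show "x + y = y + x" by transfer (auto intro!: crit_rel_eqI AD dest!: R simp: algebra_simps)
  show "0 + x = x" by transfer (auto intro!: crit_rel_eqI AD dest!: R simp: algebra_simps)
  show "- x + x = 0" by transfer (auto intro!: crit_rel_eqI AD dest!: R simp: algebra_simps)
  show "x - y = x + - y" by transfer (auto intro!: crit_rel_eqI AD dest!: R simp: algebra_simps)
  show "x + y - x = y" by transfer (auto intro!: crit_rel_eqI AD dest!: R simp: algebra_simps)
  show "x - y - z = x - (y + z)" by transfer (auto intro!: crit_rel_eqI AD dest!: R simp: algebra_simps)
  show "0 * x = 0" "x * 0 = 0" by (transfer; auto intro!: crit_rel_eqI AD dest!: R simp: algebra_simps)+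
  show "x * y * z = x * (y * z)" by transfer (auto intro!: crit_rel_eqI AD dest!: R simp: algebra_simps)
  show "x * y = y * x" by transfer (auto intro!: crit_rel_eqI AD dest!: R simp: algebra_simps)
  show "1 * x = x" by transfer (auto intro!: crit_rel_eqI AD dest!: R simp: algebra_simps)
  show "(x + y) * z = x * z + y * z" by transfer (auto intro!: crit_rel_eqI AD dest!: R simp: algebra_simps)
  have zero_eq: "crit_rel p 0 \<longleftrightarrow> p \<in> crit_ring \<and> p \<in> supp crit_cone" for p :: "'a mpoly"
    using AD(1) by (auto simp: crit_rel_def)
  show "(0::'a residue) \<noteq> 1"
    by transfer (use crit.one_notin_supp crit.supp_minus[of "- 1"] in \<open>auto simp: crit_rel_def\<close>)
  have no_zero_div: "x = 0 \<or> y = 0" if "x * y = 0" for x y :: "'a residue"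
    using that by transfer (use crit.supp_prime in \<open>auto simp: zero_eq dest!: R\<close>)
  have refl: "x \<le> x" for x :: "'a residue" by transfer (simp add: crit.zero_in)
  show "x \<le> x" by (rule refl)
  show antisym: "x = y" if "x \<le> y" "y \<le> x" for x y :: "'a residue"
    using that by transfer (auto simp: crit_rel_def supp_iff)
  show "x \<le> z" if "x \<le> y" "y \<le> z"
    using that
  proof transfer
    fix p q r :: "'a mpoly" assume "q - p \<in> crit_cone" "r - q \<in> crit_cone"
    then have "(q - p) + (r - q) \<in> crit_cone" by (rule crit.coneD(2))
    then show "r - p \<in> crit_cone" by (simp add: algebra_simps)
  qed
  show "x < y \<longleftrightarrow> x \<le> y \<and> \<not> y \<le> x"
    unfolding less_residue_def using antisym refl by blast
  show "x \<le> y \<or> y \<le> x"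
  proof transfer
    fix p q :: "'a mpoly" assume "crit_rel p p" "crit_rel q q"
    then have "q - p \<in> crit_ring" by (auto dest!: R intro: AD)
    from crit.coneD(6)[OF this] show "q - p \<in> crit_cone \<or> p - q \<in> crit_cone" by simp
  qed
  show "z + x \<le> z + y" if "x \<le> y" using that by transfer simp
  show "z * x < z * y" if "x < y" "0 < z"
  proof -
    have "x \<le> y" "0 \<le> z" using that by (auto simp: less_residue_def)
    then have "z * x \<le> z * y"
    proof transfer
      fix p q r :: "'a mpoly" assume "q - p \<in> crit_cone" "r - 0 \<in> crit_cone"
      then have "r * (q - p) \<in> crit_cone" using crit.coneD(3)[of r "q - p"] by simp
      then show "r * q - r * p \<in> crit_cone" by (simp add: algebra_simps)
    qed
    moreover have "z * x \<noteq> z * y"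
    proof
      assume "z * x = z * y"
      moreover have "z * y - z * x = z * (y - x)"
        by transfer (auto intro!: crit_rel_eqI AD dest!: R simp: algebra_simps)
      moreover have "z * y - z * y = 0" by transfer (auto intro!: crit_rel_eqI AD dest!: R)
      ultimately have "z = 0 \<or> y - x = 0" using no_zero_div by metis
      moreover have "y - x = 0 \<Longrightarrow> y = x" by transfer (auto simp: crit_rel_def)
      ultimately show False using that by (auto simp: less_residue_def)
    qed
    ultimately show ?thesis by (simp add: less_residue_def)
  qed
  show "\<bar>x\<bar> = (if x < 0 then - x else x)" by (rule abs_residue_def)
  show "sgn x = (if x = 0 then 0 else if 0 < x then 1 else - 1)" by (rule sgn_residue_def)
qed

end

lemma crit_rel_refl: "p \<in> crit_ring \<Longrightarrow> crit_rel p p"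
  by (simp add: crit_rel_def crit.supp_zero)

lemma hom_on_residue_of: "hom_on crit_ring residue_of"
  unfolding hom_on_def
  by (auto simp: plus_residue.abs_eq times_residue.abs_eq one_residue_def crit_rel_refl)

lemma sg_residue_of:
  assumes p: "p \<in> crit_ring"
  shows "sg (residue_of p) = cone_sg crit_cone p"
proof -
  have nonneg: "0 \<le> residue_of q \<longleftrightarrow> q \<in> crit_cone" if "q \<in> crit_ring" for q
    unfolding zero_residue_def using that
    by (simp add: less_eq_residue.abs_eq crit_rel_refl crit.AD)
  have "residue_of p \<le> 0 \<longleftrightarrow> - p \<in> crit_cone"
    unfolding zero_residue_def using p
    by (simp add: less_eq_residue.abs_eq crit_rel_refl crit.AD)
  then show ?thesis using nonneg[OF p] crit.coneD(6)[OF p]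
    unfolding sg_def cone_sg_def supp_iff by auto
qed

lemma hom_on_Fract: "hom_on UNIV (\<lambda>x :: 'a::idom. Fract x 1)"
  by (simp add: hom_on_def One_fract_def)

lemma sg_Fract: "sg (Fract x 1) = sg (x :: 'a::linordered_idom)"
  by (auto simp: sg_def Fract_less_zero_iff Zero_fract_def eq_fract)

lemma hom_on_comp: "hom_on A f \<Longrightarrow> hom_on UNIV g \<Longrightarrow> hom_on A (\<lambda>x. g (f x))"
  by (simp add: hom_on_def)

text \<open>The residue map into the real closure of the fractions of the residue ring is the evaluation at a point
  \<open>x\<close> over a real closed field, and the signs of its values are those given by the cone. Transfer moves the
  point to the field \<open>'r\<close>.\<close>
lemma critical_realized:
  fixes M :: "'r::linordered_field set"
  assumes ivp: "has_ivp TYPE('r)" and M: "crit_ring = mpolys M n" and comp: "compatible_cone M n crit_cone"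
  shows "finitely_realized M n crit_cone"
  unfolding finitely_realized_def
proof (intro allI impI)
  fix G :: "'r mpoly set" assume G: "finite G" "G \<subseteq> mpolys M n"
  define \<psi> :: "'r mpoly \<Rightarrow> 'r residue fract real_closure" where "\<psi> p = to_real_closure (Fract (residue_of p) 1)" for p
  have \<psi>: "hom_on (mpolys M n) \<psi>"
    unfolding \<psi>_def M[symmetric]
    by (intro hom_on_comp[OF _ hom_on_to_real_closure] hom_on_comp[OF _ hom_on_Fract] hom_on_residue_of)
  have sg\<psi>: "sg (\<psi> p) = cone_sg crit_cone p" if "p \<in> mpolys M n" for p
    using that unfolding \<psi>_def sg_to_real_closure sg_Fract M[symmetric] by (rule sg_residue_of)
  have subM: "subring_set M" using comp by (simp add: compatible_cone_def)
  define h where "h c = \<psi> (Const c)" for c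
  have Cin: "Const c \<in> mpolys M n" if "c \<in> M" for c using that by (rule Const_in_mpolys)
  have h: "hom_on M h"
    unfolding hom_on_def h_def hom_onD(1)[OF subring_set_UNIV hom_on_Const]
  proof (intro conjI ballI)
    fix c d assume "c \<in> M" "d \<in> M"
    then show "\<psi> (Const (c + d)) = \<psi> (Const c) + \<psi> (Const d)" "\<psi> (Const (c * d)) = \<psi> (Const c) * \<psi> (Const d)"
      using \<psi> Cin unfolding hom_on_def
      by (simp_all add: hom_onD(3,4)[OF subring_set_UNIV hom_on_Const])
  qed (use \<psi> in \<open>simp add: hom_on_def\<close>)
  have id: "hom_on M (id :: 'r \<Rightarrow> 'r)" by (simp add: hom_on_def)
  have pos: "h c > 0" if "c \<in> M" "c > 0" for c
  proof -
    have "cone_sg crit_cone (Const c) = 1" using comp that unfolding compatible_cone_def cone_sg_def by auto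
    then show ?thesis using sg\<psi>[OF Cin[OF that(1)]] by (simp add: h_def)
  qed
  have sgh: "sg (h c) = sg (id c)" if c: "c \<in> M" for c
  proof (cases c "0 :: 'r" rule: linorder_cases)
    case less
    then have "h (- c) > 0" using pos[of "- c"] subring_setD(3)[OF subM c] by simp
    then show ?thesis using less hom_onD(5)[OF subM h c] by (simp add: sg_def)
  next
    case equal
    then show ?thesis using hom_onD(2)[OF subM h] by simp
  next
    case greater
    then show ?thesis using pos[OF c] by (simp add: sg_def)
  qed
  define x where "x i = \<psi> (Var i)" for i
  have val: "mpoly_value n h x p = \<psi> p" if "p \<in> mpolys M n" for p
  proof -
    interpret U: cring "ring_of (UNIV :: 'r residue fract real_closure set)" by (rule cring_ring_of[OF subring_set_UNIV])
    show ?thesis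
      by (rule U.ring_hom_mpoly_eval[OF subM _ that]) (use \<psi> in \<open>auto simp: hom_on_iff_ring_hom h_def x_def\<close>)
  qed
  obtain y where "\<forall>g\<in>G. sg (mpoly_value n h x g) = sg (mpoly_value n id y g)"
    using sign_transfer[OF real_closure_ivp ivp subM h id sgh G] by blast
  then have "\<forall>g\<in>G. sg (mpoly_value n id y g) = cone_sg crit_cone g"
    using val sg\<psi> G(2) by (metis subsetD)
  then show "\<exists>y. \<forall>g\<in>G. sg (mpoly_value n id y g) = cone_sg crit_cone g" by blast
qed

section \<open>Extending a prime cone to real coefficients\<close>

theorem compatible_cone_realized:
  fixes M :: "'r::linordered_field set"
  assumes "has_ivp TYPE('r)" "compatible_cone M n \<beta>"
  shows "finitely_realized M n \<beta>"
proof -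
  obtain C :: "'r set" and d where C: "crit_ring = mpolys C d" "compatible_cone C d crit_cone"
    and worst: "\<forall>(M' :: 'r set) n' \<beta>. compatible_cone M' n' \<beta> \<longrightarrow> finitely_realized C d crit_cone \<longrightarrow> finitely_realized M' n' \<beta>"
    using critical by metis
  show ?thesis
    using worst[rule_format, OF assms(2) critical_realized[OF assms(1) C]] .
qed

text \<open>By Zorn's lemma there is a maximal family with the finite intersection property. Maximality forces it to
  contain the intersection of any two members and every set that meets all finite intersections of members.\<close>
lemma ultrafilter_exists:
  fixes B :: "'x set set"
  assumes fip: "\<And>F. finite F \<Longrightarrow> F \<subseteq> B \<Longrightarrow> \<Inter>F \<noteq> {}"
  shows "\<exists>U. B \<subseteq> U \<and> {} \<notin> U \<and> (\<forall>S\<in>U. \<forall>T\<in>U. S \<inter> T \<in> U) \<and> (\<forall>S. S \<in> U \<or> - S \<in> U)"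
proof -
  define \<F> where "\<F> = {U. B \<subseteq> U \<and> (\<forall>F. finite F \<longrightarrow> F \<subseteq> U \<longrightarrow> \<Inter>F \<noteq> {})}"
  have "\<exists>U\<in>\<F>. \<forall>V\<in>\<F>. U \<subseteq> V \<longrightarrow> V = U"
  proof (rule subset_Zorn_nonempty)
    show "\<F> \<noteq> {}" using fip unfolding \<F>_def by blast
    fix \<C> assume ne: "\<C> \<noteq> {}" and chain: "subset.chain \<F> \<C>"
    have good: "B \<subseteq> U" "\<And>F. finite F \<Longrightarrow> F \<subseteq> U \<Longrightarrow> \<Inter>F \<noteq> {}" if "U \<in> \<C>" for U
      using chain that unfolding \<F>_def subset.chain_def by auto
    have "\<Inter>F \<noteq> {}" if F: "finite F" "F \<subseteq> \<Union>\<C>" for F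
    proof -
      obtain U where "U \<in> \<C>" "F \<subseteq> U" using finite_subset_Union_chain[OF F ne chain] by blast
      then show ?thesis using good(2) F(1) by blast
    qed
    moreover have "B \<subseteq> \<Union>\<C>" using ne good(1) by blast
    ultimately show "\<Union>\<C> \<in> \<F>" unfolding \<F>_def by blast
  qed
  then obtain U where U: "U \<in> \<F>" and max: "\<And>V. V \<in> \<F> \<Longrightarrow> U \<subseteq> V \<Longrightarrow> V = U" by blast
  have Ufip: "\<Inter>F \<noteq> {}" if "finite F" "F \<subseteq> U" for F
    using U that unfolding \<F>_def by blast
  have BU: "B \<subseteq> U" using U unfolding \<F>_def by blast
  have addable: "S \<in> U" if S: "\<And>F. finite F \<Longrightarrow> F \<subseteq> U \<Longrightarrow> \<Inter>F \<inter> S \<noteq> {}" for S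
  proof -
    have "\<Inter>F \<noteq> {}" if F: "finite F" "F \<subseteq> insert S U" for F
    proof -
      have "\<Inter>(F - {S}) \<inter> S \<noteq> {}" using S[of "F - {S}"] F by blast
      then show ?thesis by blast
    qed
    then have "insert S U \<in> \<F>" using BU unfolding \<F>_def by blast
    then show ?thesis using max[of "insert S U"] by blast
  qed
  have "S \<inter> T \<in> U" if ST: "S \<in> U" "T \<in> U" for S T
  proof (rule addable)
    fix F assume "finite F" "F \<subseteq> U"
    then have "\<Inter>(insert S (insert T F)) \<noteq> {}" using ST by (intro Ufip) auto
    then show "\<Inter>F \<inter> (S \<inter> T) \<noteq> {}" by auto
  qed
  moreover have "S \<in> U \<or> - S \<in> U" for S
  proof (rule ccontr)
    assume no: "\<not> (S \<in> U \<or> - S \<in> U)"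
    obtain F where F: "finite F" "F \<subseteq> U" "\<Inter>F \<inter> S = {}" using addable[of S] no by blast
    obtain F' where F': "finite F'" "F' \<subseteq> U" "\<Inter>F' \<inter> - S = {}" using addable[of "- S"] no by blast
    have "\<Inter>(F \<union> F') \<noteq> {}" using F F' by (intro Ufip) auto
    then show False using F(3) F'(3) by auto
  qed
  moreover have "{} \<notin> U" using Ufip[of "{{}}"] by auto
  ultimately show ?thesis using BU by blast
qed

text \<open>By compatibility and \<open>compatible_cone_realized\<close> the sets \<open>S g\<close> of points where \<open>g\<close> has the sign given by
  \<open>\<beta>\<close> have the finite intersection property. For an ultrafilter \<open>U\<close> that contains them, the polynomials
  that are non-negative on a set in \<open>U\<close> form a prime cone, and on \<open>mpolys M n\<close> it agrees with \<open>\<beta>\<close>.\<close>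
theorem cone_extends:
  fixes M :: "'r::linordered_field set"
  assumes ivp: "has_ivp TYPE('r)" and comp: "compatible_cone M n \<beta>"
  shows "\<exists>\<alpha>\<in>Spec_r (mpolys UNIV n). \<alpha> \<inter> mpolys M n = \<beta>"
proof -
  define S where "S g = {y. sg (mpoly_value n id y g) = cone_sg \<beta> g}" for g :: "'r mpoly"
  have "\<Inter>F \<noteq> {}" if F: "finite F" "F \<subseteq> S ` mpolys M n" for F
  proof -
    obtain G where G: "finite G" "G \<subseteq> mpolys M n" "F = S ` G" using finite_subset_image[OF F] by blast
    obtain y where "\<forall>g\<in>G. sg (mpoly_value n id y g) = cone_sg \<beta> g"
      using compatible_cone_realized[OF ivp comp] G(1,2) unfolding finitely_realized_def by metis
    then have "y \<in> \<Inter>F" unfolding G(3) S_def by simp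
    then show ?thesis by (metis empty_iff)
  qed
  from ultrafilter_exists[OF this]
  obtain U where U': "S ` mpolys M n \<subseteq> U \<and> {} \<notin> U \<and> (\<forall>S\<in>U. \<forall>T\<in>U. S \<inter> T \<in> U) \<and> (\<forall>S. S \<in> U \<or> - S \<in> U)" ..
  then have U: "S ` mpolys M n \<subseteq> U" "{} \<notin> U" "\<And>S T. S \<in> U \<Longrightarrow> T \<in> U \<Longrightarrow> S \<inter> T \<in> U" "\<And>S. S \<in> U \<or> - S \<in> U"
    by simp_all
  have up: "T \<in> U" if "S \<in> U" "S \<subseteq> T" for S T
  proof (rule ccontr)
    assume "T \<notin> U"
    then have "S \<inter> - T \<in> U" using U(3,4) that(1) by blast
    moreover have "S \<inter> - T = {}" using that(2) by blast
    ultimately show False using U(2) by simp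
  qed
  have id: "hom_on UNIV (id :: 'r \<Rightarrow> 'r)" by (simp add: hom_on_def)
  note A = mpolys_subring[OF subring_set_UNIV, of n, where 'a = 'r]
  note AD = subring_setD[OF A] and v = hom_onD[OF A mpoly_value_hom_on[OF subring_set_UNIV id]]
  define nn where "nn g = {y. 0 \<le> mpoly_value n id y g}" for g :: "'r mpoly"
  define \<alpha> where "\<alpha> = {g \<in> mpolys UNIV n. nn g \<in> U}"
  have "prime_cone (mpolys UNIV n) \<alpha>"
    unfolding prime_cone_def
  proof (intro conjI ballI impI)
    show "\<alpha> \<subseteq> mpolys UNIV n" by (auto simp: \<alpha>_def)
    show "p + q \<in> \<alpha>" "p * q \<in> \<alpha>" if "p \<in> \<alpha>" "q \<in> \<alpha>" for p q
    proof -
      have pq: "p \<in> mpolys UNIV n" "q \<in> mpolys UNIV n" "nn p \<inter> nn q \<in> U" using that U(3) by (auto simp: \<alpha>_def)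
      have "nn p \<inter> nn q \<subseteq> nn (p + q)" "nn p \<inter> nn q \<subseteq> nn (p * q)" using pq by (auto simp: nn_def v)
      then have "nn (p + q) \<in> U" "nn (p * q) \<in> U" using up[OF pq(3)] by blast+
      then show "p + q \<in> \<alpha>" "p * q \<in> \<alpha>" using pq AD by (auto simp: \<alpha>_def)
    qed
    have "UNIV \<in> U" using U(2) U(4)[of UNIV] by simp
    then show "p * p \<in> \<alpha>" if "p \<in> mpolys UNIV n" for p
      using that AD(5)[of p p] by (simp add: \<alpha>_def nn_def v)
    show "- 1 \<notin> \<alpha>" using U(2) AD(2) by (simp add: \<alpha>_def nn_def v)
    show "p \<in> \<alpha> \<or> - q \<in> \<alpha>" if pq: "p \<in> mpolys UNIV n" "q \<in> mpolys UNIV n" "p * q \<in> \<alpha>" for p q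
    proof (rule ccontr)
      assume "\<not> (p \<in> \<alpha> \<or> - q \<in> \<alpha>)"
      then have "- nn p \<in> U" "- nn (- q) \<in> U" using pq AD(3) U(4) by (auto simp: \<alpha>_def)
      then have "(- nn p \<inter> - nn (- q)) \<inter> nn (p * q) \<in> U" using pq(3) by (intro U(3)) (auto simp: \<alpha>_def)
      moreover have "(- nn p \<inter> - nn (- q)) \<inter> nn (p * q) = {}"
        using pq by (auto simp: nn_def v zero_le_mult_iff)
      ultimately show False using U(2) by simp
    qed
  qed
  moreover have "\<alpha> \<inter> mpolys M n = \<beta>"
  proof -
    have sub: "mpolys M n \<subseteq> mpolys UNIV n" by (auto simp: mpolys_def)
    interpret b: cone_on "mpolys M n" \<beta>
      using comp mpolys_subring by unfold_locales (auto simp: compatible_cone_def)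
    have "g \<in> \<alpha> \<longleftrightarrow> g \<in> \<beta>" if g: "g \<in> mpolys M n" for g
    proof
      assume "g \<in> \<beta>"
      then have "cone_sg \<beta> g \<ge> 0" by (simp add: cone_sg_def)
      have "0 \<le> mpoly_value n id y g" if "sg (mpoly_value n id y g) = cone_sg \<beta> g" for y
        using sg_simps(9)[of "mpoly_value n id y g"] unfolding that using \<open>cone_sg \<beta> g \<ge> 0\<close> by blast
      then have "S g \<subseteq> nn g" unfolding S_def nn_def by blast
      then have "nn g \<in> U" using up U(1) g by blast
      then show "g \<in> \<alpha>" using g sub by (auto simp: \<alpha>_def)
    next
      assume "g \<in> \<alpha>"
      then have "nn g \<inter> S g \<in> U" using U(1,3) g by (auto simp: \<alpha>_def)
      then have "nn g \<inter> S g \<noteq> {}" using U(2) by metis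
      then obtain y where "0 \<le> mpoly_value n id y g" "sg (mpoly_value n id y g) = cone_sg \<beta> g"
        by (auto simp: S_def nn_def)
      then have "cone_sg \<beta> g \<ge> 0" using sg_simps(9)[of "mpoly_value n id y g"] by simp
      then show "g \<in> \<beta>" by (auto simp: cone_sg_def supp_iff split: if_splits)
    qed
    then show ?thesis using b.coneD(1) by blast
  qed
  ultimately show ?thesis unfolding Spec_r_def by blast
qed

section \<open>Quotients by a prime cone\<close>

lemma ring_hom_oring_of: "ring_hom (oring_of A) S = ring_hom (ring_of A) S"
  by (auto simp: ring_hom_def)

lemma subring_oring_of_UNIV:
  assumes "subring M (oring_of (UNIV :: 'r::linordered_field set))"
  shows "subring_set M"
proof -
  interpret U: cring "oring_of (UNIV :: 'r set)"
  proof (rule cringI)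
    show "abelian_group (oring_of (UNIV :: 'r set))"
    proof (rule abelian_groupI)
      show "\<exists>y\<in>carrier (oring_of UNIV). y \<oplus>\<^bsub>oring_of UNIV\<^esub> x = \<zero>\<^bsub>oring_of UNIV\<^esub>" for x :: 'r
        by (auto intro!: exI[of _ "- x"])
    qed (auto simp: algebra_simps)
    show "Group.comm_monoid (oring_of (UNIV :: 'r set))"
      by (rule comm_monoidI) (auto simp: algebra_simps)
  qed (simp add: algebra_simps)
  have neg: "\<ominus>\<^bsub>oring_of UNIV\<^esub> x = - x" for x :: 'r
    by (rule U.sum_zero_eq_neg[symmetric]) auto
  show ?thesis
    using subringE[OF assms] unfolding subring_set_def neg by auto
qed

context cone_on
begin

text \<open>\<open>S\<close> is, up to isomorphism, the ring \<open>A / supp(\<alpha>)\<close> with the order induced by \<open>\<alpha>\<close>, and \<open>\<psi>\<close> is the residue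
  map. This treats \<open>residue_ring\<close> together with its copies on other types.\<close>
definition presents :: "('s, 't) oring_scheme \<Rightarrow> ('a \<Rightarrow> 's) \<Rightarrow> bool" where
  "presents S \<psi> \<longleftrightarrow> carrier S = \<psi> ` A \<and> \<psi> \<in> ring_hom (ring_of A) S \<and> \<psi> 0 = \<zero>\<^bsub>S\<^esub> \<and>
     (\<forall>p\<in>A. \<forall>q\<in>A. (\<psi> p = \<psi> q \<longleftrightarrow> p - q \<in> supp \<alpha>) \<and> (leq S (\<psi> p) (\<psi> q) \<longleftrightarrow> q - p \<in> \<alpha>))"

lemma presentsD:
  assumes "presents S \<psi>"
  shows "carrier S = \<psi> ` A" "\<psi> \<in> ring_hom (ring_of A) S" "\<psi> 0 = \<zero>\<^bsub>S\<^esub>" "\<psi> 1 = \<one>\<^bsub>S\<^esub>"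
    "p \<in> A \<Longrightarrow> q \<in> A \<Longrightarrow> \<psi> p \<oplus>\<^bsub>S\<^esub> \<psi> q = \<psi> (p + q)" "p \<in> A \<Longrightarrow> q \<in> A \<Longrightarrow> \<psi> p \<otimes>\<^bsub>S\<^esub> \<psi> q = \<psi> (p * q)"
    "p \<in> A \<Longrightarrow> q \<in> A \<Longrightarrow> \<psi> p = \<psi> q \<longleftrightarrow> p - q \<in> supp \<alpha>"
    "p \<in> A \<Longrightarrow> q \<in> A \<Longrightarrow> leq S (\<psi> p) (\<psi> q) \<longleftrightarrow> q - p \<in> \<alpha>"
    "p \<in> A \<Longrightarrow> \<psi> p = \<zero>\<^bsub>S\<^esub> \<longleftrightarrow> p \<in> supp \<alpha>"
proof -
  have "\<psi> p = \<psi> q \<longleftrightarrow> p - q \<in> supp \<alpha>" if "p \<in> A" "q \<in> A" for p q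
    using assms that unfolding presents_def by blast
  from this[OF _ AD(1)] show "p \<in> A \<Longrightarrow> \<psi> p = \<zero>\<^bsub>S\<^esub> \<longleftrightarrow> p \<in> supp \<alpha>"
    using assms unfolding presents_def by auto
qed (use assms in \<open>auto simp: presents_def ring_hom_def\<close>)

lemma presents_cring:
  assumes S: "presents S \<psi>"
  shows "cring S"
proof -
  note P = presentsD[OF S]
  show ?thesis
  proof (rule cringI)
    show "abelian_group S"
    proof (rule abelian_groupI)
      fix x assume "x \<in> carrier S"
      then obtain p where p: "p \<in> A" "x = \<psi> p" unfolding P(1) by blast
      then have "\<psi> (- p) \<oplus>\<^bsub>S\<^esub> x = \<zero>\<^bsub>S\<^esub>" using AD(3) by (simp add: P(5) P(3))
      then show "\<exists>y\<in>carrier S. y \<oplus>\<^bsub>S\<^esub> x = \<zero>\<^bsub>S\<^esub>" using p AD(3) unfolding P(1) by blast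
    qed (auto simp: P(1,5) AD add_ac simp flip: P(3))
    show "Group.comm_monoid S"
      by (rule comm_monoidI) (auto simp: P(1,6) AD mult_ac simp flip: P(4))
  qed (auto simp: P(1,5,6) AD algebra_simps)
qed

lemma presents_ordered_cring:
  assumes S: "presents S \<psi>"
  shows "ordered_cring S"
proof -
  note P = presentsD[OF S]
  interpret cring S by (rule presents_cring[OF S])
  show ?thesis
  proof
    fix a assume "a \<in> carrier S"
    then obtain p where p: "p \<in> A" "a = \<psi> p" unfolding P(1) by blast
    show "leq S a a" using p by (simp add: P(8) zero_in)
    fix b assume "b \<in> carrier S"
    then obtain q where q: "q \<in> A" "b = \<psi> q" unfolding P(1) by blast
    show "leq S a b \<or> leq S b a"
      using p q coneD(6)[of "q - p"] AD(6) by (simp add: P(8))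
    show "a = b" if "leq S a b" "leq S b a"
      using that p q by (simp add: P(7,8) supp_iff)
    show "leq S \<zero>\<^bsub>S\<^esub> (a \<otimes>\<^bsub>S\<^esub> b)" if "leq S \<zero>\<^bsub>S\<^esub> a" "leq S \<zero>\<^bsub>S\<^esub> b"
      using that p q AD coneD(3)[of p q] by (simp add: P(6,8) flip: P(3))
    fix c assume "c \<in> carrier S"
    then obtain r where r: "r \<in> A" "c = \<psi> r" unfolding P(1) by blast
    show "leq S a c" if "leq S a b" "leq S b c"
      using that p q r coneD(2)[of "q - p" "r - q"] by (simp add: P(8))
    show "leq S (a \<oplus>\<^bsub>S\<^esub> c) (b \<oplus>\<^bsub>S\<^esub> c)" if "leq S a b"
      using that p q r AD by (simp add: P(5,8))
  qed
qed

lemma presents_discretely_ordered_ring: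
  assumes S: "presents S \<psi>" and disc: "\<And>g. g \<in> A \<Longrightarrow> g \<in> \<alpha> \<Longrightarrow> g \<notin> supp \<alpha> \<Longrightarrow> g - 1 \<in> \<alpha>"
  shows "discretely_ordered_ring S"
proof -
  note P = presentsD[OF S]
  interpret ordered_cring S by (rule presents_ordered_cring[OF S])
  show ?thesis
  proof
    show "\<not> (\<exists>a\<in>carrier S. leq S \<zero>\<^bsub>S\<^esub> a \<and> a \<noteq> \<zero>\<^bsub>S\<^esub> \<and> leq S a \<one>\<^bsub>S\<^esub> \<and> a \<noteq> \<one>\<^bsub>S\<^esub>)"
    proof (intro notI, elim bexE conjE)
      fix a assume a: "a \<in> carrier S" "leq S \<zero>\<^bsub>S\<^esub> a" "a \<noteq> \<zero>\<^bsub>S\<^esub>" "leq S a \<one>\<^bsub>S\<^esub>" "a \<noteq> \<one>\<^bsub>S\<^esub>"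
      then obtain p where p: "p \<in> A" "a = \<psi> p" unfolding P(1) by blast
      have "p \<in> \<alpha>" using a(2) p AD(1) by (simp add: P(8) flip: P(3))
      moreover have "p \<notin> supp \<alpha>" using a(3) p by (simp add: P(9))
      ultimately have "p - 1 \<in> \<alpha>" using disc p by blast
      moreover have "1 - p \<in> \<alpha>" using a(4) p AD(2) by (simp add: P(8) flip: P(4))
      ultimately have "p - 1 \<in> supp \<alpha>" by (simp add: supp_iff)
      then have "\<psi> p = \<psi> 1" using P(7)[OF p(1) AD(2)] by simp
      then show False using a(5) p by (simp add: P(4))
    qed
  qed
qed

text \<open>The residue ring can be put on any type that has room for the classes: the operations are defined through
  chosen representatives \<open>s u\<close>.\<close>
lemma quotient_exists:
  assumes eq: "\<And>p q. p \<in> A \<Longrightarrow> q \<in> A \<Longrightarrow> \<psi> p = \<psi> q \<longleftrightarrow> p - q \<in> supp \<alpha>"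
  shows "\<exists>S :: 's oring. presents S \<psi>"
proof -
  define s where "s u = (SOME p. p \<in> A \<and> \<psi> p = u)" for u
  have s: "s (\<psi> p) \<in> A \<and> \<psi> (s (\<psi> p)) = \<psi> p" if "p \<in> A" for p
    unfolding s_def by (rule someI[of _ p]) (use that in simp)
  have sp: "s (\<psi> p) \<in> A" "s (\<psi> p) - p \<in> supp \<alpha>" if "p \<in> A" for p
    using s[OF that] eq[of "s (\<psi> p)" p] that by auto
  define S where "S = \<lparr>carrier = \<psi> ` A, monoid.mult = \<lambda>u v. \<psi> (s u * s v), monoid.one = \<psi> 1,
    ring.zero = \<psi> 0, ring.add = \<lambda>u v. \<psi> (s u + s v), leq = \<lambda>u v. s v - s u \<in> \<alpha>\<rparr>"
  have add: "\<psi> (s (\<psi> p) + s (\<psi> q)) = \<psi> (p + q)" if "p \<in> A" "q \<in> A" for p q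
  proof -
    \<comment> \<open>The operations on representatives do not depend on their choice, since the support is an ideal.\<close>
    have "(s (\<psi> p) + s (\<psi> q)) - (p + q) = (s (\<psi> p) - p) + (s (\<psi> q) - q)" by simp
    then show ?thesis using eq[of "s (\<psi> p) + s (\<psi> q)" "p + q"] sp that AD(4) supp_add by metis
  qed
  have mult: "\<psi> (s (\<psi> p) * s (\<psi> q)) = \<psi> (p * q)" if pq: "p \<in> A" "q \<in> A" for p q
  proof -
    have "s (\<psi> p) * s (\<psi> q) - p * q = s (\<psi> q) * (s (\<psi> p) - p) + p * (s (\<psi> q) - q)"
      by (simp add: algebra_simps)
    also have "\<dots> \<in> supp \<alpha>" using sp pq by (intro supp_add supp_mult) auto
    finally show ?thesis using eq[of "s (\<psi> p) * s (\<psi> q)" "p * q"] sp pq AD(5) by simp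
  qed
  have le: "s (\<psi> q) - s (\<psi> p) \<in> \<alpha> \<longleftrightarrow> q - p \<in> \<alpha>" if pq: "p \<in> A" "q \<in> A" for p q
  proof (rule cone_cong)
    have "(s (\<psi> q) - s (\<psi> p)) - (q - p) = (s (\<psi> q) - q) - (s (\<psi> p) - p)" by simp
    then show "(s (\<psi> q) - s (\<psi> p)) - (q - p) \<in> supp \<alpha>" using sp pq supp_diff by metis
  qed
  have "presents S \<psi>"
    unfolding presents_def S_def ring_hom_def using add mult le eq by auto
  then show ?thesis by blast
qed

lemma supp_ideal: "ideal (supp \<alpha>) (ring_of A)"
proof (rule idealI)
  interpret G: cring "ring_of A" by (rule cring_ring_of[OF ring])
  show "ring (ring_of A)" ..
  have "\<ominus>\<^bsub>ring_of A\<^esub> p = - p" if "p \<in> A" for p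
    by (rule G.sum_zero_eq_neg[symmetric]) (use that AD in auto)
  then show "subgroup (supp \<alpha>) (add_monoid (ring_of A))"
    by (intro G.add.subgroupI) (use supp_in supp_zero supp_minus supp_add in \<open>auto simp: a_inv_def[symmetric]\<close>)
next
  fix a x assume "a \<in> supp \<alpha>" "x \<in> carrier (ring_of A)"
  then have "x * a \<in> supp \<alpha>" by (simp add: supp_mult)
  then show "x \<otimes>\<^bsub>ring_of A\<^esub> a \<in> supp \<alpha>" "a \<otimes>\<^bsub>ring_of A\<^esub> x \<in> supp \<alpha>"
    by (simp_all add: mult.commute)
qed

lemma residue_class_eq_iff:
  "residue_class A \<alpha> p = residue_class A \<alpha> q \<longleftrightarrow> p - q \<in> supp \<alpha>"
proof -
  have c: "residue_class A \<alpha> p = (\<lambda>h. h + p) ` supp \<alpha>" for p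
    by (auto simp: residue_class_def a_r_coset_def')
  show ?thesis
  proof
    assume "residue_class A \<alpha> p = residue_class A \<alpha> q"
    then have "0 + p \<in> (\<lambda>h. h + q) ` supp \<alpha>" using supp_zero unfolding c by blast
    then show "p - q \<in> supp \<alpha>" by (auto simp: algebra_simps)
  next
    have *: "residue_class A \<alpha> p \<subseteq> residue_class A \<alpha> q" if "p - q \<in> supp \<alpha>" for p q
    proof
      fix x assume "x \<in> residue_class A \<alpha> p"
      then obtain h where h: "h \<in> supp \<alpha>" "x = h + p" unfolding c by blast
      then have "x = (h + (p - q)) + q" by simp
      then show "x \<in> residue_class A \<alpha> q" unfolding c using supp_add[OF h(1) that] by blast
    qed
    assume "p - q \<in> supp \<alpha>"
    then show "residue_class A \<alpha> p = residue_class A \<alpha> q" using *[of p q] *[of q p] supp_minus[of "p - q"] by auto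
  qed
qed

lemma presents_residue_ring: "presents (residue_ring A \<alpha>) (residue_class A \<alpha>)"
proof -
  interpret I: ideal "supp \<alpha>" "ring_of A" by (rule supp_ideal)
  have car: "carrier (residue_ring A \<alpha>) = residue_class A \<alpha> ` A"
    by (auto simp: residue_ring_def ring.defs FactRing_def A_RCOSETS_def' residue_class_def)
  have zero: "residue_class A \<alpha> 0 = \<zero>\<^bsub>residue_ring A \<alpha>\<^esub>"
    by (auto simp: residue_ring_def ring.defs FactRing_def residue_class_def a_r_coset_def')
  have hom: "residue_class A \<alpha> \<in> ring_hom (ring_of A) (residue_ring A \<alpha>)"
    using I.rcos_ring_hom
    by (simp add: residue_ring_def ring.defs ring_hom_def residue_class_def[abs_def])
  have le: "leq (residue_ring A \<alpha>) (residue_class A \<alpha> p) (residue_class A \<alpha> q) \<longleftrightarrow> q - p \<in> \<alpha>"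
    if "p \<in> A" "q \<in> A" for p q
  proof -
    have "leq (residue_ring A \<alpha>) (residue_class A \<alpha> p) (residue_class A \<alpha> q) \<longleftrightarrow>
       (\<exists>h\<in>supp \<alpha>. \<exists>k\<in>supp \<alpha>. (k + q) - (h + p) \<in> \<alpha>)"
      by (auto simp: residue_ring_def ring.defs oring.defs residue_class_def a_r_coset_def')
    moreover have "(k + q) - (h + p) \<in> \<alpha> \<longleftrightarrow> q - p \<in> \<alpha>" if "h \<in> supp \<alpha>" "k \<in> supp \<alpha>" for h k
      using that supp_diff[of k h] by (intro cone_cong) (simp add: algebra_simps)
    ultimately show ?thesis using supp_zero by blast
  qed
  show ?thesis unfolding presents_def by (intro conjI ballI car zero hom le residue_class_eq_iff)
qed

end

lemma cring_of_real_closed: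
  "real_closed_ordered_field K \<Longrightarrow> cring K"
  by (simp add: real_closed_ordered_field_def ordered_cring_def)

text \<open>Under either alternative in the definition of \<open>residue_real_closure\<close> the map \<open>g \<mapsto> g(\<alpha>)\<close> is the residue map
  followed by an injective homomorphism of rings, so its kernel is the support of \<open>\<alpha>\<close>.\<close>
lemma residue_real_closure_hom:
  fixes \<alpha> :: "'r::linordered_field mpoly set"
  assumes \<alpha>: "\<alpha> \<in> Spec_r (mpolys UNIV n)"
  shows "cring (k_field n \<alpha>)" "k_value n \<alpha> \<in> ring_hom (ring_of (mpolys UNIV n)) (k_field n \<alpha>)"
    "g \<in> mpolys UNIV n \<Longrightarrow> k_value n \<alpha> g = \<zero>\<^bsub>k_field n \<alpha>\<^esub> \<longleftrightarrow> g \<in> supp \<alpha>"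
proof -
  let ?A = "mpolys UNIV n :: 'r mpoly set"
  interpret c: cone_on ?A \<alpha>
    using \<alpha> mpolys_subring[OF subring_set_UNIV] by unfold_locales (auto simp: Spec_r_def)
  let ?D = "residue_ring ?A \<alpha>"
  note P = c.presentsD[OF c.presents_residue_ring]
  have D: "cring ?D" by (rule c.presents_cring[OF c.presents_residue_ring])
  define k where "k = residue_real_closure n \<alpha>"
  have k: "cring (fst k) \<and> snd k \<in> ring_hom ?D (fst k) \<and> inj_on (snd k) (carrier ?D)"
  proof (cases "\<exists>k. real_closure_of_fractions ?D (k :: 'r mpoly set oring \<times> ('r mpoly set \<Rightarrow> 'r mpoly set))")
    case True
    then have "k = (SOME k. real_closure_of_fractions ?D k)" by (simp add: k_def residue_real_closure_def)
    then have "real_closure_of_fractions ?D k" using someI_ex[OF True] by simp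
    then show ?thesis
      by (auto simp: real_closure_of_fractions_def ordered_ring_embedding_def case_prod_beta intro: cring_of_real_closed)
  next
    case False
    then have "k = (?D, id)" by (simp add: k_def residue_real_closure_def)
    then show ?thesis using D by (simp add: ring_hom_def)
  qed
  have val: "k_value n \<alpha> g = snd k (residue_class ?A \<alpha> g)" for g by (simp add: k_value_def k_def)
  show "cring (k_field n \<alpha>)" using k by (simp add: k_def)
  show "k_value n \<alpha> \<in> ring_hom (ring_of ?A) (k_field n \<alpha>)"
    using k ring_hom_trans[OF P(2), of "snd k" "fst k"] unfolding val[abs_def] k_def[symmetric] comp_def by blast
  have "snd k \<zero>\<^bsub>?D\<^esub> = \<zero>\<^bsub>fst k\<^esub>"
    using k D by (intro ring_hom_zero) (auto simp: cring_def)
  moreover have "\<zero>\<^bsub>?D\<^esub> \<in> carrier ?D" using D by (simp add: cring.cring_simprules(2))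
  ultimately show "k_value n \<alpha> g = \<zero>\<^bsub>k_field n \<alpha>\<^esub> \<longleftrightarrow> g \<in> supp \<alpha>" if "g \<in> ?A"
    using k that P(1) P(9)[OF that] unfolding val k_def[symmetric]
    by (metis (no_types, lifting) imageI inj_onD)
qed

lemma tilde_zero_set_iff:
  fixes f :: "'r::linordered_field mpoly"
  assumes f: "f \<in> mpolys UNIV n"
  shows "\<alpha> \<in> tilde_zero_set n f \<longleftrightarrow> \<alpha> \<in> Spec_r (mpolys UNIV n) \<and> f \<in> supp \<alpha>"
proof (cases "\<alpha> \<in> Spec_r (mpolys UNIV n)")
  case True
  note k = residue_real_closure_hom[OF True]
  have "mpoly_eval (k_field n \<alpha>) n (\<lambda>c. k_value n \<alpha> (Const c)) f (\<lambda>i. k_value n \<alpha> (Var i)) = k_value n \<alpha> f"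
    by (rule cring.ring_hom_mpoly_eval[OF k(1) subring_set_UNIV k(2) f]) auto
  then show ?thesis using True k(3)[OF f] by (simp add: tilde_zero_set_def)
qed (simp add: tilde_zero_set_def)

section \<open>Arithmetical points and solutions\<close>

lemma mpolys_mono: "M \<subseteq> M' \<Longrightarrow> mpolys M n \<subseteq> mpolys M' n"
  by (auto simp: mpolys_def)

lemma Const_minus: "Const (c - d) = Const c - Const d" "Const 0 = 0"
  by (simp_all add: Const_def single_diff)

lemma Const_eq_0_iff: "Const c = 0 \<longleftrightarrow> c = 0"
  unfolding Const_def by (metis lookup_single_eq lookup_zero single_zero)

text \<open>The ring is \<open>M[X] / supp(\<beta>)\<close> for \<open>\<beta> = \<alpha> \<inter> M[X]\<close>, on the first summand of the type. The conditions
  that a discrete prime cone satisfies on constants make \<open>M\<close> an ordered subring, and the classes of the variables are a solution.\<close>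
lemma solvable_if_arithmetical_point:
  fixes M :: "'r::linordered_field set" and f :: "'r mpoly"
  assumes M: "subring_set M" and f: "f \<in> mpolys M n"
    and \<alpha>: "\<alpha> \<in> tilde_zero_set n f" "arithmetical_point M n \<alpha>"
  shows "\<exists>N :: ('r mpoly set + 'c) oring. discretely_ordered_ring N \<and> solvable_in_extension M n f N"
proof -
  define A where "A = mpolys M n"
  define \<beta> where "\<beta> = \<alpha> \<inter> A"
  have A: "subring_set A" unfolding A_def by (rule mpolys_subring[OF M])
  have d: "prime_cone A \<beta>" "\<And>c. c \<in> M \<Longrightarrow> 0 \<le> c \<Longrightarrow> Const c \<in> \<beta>"
    "Const ` {m \<in> M. 0 \<le> m} \<inter> supp \<beta> = {0}"
    "\<And>g. g \<in> A \<Longrightarrow> g \<in> \<beta> \<Longrightarrow> g \<notin> supp \<beta> \<Longrightarrow> g - 1 \<in> \<beta>"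
    using \<alpha>(2) unfolding arithmetical_point_def discrete_prime_cone_def A_def[symmetric] \<beta>_def[symmetric] Spec_r_def
    by auto
  interpret b: cone_on A \<beta> by unfold_locales (rule A, rule d(1))
  define \<psi> :: "'r mpoly \<Rightarrow> 'r mpoly set + 'c" where "\<psi> p = Inl (residue_class A \<beta> p)" for p
  obtain N :: "('r mpoly set + 'c) oring" where N: "b.presents N \<psi>"
    using b.quotient_exists[of \<psi>] b.residue_class_eq_iff by (auto simp: \<psi>_def)
  note P = b.presentsD[OF N]
  have Cin: "Const c \<in> A" if "c \<in> M" for c using that unfolding A_def by (rule Const_in_mpolys)
  have Csupp: "c = 0" if "c \<in> M" "0 \<le> c" "Const c \<in> supp \<beta>" for c
  proof -
    have "Const c \<in> {0}" unfolding d(3)[symmetric] using that by blast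
    then show ?thesis by (simp add: Const_eq_0_iff)
  qed
  have Cle: "Const d - Const c \<in> \<beta> \<longleftrightarrow> c \<le> d" if cd: "c \<in> M" "d \<in> M" for c d
  proof
    assume "c \<le> d"
    then show "Const d - Const c \<in> \<beta>" using d(2)[of "d - c"] subring_setD(6)[OF M] cd by (simp add: Const_minus)
  next
    assume dc: "Const d - Const c \<in> \<beta>"
    show "c \<le> d"
    proof (rule ccontr)
      assume "\<not> c \<le> d"
      then have "0 \<le> c - d" "c - d \<in> M" using subring_setD(6)[OF M] cd by auto
      moreover from this have "Const (c - d) \<in> supp \<beta>" using d(2)[of "c - d"] dc by (simp add: supp_iff Const_minus)
      ultimately show False using Csupp[of "c - d"] \<open>\<not> c \<le> d\<close> by auto
    qed
  qed
  define j where "j c = \<psi> (Const c)" for c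
  define x where "x i = \<psi> (Var i)" for i
  have emb: "ordered_ring_embedding (oring_of M) N j"
    unfolding ordered_ring_embedding_def ring_hom_oring_of
  proof (intro conjI ballI)
    note C = hom_onD[OF subring_set_UNIV hom_on_Const]
    show "j \<in> ring_hom (ring_of M) N"
      by (rule ring_hom_memI) (auto simp: j_def P(1,4,5,6) Cin C)
    have le: "leq N (j c) (j d) \<longleftrightarrow> c \<le> d" if "c \<in> M" "d \<in> M" for c d
      using that Cle by (simp add: j_def P(8) Cin)
    then show "leq N (j c) (j d) \<longleftrightarrow> leq (oring_of M) c d" if "c \<in> carrier (oring_of M)" "d \<in> carrier (oring_of M)" for c d
      using that by simp
    show "inj_on j (carrier (oring_of M))"
    proof (rule inj_onI)
      fix c d assume cd: "c \<in> carrier (oring_of M)" "d \<in> carrier (oring_of M)" "j c = j d"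
      have "c \<le> d" using le[of c d] le[of c c] cd by simp
      moreover have "d \<le> c" using le[of d c] le[of c c] cd by simp
      ultimately show "c = d" by simp
    qed
  qed
  have "f \<in> supp \<beta>"
  proof -
    have "f \<in> supp \<alpha>" using \<alpha>(1) tilde_zero_set_iff[of f n \<alpha>] f mpolys_mono[of M UNIV n] by blast
    moreover have "f \<in> A" using f by (simp add: A_def)
    ultimately show ?thesis using b.AD(3) by (simp add: supp_iff \<beta>_def)
  qed
  then have "\<psi> f = \<zero>\<^bsub>N\<^esub>" using f P(9) by (simp add: A_def)
  moreover have "mpoly_eval N n j f x = \<psi> f"
    by (rule cring.ring_hom_mpoly_eval[OF b.presents_cring[OF N] M P(2)[unfolded A_def] f])
      (simp_all add: j_def x_def)
  moreover have "x \<in> {..<n} \<rightarrow> carrier N"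
    using Var_in_mpolys[OF M] by (auto simp: x_def P(1) A_def)
  moreover have "discretely_ordered_ring N"
    using N d(4) by (rule b.presents_discretely_ordered_ring)
  ultimately show ?thesis unfolding solvable_in_extension_def using emb by auto
qed

context ordered_cring
begin

lemma nonneg_minus: "a \<in> carrier R \<Longrightarrow> a \<preceq> \<zero> \<Longrightarrow> \<zero> \<preceq> \<ominus> a"
  using leq_add[of a "\<zero>" "\<ominus> a"] by (simp add: r_neg)

lemma nonneg_add: 
  assumes "a \<in> carrier R" "b \<in> carrier R" "\<zero> \<preceq> a" "\<zero> \<preceq> b" 
  shows "\<zero> \<preceq> a \<oplus> b"
proof -
  have "\<zero> \<oplus> b \<preceq> a \<oplus> b" using assms by (intro leq_add) auto
  then show ?thesis using assms leq_trans[of "\<zero>" b "a \<oplus> b"] by simp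
qed

lemma nonneg_or_minus: "a \<in> carrier R \<Longrightarrow> \<zero> \<preceq> a \<or> \<zero> \<preceq> \<ominus> a"
  using leq_total[of "\<zero>" a] nonneg_minus by auto

lemma square_nonneg: "a \<in> carrier R \<Longrightarrow> \<zero> \<preceq> a \<otimes> a"
  using nonneg_or_minus[of a] leq_mult[of a a] leq_mult[of "\<ominus> a" "\<ominus> a"] by (auto simp: l_minus r_minus)

lemma nonneg_antisym: "a \<in> carrier R \<Longrightarrow> \<zero> \<preceq> a \<Longrightarrow> \<zero> \<preceq> \<ominus> a \<Longrightarrow> a = \<zero>"
  using leq_add[of "\<zero>" "\<ominus> a" a] leq_antisym[of a "\<zero>"] by (simp add: l_neg)

lemma one_nonneg: "\<zero> \<preceq> \<one>"
  using square_nonneg[of "\<one>"] by simp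

end

context discretely_ordered_ring
begin

lemma positive_ge_one:
  assumes "a \<in> carrier R" "\<zero> \<preceq> a" "a \<noteq> \<zero>"
  shows "\<zero> \<preceq> a \<ominus> \<one>"
proof -
  have "\<one> \<preceq> a" using discrete leq_total[of "\<one>" a] leq_refl[of "\<one>"] assms by auto
  then have "\<one> \<oplus> \<ominus> \<one> \<preceq> a \<oplus> \<ominus> \<one>" using assms by (intro leq_add) auto
  then show ?thesis by (simp add: r_neg minus_eq)
qed

text \<open>The order axioms allow products of positive elements to vanish; discreteness excludes this. If \<open>a\<close> is negative and
  \<open>b\<close> positive, then \<open>- a - 1\<close> and \<open>b - 1\<close> are non-negative, hence so is
  \<open>(- a - 1) (b - 1) + (- a - 1) + (b - 1) = - a b - 1\<close>, and \<open>a b \<ge> 0\<close> would imply \<open>- 1 \<ge> 0\<close>.\<close>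
lemma product_of_negative_and_positive:
  assumes ab: "a \<in> carrier R" "b \<in> carrier R" and nt: "\<one> \<noteq> \<zero>"
    and a: "\<not> \<zero> \<preceq> a" and b: "\<not> \<zero> \<preceq> \<ominus> b"
  shows "\<not> \<zero> \<preceq> a \<otimes> b"
proof
  assume ge: "\<zero> \<preceq> a \<otimes> b"
  have "\<zero> \<preceq> \<ominus> a" "\<zero> \<preceq> b" using a b nonneg_or_minus ab by blast+
  moreover have "\<ominus> a \<noteq> \<zero>" "b \<noteq> \<zero>" using a b ab leq_refl[of "\<zero>"] minus_minus[of a] by force+
  ultimately have ge1: "\<zero> \<preceq> \<ominus> a \<ominus> \<one>" "\<zero> \<preceq> b \<ominus> \<one>"
    using positive_ge_one ab by auto
  have h1: "\<zero> \<preceq> (\<ominus> a \<ominus> \<one>) \<otimes> (b \<ominus> \<one>)" using ge1 ab by (intro leq_mult) auto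
  have h2: "\<zero> \<preceq> (\<ominus> a \<ominus> \<one>) \<oplus> (b \<ominus> \<one>)" using ge1 ab by (intro nonneg_add) auto
  have "\<zero> \<preceq> ((\<ominus> a \<ominus> \<one>) \<otimes> (b \<ominus> \<one>) \<oplus> ((\<ominus> a \<ominus> \<one>) \<oplus> (b \<ominus> \<one>))) \<oplus> a \<otimes> b"
    by (rule nonneg_add[OF _ _ nonneg_add[OF _ _ h1 h2] ge]) (use ab in auto)
  also have "((\<ominus> a \<ominus> \<one>) \<otimes> (b \<ominus> \<one>) \<oplus> ((\<ominus> a \<ominus> \<one>) \<oplus> (b \<ominus> \<one>))) \<oplus> a \<otimes> b = \<ominus> \<one>"
    using ab by algebra
  finally have "\<zero> \<preceq> \<ominus> \<one>" .
  then show False using nonneg_antisym[OF _ one_nonneg] nt by simp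
qed

end

text \<open>The polynomials over \<open>M\<close> that are non-negative at the solution form an \<open>M\<close>-discrete prime cone \<open>\<beta>\<close> with \<open>f\<close> in
  its support, and \<open>cone_extends\<close> provides the point \<open>\<alpha>\<close>.\<close>
lemma arithmetical_point_if_solvable:
  fixes M :: "'r::linordered_field set" and f :: "'r mpoly" and N :: "'u oring"
  assumes ivp: "has_ivp TYPE('r)" and M: "subring_set M" and f: "f \<in> mpolys M n"
    and disc: "discretely_ordered_ring N" and sol: "solvable_in_extension M n f N"
  shows "\<exists>\<alpha>\<in>tilde_zero_set n f. arithmetical_point M n \<alpha>"
proof -
  interpret N: discretely_ordered_ring N by (rule disc)
  obtain j x where j: "ordered_ring_embedding (oring_of M) N j" and x: "x \<in> {..<n} \<rightarrow> carrier N"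
    and fx: "mpoly_eval N n j f x = \<zero>\<^bsub>N\<^esub>"
    using sol unfolding solvable_in_extension_def by blast
  have jh: "j \<in> ring_hom (ring_of M) N" using j by (simp add: ordered_ring_embedding_def ring_hom_oring_of)
  have jle: "leq N (j c) (j d) \<longleftrightarrow> c \<le> d" and jinj: "j c = j d \<longleftrightarrow> c = d" if "c \<in> M" "d \<in> M" for c d
    using j that unfolding ordered_ring_embedding_def inj_on_def by auto
  note jf = N.ring_hom_facts[OF M jh]
  define A where "A = mpolys M n"
  have A: "subring_set A" unfolding A_def by (rule mpolys_subring[OF M])
  note AD = subring_setD[OF A]
  define \<phi> where "\<phi> p = mpoly_eval N n j p x" for p
  have \<phi>h: "\<phi> \<in> ring_hom (ring_of A) N" unfolding \<phi>_def[abs_def] A_def by (rule N.mpoly_eval_ring_hom[OF M jh x])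
  note \<phi> = N.ring_hom_facts[OF A \<phi>h]
  have \<phi>m: "\<phi> (- p) = \<ominus>\<^bsub>N\<^esub> \<phi> p" if "p \<in> A" for p
    using \<phi>(2)[OF AD(3)[OF that] that] \<phi>(1) AD(3) that \<phi>(5) by (intro N.sum_zero_eq_neg) auto
  have \<phi>C: "\<phi> (Const c) = j c" if "c \<in> M" for c
    unfolding \<phi>_def by (rule N.mpoly_eval_Const[OF M jh x that])
  have nt: "\<one>\<^bsub>N\<^esub> \<noteq> \<zero>\<^bsub>N\<^esub>"
    using jinj[of 1 0] subring_setD(1,2)[OF M] jf(4,5) by auto
  define \<beta> where "\<beta> = {p \<in> A. leq N \<zero>\<^bsub>N\<^esub> (\<phi> p)}"
  have cone: "prime_cone A \<beta>"
    unfolding prime_cone_def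
  proof (intro conjI ballI impI)
    show "\<beta> \<subseteq> A" by (auto simp: \<beta>_def)
    show "p + q \<in> \<beta>" "p * q \<in> \<beta>" if "p \<in> \<beta>" "q \<in> \<beta>" for p q
      using that AD \<phi> N.nonneg_add N.leq_mult by (auto simp: \<beta>_def)
    show "p * p \<in> \<beta>" if "p \<in> A" for p
      using that AD \<phi> N.square_nonneg by (auto simp: \<beta>_def)
    show "- 1 \<notin> \<beta>"
      using N.nonneg_antisym[OF N.one_closed N.one_nonneg] nt by (auto simp: \<beta>_def \<phi>m[OF AD(2)] \<phi>(4))
    show "p \<in> \<beta> \<or> - q \<in> \<beta>" if "p \<in> A" "q \<in> A" "p * q \<in> \<beta>" for p q
      using N.product_of_negative_and_positive[of "\<phi> p" "\<phi> q"] nt that AD(3)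
      by (auto simp: \<beta>_def \<phi>m \<phi>(1,3))
  qed
  have supp: "p \<in> supp \<beta> \<longleftrightarrow> \<phi> p = \<zero>\<^bsub>N\<^esub>" if p: "p \<in> A" for p
    using N.nonneg_antisym[of "\<phi> p"] N.leq_refl[of "\<zero>\<^bsub>N\<^esub>"] AD(3)[OF p] p
    by (auto simp: supp_iff \<beta>_def \<phi>m \<phi>(1))
  have Cin: "Const c \<in> A" if "c \<in> M" for c using that unfolding A_def by (rule Const_in_mpolys)
  have Cnonneg: "Const c \<in> \<beta>" if "c \<in> M" "0 \<le> c" for c
    using that jle[of 0 c] subring_setD(1)[OF M] Cin by (simp add: \<beta>_def \<phi>C jf(5))
  have Csupp: "Const c \<in> supp \<beta> \<longleftrightarrow> c = 0" if "c \<in> M" for c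
    using supp[OF Cin[OF that]] \<phi>C[OF that] jinj[OF that subring_setD(1)[OF M]] jf(5) by simp
  have "compatible_cone M n \<beta>"
    unfolding compatible_cone_def A_def[symmetric] using M cone Cnonneg Csupp by force
  from cone_extends[OF ivp this] obtain \<alpha>
    where \<alpha>: "\<alpha> \<in> Spec_r (mpolys UNIV n)" "\<alpha> \<inter> A = \<beta>" unfolding A_def by blast
  have "g - 1 \<in> \<beta>" if g: "g \<in> A" "g \<in> \<beta>" "g \<notin> supp \<beta>" for g
  proof -
    have "leq N \<zero>\<^bsub>N\<^esub> (\<phi> g \<ominus>\<^bsub>N\<^esub> \<one>\<^bsub>N\<^esub>)"
      using g supp by (intro N.positive_ge_one \<phi>(1)) (auto simp: \<beta>_def)
    moreover have "\<phi> (g - 1) = \<phi> g \<ominus>\<^bsub>N\<^esub> \<one>\<^bsub>N\<^esub>"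
      using \<phi>(2)[OF g(1) AD(3)[OF AD(2)]] \<phi>m[OF AD(2)] \<phi>(4) by (simp add: N.minus_eq)
    ultimately show ?thesis using AD(6)[OF g(1) AD(2)] by (simp add: \<beta>_def)
  qed
  moreover have "Const ` {m \<in> M. 0 \<le> m} \<inter> supp \<beta> = {0}"
    using Csupp subring_setD(1)[OF M] by (force simp: Const_minus(2) supp_iff Cnonneg)
  ultimately have "arithmetical_point M n \<alpha>"
    unfolding arithmetical_point_def discrete_prime_cone_def A_def[symmetric] \<alpha>(2)
    using \<alpha>(1) cone Cnonneg by (auto simp: Spec_r_def)
  moreover have "\<alpha> \<in> tilde_zero_set n f"
  proof -
    have "f \<in> supp \<beta>" using supp[of f] f fx by (simp add: A_def \<phi>_def)
    then have "f \<in> supp \<alpha>" using \<alpha>(2) by (auto simp: supp_iff)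
    then show ?thesis using \<alpha>(1) tilde_zero_set_iff[of f n \<alpha>] f mpolys_mono[of M UNIV n] by blast
  qed
  ultimately show ?thesis by blast
qed

theorem theorem3p17:
  fixes M :: "'r::linordered_field set" and n :: nat and f :: "'r mpoly"
  assumes "real_closed_ordered_field (oring_of (UNIV :: 'r set))"
    and "subring M (oring_of (UNIV :: 'r set))"
    and "discretely_ordered_ring (oring_of M)"
    and "f \<in> mpolys M n"
  shows "(\<exists>N :: ('r mpoly set + 'c) oring.
            discretely_ordered_ring N \<and> solvable_in_extension M n f N)
         \<longleftrightarrow> (\<exists>\<alpha> \<in> tilde_zero_set n f. arithmetical_point M n \<alpha>)"
proof -
  note ivp = real_closed_ordered_field_ivp[OF assms(1)] and M = subring_oring_of_UNIV[OF assms(2)]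
  show ?thesis
    using arithmetical_point_if_solvable[OF ivp M assms(4)] solvable_if_arithmetical_point[OF M assms(4)] by blast
qed

end
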